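(* For every Poincare duality algebra $\mathcal{A}^*$ over $\mathbb{R}$ generated in degree $2$ there exists a complete simplicial multi-fan $\Delta$ such that $\mathcal{A}^*\cong \mathcal{A}^*(\Delta)$.
   Context: A Poincare duality algebra of formal dimension $2n$ over a field $k$ is a finite-dimensional graded commutative $k$-algebra $\mathcal{A}^*=\bigoplus_{j=0}^n\mathcal{A}^{2j}$ together with an isomorphism $\int\colon\mathcal{A}^{2n}\to k$ such that the pairing $\mathcal{A}^{2p}\otimes\mathcal{A}^{2n-2p}\to k$, $a\otimes b\mapsto\int ab$, is non-degenerate. A complete simplicial multi-fan in an oriented real vector space $V\cong\mathbb{R}^n$ (with fixed inner product) is a pair $(w_{ch},\lambda)$, where $w_{ch}=\sum_{I\subset[m],|I|=n}w(I)I$ is a real simplicial $(n-1)$-cycle on the vertex set $[m]$ (in the $(n-1)$-skeleton of the simplex on $[m]$), and $\lambda\colon[m]\to V$ is a function such that $\{\lambda(i)\}_{i\in I}$ is a basis of $V$ whenever $|I|=n$ and $w(I)\neq0$. Its volume polynomial $V_\Delta\in\mathbb{R}[c_1,\ldots,c_m]$ is the homogeneous degree-$n$ polynomial whose value at $(c_1,\ldots,c_m)$ is the volume (integral of the Duistermaat--Heckman winding-number function) of the multi-polytope based on $\Delta$ with support hyperplanes $H_i=\{u\in V^*\mid\langle u,\lambda(i)\rangle=c_i\}$. The multi-fan algebra is $\mathcal{A}^*(\Delta)=\mathcal{D}/\mathrm{Ann}\,V_\Delta$, where $\mathcal{D}=\mathbb{R}[\partial_1,\ldots,\partial_m]$,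 $\partial_i=\partial/\partial c_i$ with $\deg\partial_i=2$, and $\mathrm{Ann}\,V_\Delta=\{D\in\mathcal{D}\mid DV_\Delta=0\}$; it is a Poincare duality algebra of formal dimension $2n$. *)

theory Defs
  imports
    "HOL-Analysis.Analysis"
    "HOL-Algebra.Algebraic_Closure_Type"
    "HOL-Library.Poly_Mapping"
begin

section \<open>Poincare duality algebras over the reals\<close>

abbreviation real_field :: "real ring" where
  "real_field \<equiv> ring_of_type_algebra"

text \<open>
  The family \<open>gr\<close> is indexed by the actual degree, so the nonzero pieces sit in the even
  degrees \<open>0, 2, \<dots>, 2 n\<close>; as there is nothing in odd degrees, graded commutative means
  commutative. The functional \<open>intg\<close> matters only on the top piece \<open>gr (2 * n)\<close>.
\<close>

locale poincare_duality_algebra =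
  Module.algebra real_field A for A :: "(real, 'a) module" (structure) +
  fixes n :: nat and gr :: "nat \<Rightarrow> 'a set" and intg :: "'a \<Rightarrow> real"
  assumes finite_dim:
      "\<exists>S. finite S \<and> S \<subseteq> carrier A \<and>
        (\<forall>x\<in>carrier A. \<exists>r :: 'a \<Rightarrow> real. x = (\<Oplus>s\<in>S. r s \<odot> s))"
    and gr_submodule: "\<And>d. submodule (gr d) real_field A"
    and gr_trivial: "\<And>d. odd d \<or> d > 2 * n \<Longrightarrow> gr d = {\<zero>}"
    and gr_direct_sum:
      "\<And>x. x \<in> carrier A \<Longrightarrow>
        \<exists>!f. f \<in> (\<Pi>\<^sub>E j\<in>{..n}. gr (2 * j)) \<and> x = (\<Oplus>j\<in>{..n}. f j)"
    and gr_one: "\<one> \<in> gr 0"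
    and gr_mult: "\<And>d e x y. x \<in> gr d \<Longrightarrow> y \<in> gr e \<Longrightarrow> x \<otimes> y \<in> gr (d + e)"
    and intg_add:
      "\<And>x y. x \<in> gr (2 * n) \<Longrightarrow> y \<in> gr (2 * n) \<Longrightarrow> intg (x \<oplus> y) = intg x + intg y"
    and intg_smult: "\<And>r x. x \<in> gr (2 * n) \<Longrightarrow> intg (r \<odot> x) = r * intg x"
    and intg_bij: "bij_betw intg (gr (2 * n)) UNIV"
    and nondegenerate:
      "\<And>p a. p \<le> n \<Longrightarrow> a \<in> gr (2 * p) \<Longrightarrow>
        (\<forall>b\<in>gr (2 * n - 2 * p). intg (a \<otimes> b) = 0) \<Longrightarrow> a = \<zero>"

definition generated_in_degree_2 :: "(real, 'a) module \<Rightarrow> (nat \<Rightarrow> 'a set) \<Rightarrow> bool" where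
  "generated_in_degree_2 A gr \<longleftrightarrow>
    (\<forall>S. subring S A \<and> submodule S real_field A \<and> gr 2 \<subseteq> S \<longrightarrow> S = carrier A)"

definition graded_algebra_isomorphic ::
  "(real, 'a) module \<Rightarrow> (nat \<Rightarrow> 'a set) \<Rightarrow> (real, 'b) module \<Rightarrow> (nat \<Rightarrow> 'b set) \<Rightarrow> bool"
where
  "graded_algebra_isomorphic A grA B grB \<longleftrightarrow>
    (\<exists>\<phi>. \<phi> \<in> ring_iso A B \<and>
      (\<forall>r. \<forall>x\<in>carrier A. \<phi> (r \<odot>\<^bsub>A\<^esub> x) = r \<odot>\<^bsub>B\<^esub> \<phi> x) \<and>
      (\<forall>d. \<phi> ` grA d = grB d))"


section \<open>Complete simplicial multi-fans\<close>

text \<open>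
  The vertex set is \<open>{..<m}\<close>, and \<open>w I\<close> is the coefficient of the simplex \<open>I\<close> oriented by
  the increasing order of its vertices. The boundary is the augmented one, so a 0-cycle
  (\<open>n = 1\<close>) has coefficients summing to zero.
\<close>

definition simplicial_cycle :: "nat \<Rightarrow> nat \<Rightarrow> (nat set \<Rightarrow> real) \<Rightarrow> bool" where
  "simplicial_cycle m n w \<longleftrightarrow>
    (\<forall>I. w I \<noteq> 0 \<longrightarrow> I \<subseteq> {..<m} \<and> card I = n) \<and>
    (\<forall>J. J \<subseteq> {..<m} \<and> card J + 1 = n \<longrightarrow>
      (\<Sum>i\<in>{..<m} - J. (- 1) ^ card {j\<in>J. j < i} * w (insert i J)) = 0)"

definition complete_multi_fan ::
  "nat \<Rightarrow> (nat set \<Rightarrow> real) \<Rightarrow> (nat \<Rightarrow> real ^ 'n) \<Rightarrow> bool"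
where
  "complete_multi_fan m w lam \<longleftrightarrow>
    simplicial_cycle m CARD('n) w \<and>
    (\<forall>I. I \<subseteq> {..<m} \<and> card I = CARD('n) \<and> w I \<noteq> 0 \<longrightarrow>
      inj_on lam I \<and> independent (lam ` I) \<and> span (lam ` I) = UNIV)"


section \<open>Duistermaat--Heckman function and volume of a multi-polytope\<close>

text \<open>
  Throughout, \<open>V\<close> is \<open>real ^ 'n\<close> with its standard inner product, which also identifies
  \<open>V\<^sup>*\<close> with \<open>V\<close>, and with the orientation given by the enumeration
  \<open>to_nat_on UNIV\<close> of \<open>'n\<close>.
\<close>

text \<open>
  The winding number around \<open>u\<close> of an \<open>(n-1)\<close>-cycle made of oriented affine simplices is the
  degree of its radial projection to the unit sphere around \<open>u\<close>, i.e. the total signed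
  solid angle at \<open>u\<close> divided by the full solid angle (for \<open>n = 2\<close>: the total angle divided
  by \<open>2 \<pi>\<close>). The contribution of the simplex with vertices \<open>y 0, \<dots>, y (n-1)\<close> is the
  volume fraction of the unit ball filled by the cone that it spans from \<open>u\<close>, with the sign
  of \<open>det (y 0 - u, \<dots>, y (n-1) - u)\<close>.
\<close>

definition signed_solid_angle :: "(nat \<Rightarrow> real ^ 'n) \<Rightarrow> real ^ 'n \<Rightarrow> real" where
  "signed_solid_angle y u =
    sgn (det ((\<chi> k. y (to_nat_on (UNIV :: 'n set) k) - u) :: real ^ 'n ^ 'n)) *
    measure lebesgue
      ({\<Sum>k<CARD('n). t k *\<^sub>R (y k - u) | t. \<forall>k<CARD('n). 0 \<le> t k} \<inter> cball 0 1) /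
    measure lebesgue (cball 0 1 :: (real ^ 'n) set)"

definition support_hyperplane ::
  "(nat \<Rightarrow> real ^ 'n) \<Rightarrow> (nat \<Rightarrow> real) \<Rightarrow> nat \<Rightarrow> (real ^ 'n) set"
where
  "support_hyperplane lam c i = {u. u \<bullet> lam i = c i}"

text \<open>
  The Duistermaat--Heckman function counts the winding around \<open>u\<close> of the image of the cycle
  under a map to \<open>V\<^sup>*\<close> that sends the dual face of each simplex \<open>J\<close> into
  \<open>H\<^sub>J = (\<Inter>i\<in>J. H\<^sub>i)\<close>; any two such maps are homotopic off \<open>u\<close> if \<open>u\<close> lies on no \<open>H\<^sub>i\<close>.
  We use the map that is affine on the barycentric subdivision and sends the barycenter
  of \<open>J\<close> to the point of \<open>H\<^sub>J\<close> closest to the origin.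

  The simplices of the subdivision of \<open>I = {i\<^sub>0 < \<dots> < i\<^sub>n\<^sub>-\<^sub>1}\<close> are the flags
  \<open>{i\<^sub>p\<^sub>(\<^sub>0\<^sub>)} \<subset> {i\<^sub>p\<^sub>(\<^sub>0\<^sub>), i\<^sub>p\<^sub>(\<^sub>1\<^sub>)} \<subset> \<dots> \<subset> I\<close>, one for each
  permutation \<open>p\<close>, with orientation sign \<open>sign p\<close>.
\<close>

definition barycenter_image ::
  "(nat \<Rightarrow> real ^ 'n) \<Rightarrow> (nat \<Rightarrow> real) \<Rightarrow> nat set \<Rightarrow> real ^ 'n"
where
  "barycenter_image lam c J = closest_point (\<Inter>i\<in>J. support_hyperplane lam c i) 0"

definition flag_face :: "nat set \<Rightarrow> (nat \<Rightarrow> nat) \<Rightarrow> nat \<Rightarrow> nat set" where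
  "flag_face I p k = (\<lambda>j. sorted_list_of_set I ! p j) ` {..k}"

definition DH ::
  "nat \<Rightarrow> (nat set \<Rightarrow> real) \<Rightarrow> (nat \<Rightarrow> real ^ 'n) \<Rightarrow> (nat \<Rightarrow> real) \<Rightarrow> real ^ 'n \<Rightarrow> real"
where
  "DH m w lam c u =
    (\<Sum>I | I \<subseteq> {..<m} \<and> card I = CARD('n).
      \<Sum>p | p permutes {..<CARD('n)}.
        w I * of_int (sign p) *
        signed_solid_angle (\<lambda>k. barycenter_image lam c (flag_face I p k)) u)"

definition multi_polytope_volume ::
  "nat \<Rightarrow> (nat set \<Rightarrow> real) \<Rightarrow> (nat \<Rightarrow> real ^ 'n) \<Rightarrow> (nat \<Rightarrow> real) \<Rightarrow> real"
where
  "multi_polytope_volume m w lam c = (LINT u|lebesgue. DH m w lam c u)"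


section \<open>Polynomials and differential operators\<close>

text \<open>
  A monomial is an exponent vector \<open>nat \<Rightarrow>\<^sub>0 nat\<close>. The same type represents the polynomials in
  \<open>c\<^sub>0, c\<^sub>1, \<dots>\<close> and the differential operators with constant coefficients in
  \<open>\<partial>\<^sub>0, \<partial>\<^sub>1, \<dots>\<close>.
\<close>

type_synonym mpoly = "(nat \<Rightarrow>\<^sub>0 nat) \<Rightarrow>\<^sub>0 real"

definition mpolys :: "nat \<Rightarrow> mpoly set" where
  "mpolys m = {p. \<forall>t\<in>Poly_Mapping.keys p. Poly_Mapping.keys t \<subseteq> {..<m}}"

definition homogeneous :: "nat \<Rightarrow> mpoly \<Rightarrow> bool" where
  "homogeneous d p \<longleftrightarrow>
    (\<forall>t\<in>Poly_Mapping.keys p. (\<Sum>i\<in>Poly_Mapping.keys t. Poly_Mapping.lookup t i) = d)"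

definition eval_mpoly :: "mpoly \<Rightarrow> (nat \<Rightarrow> real) \<Rightarrow> real" where
  "eval_mpoly p c =
    (\<Sum>t\<in>Poly_Mapping.keys p. Poly_Mapping.lookup p t *
      (\<Prod>i\<in>Poly_Mapping.keys t. c i ^ Poly_Mapping.lookup t i))"

definition partial_diff :: "nat \<Rightarrow> mpoly \<Rightarrow> mpoly" where
  "partial_diff i p =
    (\<Sum>t\<in>Poly_Mapping.keys p.
      Poly_Mapping.single (t - Poly_Mapping.single i 1)
        (of_nat (Poly_Mapping.lookup t i) * Poly_Mapping.lookup p t))"

definition monomial_diff :: "(nat \<Rightarrow>\<^sub>0 nat) \<Rightarrow> mpoly \<Rightarrow> mpoly" where
  "monomial_diff t =
    foldr (\<lambda>i. partial_diff i ^^ Poly_Mapping.lookup t i)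
      (sorted_list_of_set (Poly_Mapping.keys t))"

definition apply_diff :: "mpoly \<Rightarrow> mpoly \<Rightarrow> mpoly" where
  "apply_diff D p =
    (\<Sum>t\<in>Poly_Mapping.keys D. Poly_Mapping.single 0 (Poly_Mapping.lookup D t) *
      monomial_diff t p)"

definition diff_ring :: "nat \<Rightarrow> mpoly ring" where
  "diff_ring m = \<lparr>carrier = mpolys m, mult = (*), one = 1, zero = 0, add = (+)\<rparr>"

definition Ann :: "nat \<Rightarrow> mpoly \<Rightarrow> mpoly set" where
  "Ann m p = {D \<in> carrier (diff_ring m). apply_diff D p = 0}"


section \<open>The multi-fan algebra\<close>

definition is_volume_polynomial ::
  "nat \<Rightarrow> (nat set \<Rightarrow> real) \<Rightarrow> (nat \<Rightarrow> real ^ 'n) \<Rightarrow> mpoly \<Rightarrow> bool"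
where
  "is_volume_polynomial m w lam p \<longleftrightarrow>
    p \<in> mpolys m \<and> homogeneous CARD('n) p \<and>
    (\<forall>c. eval_mpoly p c = multi_polytope_volume m w lam c)"

definition volume_polynomial ::
  "nat \<Rightarrow> (nat set \<Rightarrow> real) \<Rightarrow> (nat \<Rightarrow> real ^ 'n) \<Rightarrow> mpoly"
where
  "volume_polynomial m w lam = (THE p. is_volume_polynomial m w lam p)"

definition multi_fan_algebra ::
  "nat \<Rightarrow> (nat set \<Rightarrow> real) \<Rightarrow> (nat \<Rightarrow> real ^ 'n) \<Rightarrow> (real, mpoly set) module"
where
  "multi_fan_algebra m w lam =
    (let D = diff_ring m; I = Ann m (volume_polynomial m w lam); Q = D Quot I in
      \<lparr>carrier = carrier Q, mult = mult Q, one = one Q, zero = zero Q, add = add Q,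
       smult = (\<lambda>r C. (I +>\<^bsub>D\<^esub> Poly_Mapping.single 0 r) \<otimes>\<^bsub>Q\<^esub> C)\<rparr>)"

text \<open>Each \<open>\<partial>\<^sub>i\<close> has degree 2.\<close>

definition multi_fan_grading ::
  "nat \<Rightarrow> (nat set \<Rightarrow> real) \<Rightarrow> (nat \<Rightarrow> real ^ 'n) \<Rightarrow> nat \<Rightarrow> mpoly set set"
where
  "multi_fan_grading m w lam d =
    {Ann m (volume_polynomial m w lam) +>\<^bsub>diff_ring m\<^esub> p | p.
      p \<in> carrier (diff_ring m) \<and> (\<forall>t\<in>Poly_Mapping.keys p. 2 * (\<Sum>i\<in>Poly_Mapping.keys t. Poly_Mapping.lookup t i) = d)}"

end

theory Submission
  imports Defs
begin

text \<open>
  Choose \<open>x\<^sub>0, \<dots>, x\<^sub>m\<^sub>-\<^sub>1\<close> in degree 2 generating \<open>A\<close> and vectors \<open>\<lambda>\<^sub>i\<close> in general position (on the moment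
  curve) with \<open>\<Sum>\<^sub>i \<lambda>\<^sub>i \<otimes> x\<^sub>i = 0\<close>: any \<open>q\<close> generators can be completed by \<open>n\<close> further elements solving
  this relation. By Macaulay duality \<open>A\<close> is \<open>\<D> / Ann P\<close> for \<open>P(c) = \<integral> (\<Sum>\<^sub>i c\<^sub>i x\<^sub>i)\<^sup>n / n!\<close>. The weights
  \<open>w(I) = det(\<lambda>\<^sub>I) \<integral> \<Prod>\<^sub>i\<^sub>\<in>\<^sub>I x\<^sub>i\<close> form a cycle because of the relation, and the claim is that \<open>P\<close> is
  the volume polynomial of \<open>(w, \<lambda>)\<close>.

  Since solid angles satisfy a cocycle identity, the Duistermaat--Heckman function is almost everywhere
  the signed sum of the indicator functions of the simplices spanned by the origin and the simplices of
  the cycle, so the volume is \<open>\<Sum> w(I) sgn(p) det(y\<^sub>0, \<dots>, y\<^sub>n\<^sub>-\<^sub>1) / n!\<close> over all flags. As \<open>y\<^sub>k\<close> lies on the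
  hyperplanes of the first \<open>k + 1\<close> entries of the flag \<open>(i\<^sub>0, \<dots>, i\<^sub>n\<^sub>-\<^sub>1)\<close>,
  the product \<open>det(\<lambda>\<^sub>i\<^sub>0, \<dots>) det(y\<^sub>0, \<dots>)\<close> equals
  \<open>\<Prod>\<^sub>k (c(i\<^sub>k) - \<langle>\<lambda>(i\<^sub>k), y\<^sub>k\<^sub>-\<^sub>1\<rangle>)\<close>. Summing over \<open>i\<^sub>n\<^sub>-\<^sub>1\<close>, then over \<open>i\<^sub>n\<^sub>-\<^sub>2\<close>, and so on, the relation kills the terms
  \<open>\<langle>\<lambda>(i\<^sub>k), y\<^sub>k\<^sub>-\<^sub>1\<rangle>\<close>, and \<open>P\<close> remains.
\<close>

section \<open>Determinants and volumes of simplices\<close>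

text \<open>Both sides are multiplicative under composition, so it suffices to treat elementary
  maps: those with a vanishing coordinate, diagonal stretches, coordinate swaps and shears.\<close>

lemma measure_linear_image_cart:
  fixes f :: "real^'n \<Rightarrow> real^'n"
  assumes "linear f" "S \<in> lmeasurable"
  shows "f ` S \<in> lmeasurable \<and> measure lebesgue (f ` S) = \<bar>det (matrix f)\<bar> * measure lebesgue S"
proof -
  have "\<forall>S\<in>lmeasurable. f ` S \<in> lmeasurable \<and>
      measure lebesgue (f ` S) = \<bar>det (matrix f)\<bar> * measure lebesgue S"
  proof (rule induct_linear_elementary [OF \<open>linear f\<close>]; intro ballI)
    fix f g :: "real^'n \<Rightarrow> real^'n" and S :: "(real^'n) set"
    assume "linear f" "linear g"
      and "\<forall>S\<in>lmeasurable. f ` S \<in> lmeasurable \<and>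
        measure lebesgue (f ` S) = \<bar>det (matrix f)\<bar> * measure lebesgue S"
      and "\<forall>S\<in>lmeasurable. g ` S \<in> lmeasurable \<and>
        measure lebesgue (g ` S) = \<bar>det (matrix g)\<bar> * measure lebesgue S"
      and "S \<in> lmeasurable"
    then show "(f \<circ> g) ` S \<in> lmeasurable \<and>
        measure lebesgue ((f \<circ> g) ` S) = \<bar>det (matrix (f \<circ> g))\<bar> * measure lebesgue S"
      by (simp only: image_comp [symmetric] matrix_compose det_mul abs_mult) (simp add: mult.assoc)
  next
    fix f :: "real^'n \<Rightarrow> real^'n" and i and S :: "(real^'n) set"
    assume f: "linear f" and zero: "\<And>x. f x $ i = 0"
    have "1 \<notin> range f"
      using zero by (metis imageE one_index zero_neq_one)
    then have "\<not> inj f"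
      using linear_injective_imp_surjective [OF f] by auto
    with f have "negligible (f ` S)" "det (matrix f) = 0"
      using negligible_linear_singular_image det_nz_iff_inj by blast+
    then show "f ` S \<in> lmeasurable \<and> measure lebesgue (f ` S) = \<bar>det (matrix f)\<bar> * measure lebesgue S"
      by (simp add: negligible_iff_measure)
  next
    fix c :: "'n \<Rightarrow> real" and S :: "(real^'n) set"
    assume "S \<in> lmeasurable"
    then show "(\<lambda>x. \<chi> i. c i * x $ i) ` S \<in> lmeasurable \<and>
      measure lebesgue ((\<lambda>x. \<chi> i. c i * x $ i) ` S) =
        \<bar>det (matrix (\<lambda>x::real^'n. \<chi> i. c i * x $ i))\<bar> * measure lebesgue S"
      by (simp add: measurable_stretch measure_stretch det_diagonal matrix_def axis_def)
  next
    fix m n :: 'n and S :: "(real^'n) set"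
    assume S: "S \<in> lmeasurable"
    let ?\<tau> = "Transposition.transpose m n" and ?h = "\<lambda>v::real^'n. \<chi> i. v $ Transposition.transpose m n i"
    have "linear ?h"
      by (rule linearI) (simp_all add: vec_eq_iff)
    \<comment> \<open>A linear map that scales all boxes by one factor scales every measurable set
      by it, so swaps and shears are checked on boxes only.\<close>
    moreover have "measure lebesgue (?h ` cbox a b) = 1 * measure lebesgue (cbox a b)" for a b
    proof -
      have inv: "?h (?h v) = v" for v
        by (simp add: vec_eq_iff)
      have all: "(\<forall>i. P (?\<tau> i)) \<longleftrightarrow> (\<forall>i. P i)" for P
        by (metis transpose_involutory)
      have mem: "?h v \<in> cbox (?h a) (?h b) \<longleftrightarrow> v \<in> cbox a b" for a b v
        using all [of "\<lambda>i. a $ i \<le> v $ i \<and> v $ i \<le> b $ i"] by (simp add: mem_box_cart)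
      have eq: "?h ` cbox a b = cbox (?h a) (?h b)"
      proof (intro equalityI subsetI)
        fix v assume "v \<in> cbox (?h a) (?h b)"
        then have "?h v \<in> cbox a b"
          using mem [of "?h v" a b] inv by simp
        then show "v \<in> ?h ` cbox a b"
          by (rule rev_image_eqI) (simp add: inv)
      qed (use mem in blast)
      have "(\<Prod>i\<in>UNIV. (b - a) $ ?\<tau> i) = (\<Prod>i\<in>UNIV. (b - a) $ i)"
        by (rule prod.permute [symmetric, unfolded o_def]) (simp add: permutes_swap_id)
      moreover have "cbox (?h a) (?h b) = {} \<longleftrightarrow> cbox a b = {}"
        unfolding eq [symmetric] by simp
      ultimately show ?thesis
        unfolding eq by (cases "cbox a b = {}") (simp_all add: content_cbox_cart)
    qed
    moreover have "matrix ?h = (\<chi> i. mat 1 $ ?\<tau> i)"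
      by (simp add: matrix_def vec_eq_iff axis_def mat_def)
    then have "\<bar>det (matrix ?h)\<bar> = 1"
      by (simp add: det_permute_rows permutes_swap_id sign_swap_id abs_mult)
    ultimately show "?h ` S \<in> lmeasurable \<and> measure lebesgue (?h ` S) = \<bar>det (matrix ?h)\<bar> * measure lebesgue S"
      using measure_linear_sufficient [OF _ S, of ?h 1] by simp
  next
    fix m n :: 'n and S :: "(real^'n) set"
    assume "m \<noteq> n" and S: "S \<in> lmeasurable"
    let ?h = "\<lambda>v::real^'n. \<chi> i. if i = m then v $ m + v $ n else v $ i"
    have lin: "linear ?h"
      by (rule linearI) (simp_all add: vec_eq_iff algebra_simps)
    moreover have "measure lebesgue (?h ` cbox a b) = 1 * measure lebesgue (cbox a b)" for a b
    proof (cases "cbox a b = {}")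
      case False
      \<comment> \<open>The shear formula for boxes asks for a nonnegative \<open>n\<close>-th
        coordinate; translating the lower corner to 0 achieves this.\<close>
      have box: "cbox a b = (+) a ` cbox 0 (b - a)"
        by (simp add: cbox_translation [symmetric])
      have "?h ` cbox a b = (+) (?h a) ` ?h ` cbox 0 (b - a)"
        unfolding box image_image linear_add [OF lin] ..
      then have "measure lebesgue (?h ` cbox a b) = measure lebesgue (?h ` cbox 0 (b - a))"
        by (simp only: measure_translation)
      also have "\<dots> = measure lebesgue (cbox 0 (b - a))"
        using \<open>m \<noteq> n\<close> False box by (intro measure_shear_interval) auto
      also have "\<dots> = measure lebesgue (cbox a b)"
        unfolding box by (simp only: measure_translation)
      finally show ?thesis
        by simp
    qed simp
    moreover have "matrix ?h =
        (\<chi> k. if k = m then row m (mat 1) + 1 *s row n (mat 1) else row k (mat 1))"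
      using \<open>m \<noteq> n\<close> by (auto simp: matrix_def vec_eq_iff axis_def mat_def row_def)
    then have "det (matrix ?h) = 1"
      using det_row_operation [OF \<open>m \<noteq> n\<close>, of "mat 1" "1::real"] by simp
    ultimately show "?h ` S \<in> lmeasurable \<and> measure lebesgue (?h ` S) = \<bar>det (matrix ?h)\<bar> * measure lebesgue S"
      using measure_linear_sufficient [OF _ S, of ?h 1] by simp
  qed
  with assms show ?thesis
    by blast
qed

text \<open>Row \<open>k\<close> is \<open>v\<close>, so each other row changes by a row operation;
  the induction runs over the set \<open>T\<close> of rows already changed.\<close>

lemma det_add_row_multiples:
  fixes y :: "'n::finite \<Rightarrow> real^'n"
  shows "det (\<chi> j. if j = k then v else y j + a j *s v) = det (\<chi> j. if j = k then v else y j)"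
proof -
  have "det (\<chi> j. if j = k then v else if j \<in> T then y j + a j *s v else y j) =
      det (\<chi> j. if j = k then v else y j)" for T :: "'n set"
    using finite [of T]
  proof (induction T)
    case (insert i T)
    show ?case
    proof (cases "i = k")
      case True
      then have "(\<chi> j. if j = k then v else if j \<in> insert i T then y j + a j *s v else y j) =
          (\<chi> j. if j = k then v else if j \<in> T then y j + a j *s v else y j)"
        by (simp add: vec_eq_iff)
      with insert show ?thesis by simp
    next
      case False
      let ?A = "\<chi> j. if j = k then v else if j \<in> T then y j + a j *s v else y j"
      have "(\<chi> j. if j = k then v else if j \<in> insert i T then y j + a j *s v else y j) =
          (\<chi> j. if j = i then row i ?A + a i *s row k ?A else row j ?A)"
        using insert False by (auto simp: vec_eq_iff row_def)
      with insert show ?thesis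
        by (simp only: det_row_operation [OF False])
    qed
  qed (simp cong: if_cong)
  from this [of UNIV] show ?thesis by (simp cong: if_cong)
qed

text \<open>Expansion by multilinearity: terms with \<open>u\<close> in two rows vanish.
  Inductively, subtracting \<open>u\<close> from row \<open>k\<close> splits off a determinant with
  row \<open>k\<close> equal to \<open>u\<close>, and this row clears \<open>- u\<close> from all
  others.\<close>

lemma det_diff_rows:
  fixes y :: "'n::finite \<Rightarrow> real^'n"
  shows "det (\<chi> j. y j - u) = det (\<chi> j. y j) - (\<Sum>k\<in>UNIV. det (\<chi> j. if j = k then u else y j))"
proof -
  have "det (\<chi> j. if j \<in> T then y j - u else y j) =
      det (\<chi> j. y j) - (\<Sum>k\<in>T. det (\<chi> j. if j = k then u else y j))" for T :: "'n set"
    using finite [of T]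
  proof (induction T)
    case (insert k T)
    let ?a = "\<lambda>j::'n. if j \<in> T then - 1 else 0 :: real"
    have "det (\<chi> j. if j \<in> insert k T then y j - u else y j) =
        det (\<chi> j. if j = k then y j + (-1) *s u else if j \<in> T then y j - u else y j)"
      using insert by (intro arg_cong [of _ _ det]) (auto simp: vec_eq_iff)
    also have "\<dots> = det (\<chi> j. if j = k then y j else if j \<in> T then y j - u else y j) +
        (-1) * det (\<chi> j. if j = k then u else if j \<in> T then y j - u else y j)"
      unfolding det_row_add det_row_mul ..
    also have "(\<chi> j. if j = k then y j else if j \<in> T then y j - u else y j) =
        (\<chi> j. if j \<in> T then y j - u else y j)"
      using insert by (auto simp: vec_eq_iff)
    also have "(\<chi> j. if j = k then u else if j \<in> T then y j - u else y j) =
        (\<chi> j. if j = k then u else y j + ?a j *s u)"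
      by (auto simp: vec_eq_iff)
    finally show ?case
      using insert by (simp only: det_add_row_multiples) (simp add: algebra_simps)
  qed (simp cong: if_cong)
  from this [of UNIV] show ?thesis by (simp cong: if_cong)
qed

text \<open>The set is the interior of the closed standard simplex, whose frontier is null by
  convexity.\<close>

lemma open_std_simplex_cart:
  "{t::real^'n. (\<forall>k. 0 < t $ k) \<and> (\<Sum>k\<in>UNIV. t $ k) < 1} \<in> lmeasurable"
  "measure lebesgue {t::real^'n. (\<forall>k. 0 < t $ k) \<and> (\<Sum>k\<in>UNIV. t $ k) < 1} = 1 / fact CARD('n)"
proof -
  let ?S = "convex hull (insert 0 Basis) :: (real^'n) set"
  have Basis: "(Basis :: (real^'n) set) = range (\<lambda>k. axis k 1)"
    by (auto simp: Basis_vec_def)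
  have "(\<Sum>i\<in>Basis. t \<bullet> i) = (\<Sum>k\<in>UNIV. t $ k)" for t :: "real^'n"
    unfolding Basis by (subst sum.reindex) (auto simp: inj_def axis_eq_axis inner_axis)
  moreover have "(\<forall>i\<in>Basis. 0 < t \<bullet> i) \<longleftrightarrow> (\<forall>k. 0 < t $ k)" for t :: "real^'n"
    unfolding Basis by (auto simp: inner_axis)
  ultimately have eq: "{t::real^'n. (\<forall>k. 0 < t $ k) \<and> (\<Sum>k\<in>UNIV. t $ k) < 1} = interior ?S"
    by (simp add: interior_std_simplex)
  have comp: "compact ?S"
    by (simp add: finite_imp_compact_convex_hull)
  then have bdd: "bounded ?S"
    by (rule compact_imp_bounded)
  show "{t::real^'n. (\<forall>k. 0 < t $ k) \<and> (\<Sum>k\<in>UNIV. t $ k) < 1} \<in> lmeasurable"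
    unfolding eq using bdd by (intro measurable_convex) (auto intro: bounded_interior)
  have "measure lebesgue (interior ?S) = measure lebesgue ?S"
    using bdd by (intro measure_interior) (auto intro: negligible_convex_frontier)
  also have "\<dots> = measure lborel ?S"
    using comp by (intro measure_completion) (auto dest: compact_imp_closed)
  also have "\<dots> = 1 / fact CARD('n)"
    by (simp add: content_std_simplex)
  finally show "measure lebesgue {t::real^'n. (\<forall>k. 0 < t $ k) \<and> (\<Sum>k\<in>UNIV. t $ k) < 1} = 1 / fact CARD('n)"
    unfolding eq .
qed

text \<open>The numerators in Cramer's rule: for a basis \<open>y\<close>, dividing by the
  determinant of \<open>y\<close> gives the \<open>k\<close>-th coordinate of
  \<open>u\<close>.\<close>

definition face_det :: "('n::finite \<Rightarrow> real^'n) \<Rightarrow> real^'n \<Rightarrow> 'n \<Rightarrow> real" where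
  "face_det y u k = det (\<chi> j. if j = k then u else y j)"

text \<open>The indicator function of the open simplex with vertices 0 and the \<open>y k\<close>,
  signed by orientation. It is phrased by determinants rather than coordinates so that it also
  covers degenerate \<open>y\<close> and can be compared with the coefficients in the cocycle
  identity.\<close>

definition simplex_sign :: "('n::finite \<Rightarrow> real^'n) \<Rightarrow> real^'n \<Rightarrow> real" where
  "simplex_sign y u =
    (if (\<forall>k. face_det y u k > 0) \<and> (\<Sum>k\<in>UNIV. face_det y u k) < det (\<chi> k. y k) then 1
     else if (\<forall>k. face_det y u k < 0) \<and> (\<Sum>k\<in>UNIV. face_det y u k) > det (\<chi> k. y k) then - 1
     else 0)"

lemma face_det_combination:
  "face_det y (\<Sum>i\<in>UNIV. t i *\<^sub>R y i) k = t k * det (\<chi> i. y i)"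
proof -
  have row: "row i (\<chi> i. y i) = y i" for i
    by (simp add: row_def vec_eq_iff)
  show ?thesis
    using cramer_lemma_transpose [of k "\<chi> i. t i" "\<chi> i. y i"]
    unfolding face_det_def row by (simp add: scalar_mult_eq_scaleR cong: if_cong)
qed

lemma in_span_rows:
  fixes y :: "'n::finite \<Rightarrow> real^'n"
  assumes "det (\<chi> i. y i) \<noteq> 0"
  obtains t where "u = (\<Sum>i\<in>UNIV. t i *\<^sub>R y i)"
proof -
  have "invertible (transpose (\<chi> i. y i))"
    using assms by (simp add: invertible_det_nz)
  then obtain B where "transpose (\<chi> i. y i) ** B = mat 1"
    unfolding invertible_def by blast
  then have "transpose (\<chi> i. y i) *v (B *v u) = u"
    by (simp add: matrix_vector_mul_assoc)
  then have "u = (\<Sum>i\<in>UNIV. (B *v u) $ i *\<^sub>R y i)"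
    by (simp add: matrix_mult_sum scalar_mult_eq_scaleR column_def transpose_def)
  then show ?thesis by (rule that)
qed

text \<open>The open simplex on 0 and \<open>y\<close> is the image of the open standard simplex
  under the linear map that sends the unit vectors to the \<open>y i\<close>.\<close>

lemma integral_simplex_sign:
  fixes y :: "'n::finite \<Rightarrow> real^'n"
  shows "integrable lebesgue (simplex_sign y)"
    and "(LINT u|lebesgue. simplex_sign y u) = det (\<chi> k. y k) / fact CARD('n)"
proof -
  let ?d = "det (\<chi> k. y k)" and ?\<Delta> = "{t::real^'n. (\<forall>k. 0 < t $ k) \<and> (\<Sum>k\<in>UNIV. t $ k) < 1}"
  define f where "f t = (\<Sum>i\<in>UNIV. (t::real^'n) $ i *\<^sub>R y i)" for t
  have f_eq: "f = (*v) (transpose (\<chi> k. y k))"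
    by (auto simp: f_def matrix_mult_sum scalar_mult_eq_scaleR column_def transpose_def)
  have fS: "f ` ?\<Delta> \<in> lmeasurable" "measure lebesgue (f ` ?\<Delta>) = \<bar>?d\<bar> / fact CARD('n)"
    using measure_linear_image_cart [of f, OF _ open_std_simplex_cart(1)]
    unfolding open_std_simplex_cart(2) by (simp_all only: f_eq matrix_vector_mul_linear
      matrix_of_matrix_vector_mul det_transpose simp_thms mult_1_right times_divide_eq_right)
  have "simplex_sign y u = sgn ?d * indicator (f ` ?\<Delta>) u" for u
  proof (cases "?d = 0")
    case True
    \<comment> \<open>With determinant 0 both clauses fail: positive numbers have no negative sum,
      and negative numbers no positive one.\<close>
    then show ?thesis
      using sum_pos [of "UNIV :: 'n set" "face_det y u"] sum_pos [of "UNIV :: 'n set" "\<lambda>k. - face_det y u k"]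
      by (auto simp: simplex_sign_def sum_negf)
  next
    case False
    obtain t where u: "u = (\<Sum>i\<in>UNIV. t i *\<^sub>R y i)"
      using in_span_rows [OF False] by blast
    have fd: "face_det y u k = t k * ?d" for k
      unfolding u by (rule face_det_combination)
    have uf: "u = f (\<chi> i. t i)"
      by (simp add: u f_def)
    have inj: "inj f"
      unfolding f_eq using False by (simp add: inj_matrix_vector_mult invertible_det_nz)
    then have "u \<in> f ` ?\<Delta> \<longleftrightarrow> (\<forall>k. 0 < t k) \<and> (\<Sum>k\<in>UNIV. t k) < 1"
      unfolding uf by (simp add: inj_image_mem_iff)
    moreover have "(\<Sum>k\<in>UNIV. face_det y u k) = (\<Sum>k\<in>UNIV. t k) * ?d"
      by (simp add: fd sum_distrib_right)
    moreover have "t k * ?d > 0 \<longleftrightarrow> (if ?d > 0 then t k > 0 else t k < 0)"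
       "t k * ?d < 0 \<longleftrightarrow> (if ?d > 0 then t k < 0 else t k > 0)" for k
      using False by (auto simp: zero_less_mult_iff mult_less_0_iff)
    moreover have "s * ?d < ?d \<longleftrightarrow> (if ?d > 0 then s < 1 else s > 1)"
       "s * ?d > ?d \<longleftrightarrow> (if ?d > 0 then s > 1 else s < 1)" for s
      using False mult_less_cancel_right [of s ?d 1] mult_less_cancel_right [of 1 ?d s] by auto
    \<comment> \<open>This excludes the clause of the wrong sign: negative coordinates cannot add up
      to more than 1.\<close>
    moreover have "\<not> ((\<forall>k. t k < 0) \<and> (\<Sum>k\<in>UNIV. t k) > 1)"
      using sum_nonpos [of "UNIV :: 'n set" t] by (force simp: less_imp_le)
    ultimately show ?thesis
      using False unfolding simplex_sign_def fd by (auto simp: indicator_def)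
  qed
  then have "simplex_sign y = (\<lambda>u. sgn ?d * indicator (f ` ?\<Delta>) u)"
    by blast
  moreover have "integrable lebesgue (\<lambda>u. sgn ?d * indicator (f ` ?\<Delta>) u)"
    using fS(1) by (intro integrable_mult_right integrable_real_indicator) (auto simp: fmeasurable_def)
  moreover have "(LINT u|lebesgue. sgn ?d * indicator (f ` ?\<Delta>) u) = sgn ?d * measure lebesgue (f ` ?\<Delta>)"
    using fS(1) by (simp add: integral_mult_right_zero)
  moreover have "sgn ?d * (\<bar>?d\<bar> / fact CARD('n)) = ?d / fact CARD('n)"
    by (simp add: sgn_mult_abs)
  ultimately show "integrable lebesgue (simplex_sign y)"
    "(LINT u|lebesgue. simplex_sign y u) = det (\<chi> k. y k) / fact CARD('n)"
    using fS(2) by simp_all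
qed

section \<open>The cocycle identity for solid angles\<close>

text \<open>The admissible \<open>s\<close> form a closed interval, bounded below because some
  \<open>d i\<close> is positive. If it is nonempty, its lower end is the largest
  \<open>- t i / d i\<close> with \<open>d i > 0\<close>, and \<open>generic\<close> makes the index
  attaining it unique.\<close>

lemma count_lower_endpoints:
  fixes t d :: "'i::finite \<Rightarrow> real"
  assumes generic: "\<And>i j. i \<noteq> j \<Longrightarrow> d i \<noteq> 0 \<Longrightarrow> d j \<noteq> 0 \<Longrightarrow> t i * d j \<noteq> t j * d i"
    and pos: "\<exists>i. d i > 0"
  shows "(\<Sum>i\<in>UNIV. if d i > 0 \<and> (\<forall>j. 0 \<le> t j - t i / d i * d j) then 1 else 0) =
    (if \<exists>s. \<forall>j. 0 \<le> t j + s * d j then 1 else 0 :: real)"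
proof -
  define P where "P i \<longleftrightarrow> d i > 0 \<and> (\<forall>j. 0 \<le> t j - t i / d i * d j)" for i
  have uniq: "i = j" if "P i" "P j" for i j
  proof (rule ccontr)
    assume "i \<noteq> j"
    from that have "d i > 0" "d j > 0" "0 \<le> t j - t i / d i * d j" "0 \<le> t i - t j / d j * d i"
      by (auto simp: P_def)
    then have "t i * d j = t j * d i"
      by (simp add: field_simps)
    with generic [OF \<open>i \<noteq> j\<close>] \<open>d i > 0\<close> \<open>d j > 0\<close> show False
      by simp
  qed
  have ex: "\<exists>i. P i" if s: "\<forall>j. 0 \<le> t j + s * d j" for s
  proof -
    let ?I = "{i. d i > 0}"
    have "Max ((\<lambda>i. - t i / d i) ` ?I) \<in> (\<lambda>i. - t i / d i) ` ?I"
      using pos by (intro Max_in) auto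
    then obtain i where i: "d i > 0" and max: "- t i / d i = Max ((\<lambda>i. - t i / d i) ` ?I)"
      by auto
    have le: "- t j / d j \<le> - t i / d i" if "d j > 0" for j
      unfolding max using that by (intro Max_ge) auto
    have "- t i / d i \<le> s"
      using i s by (simp add: field_simps) (metis add.commute add_0 diff_le_eq minus_le_iff mult.commute uminus_add_conv_diff)
    have "0 \<le> t j - t i / d i * d j" for j
    proof (cases "d j > 0")
      case True
      with le [OF this] show ?thesis
        by (simp add: field_simps)
    next
      case False
      then have "s * d j \<le> (- t i / d i) * d j"
        using \<open>- t i / d i \<le> s\<close> by (intro mult_right_mono_neg) auto
      with s [rule_format, of j] show ?thesis
        by simp
    qed
    with i show ?thesis
      unfolding P_def by blast
  qed
  show ?thesis
  proof (cases "\<exists>i. P i")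
    case True
    then obtain i where "P i" by blast
    with uniq have "P j \<longleftrightarrow> j = i" for j
      by blast
    moreover have "\<forall>j. 0 \<le> t j + (- t i / d i) * d j"
      using \<open>P i\<close> by (simp add: P_def)
    then have "\<exists>s. \<forall>j. 0 \<le> t j + s * d j"
      by blast
    ultimately show ?thesis
      unfolding P_def [symmetric] by simp
  next
    case False
    with ex have "\<not> (\<exists>s. \<forall>j. 0 \<le> t j + s * d j)"
      by blast
    with False show ?thesis
      unfolding P_def [symmetric] by simp
  qed
qed

definition constant_sign :: "('i::finite \<Rightarrow> real) \<Rightarrow> real" where
  "constant_sign d = (if \<forall>i. d i > 0 then 1 else if \<forall>i. d i < 0 then - 1 else 0)"

text \<open>Indices with \<open>d i > 0\<close> detect the lower end of the interval, those with
  \<open>d i < 0\<close> the upper end. If both signs occur, the interval has both ends or is empty,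
  and the counts cancel; if all \<open>d i\<close> have one strict sign, it is a half-line with one
  end. The assumption \<open>signs\<close> excludes a weakly one-signed \<open>d\<close> with both
  zero and nonzero entries, where the count would depend on \<open>t\<close>.\<close>

lemma signed_endpoint_count:
  fixes t d :: "'i::finite \<Rightarrow> real"
  assumes generic: "\<And>i j. i \<noteq> j \<Longrightarrow> d i \<noteq> 0 \<Longrightarrow> d j \<noteq> 0 \<Longrightarrow> t i * d j \<noteq> t j * d i"
    and signs: "(\<forall>i. d i \<noteq> 0) \<or> ((\<exists>i. d i > 0) \<longleftrightarrow> (\<exists>i. d i < 0))"
  shows "(\<Sum>i\<in>UNIV. sgn (d i) * (if \<forall>j. 0 \<le> t j - t i / d i * d j then 1 else 0)) = constant_sign d"
proof -
  let ?Q = "\<lambda>i. \<forall>j. 0 \<le> t j - t i / d i * d j"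
  let ?E = "\<exists>s. \<forall>j. 0 \<le> t j + s * d j"
  have split: "(\<Sum>i\<in>UNIV. sgn (d i) * (if ?Q i then 1 else 0)) =
      (\<Sum>i\<in>UNIV. if d i > 0 \<and> ?Q i then 1 else 0) - (\<Sum>i\<in>UNIV. if d i < 0 \<and> ?Q i then 1 else 0)"
    unfolding sum_subtractf [symmetric] by (intro sum.cong) (auto simp: sgn_if)
  have lower: "(\<Sum>i\<in>UNIV. if d i > 0 \<and> ?Q i then 1 else 0) = (if (\<exists>i. d i > 0) \<and> ?E then 1 else 0 :: real)"
  proof (cases "\<exists>i. d i > 0")
    case True
    then show ?thesis
      using count_lower_endpoints [of d t, OF generic] by simp
  qed auto
  have upper: "(\<Sum>i\<in>UNIV. if d i < 0 \<and> ?Q i then 1 else 0) = (if (\<exists>i. d i < 0) \<and> ?E then 1 else 0 :: real)"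
  proof (cases "\<exists>i. d i < 0")
    case True
    \<comment> \<open>Reversing the direction of the line exchanges upper and lower ends.\<close>
    moreover have "?E \<longleftrightarrow> (\<exists>s. \<forall>j. 0 \<le> t j + s * - d j)"
      by (metis minus_mult_commute minus_minus)
    ultimately show ?thesis
      using count_lower_endpoints [of "\<lambda>i. - d i" t] generic by simp
  qed auto
  have "?E" if "\<forall>i. d i > 0"
  proof
    show "\<forall>j. 0 \<le> t j + Max (range (\<lambda>i. - t i / d i)) * d j"
    proof
      fix j
      have "- t j / d j \<le> Max (range (\<lambda>i. - t i / d i))"
        by (intro Max_ge) auto
      with that [rule_format, of j] show "0 \<le> t j + Max (range (\<lambda>i. - t i / d i)) * d j"
        by (simp add: field_simps)
    qed
  qed
  moreover have "?E" if "\<forall>i. d i < 0"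
  proof
    show "\<forall>j. 0 \<le> t j + Min (range (\<lambda>i. - t i / d i)) * d j"
    proof
      fix j
      have "Min (range (\<lambda>i. - t i / d i)) \<le> - t j / d j"
        by (intro Min_le) auto
      with that [rule_format, of j] show "0 \<le> t j + Min (range (\<lambda>i. - t i / d i)) * d j"
        by (simp add: field_simps)
    qed
  qed
  moreover have "(\<forall>i. d i > 0) \<or> (\<forall>i. d i < 0) \<or> ((\<exists>i. d i > 0) \<longleftrightarrow> (\<exists>i. d i < 0))"
    using signs by (meson linorder_neqE_linordered_idom)
  moreover have "\<not> ((\<forall>i. d i > 0) \<and> (\<exists>i. d i < 0))" "\<not> ((\<forall>i. d i < 0) \<and> (\<exists>i. d i > 0))"
    by (meson less_asym)+
  moreover have "(\<forall>i. d i > 0) \<Longrightarrow> \<exists>i. d i > 0" "(\<forall>i. d i < 0) \<Longrightarrow> \<exists>i. d i < 0"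
    by blast+
  ultimately show ?thesis
    unfolding split lower upper constant_sign_def by (auto simp del: not_ex not_all)
qed

text \<open>Cramer's rule multiplied out, so that it also covers dependent rows, where it is a
  linear relation among them. In that case, if some coefficient \<open>face_det v x k\<close> is
  nonzero, exchanging \<open>v k\<close> for \<open>x\<close> gives a basis \<open>W\<close> in
  which \<open>v k\<close> can be expanded.\<close>

lemma cramer_rows:
  fixes v :: "'n::finite \<Rightarrow> real^'n"
  shows "(\<Sum>k\<in>UNIV. face_det v x k *\<^sub>R v k) = det (\<chi> k. v k) *\<^sub>R x"
proof (cases "det (\<chi> k. v k) = 0")
  case False
  then obtain t where x: "x = (\<Sum>i\<in>UNIV. t i *\<^sub>R v i)"
    using in_span_rows by blast
  show ?thesis
    unfolding x face_det_combination by (simp add: scaleR_sum_right mult.commute)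
next
  case det0: True
  show ?thesis
  proof (cases "\<forall>k. face_det v x k = 0")
    case False
    then obtain k where k: "face_det v x k \<noteq> 0" by blast
    define W where "W j = (if j = k then x else v j)" for j
    have detW: "det (\<chi> j. W j) = face_det v x k"
      by (simp add: W_def face_det_def)
    then obtain s where s: "v k = (\<Sum>i\<in>UNIV. s i *\<^sub>R W i)"
      using in_span_rows k by metis
    have fd: "face_det W (v k) l = s l * face_det v x k" for l
      unfolding s face_det_combination detW ..
    \<comment> \<open>Putting \<open>v k\<close> back restores \<open>v\<close>, so the coefficient
      of \<open>x\<close> in this expansion vanishes along with the determinant of
      \<open>v\<close>.\<close>
    have "face_det W (v k) k = det (\<chi> k. v k)"
      unfolding face_det_def W_def by (intro arg_cong [of _ _ det]) (auto simp: vec_eq_iff)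
    then have sk: "s k = 0"
      using fd [of k] k det0 by simp
    \<comment> \<open>\<open>W\<close> with \<open>v k\<close> in row \<open>l\<close> is, up to
      interchanging rows \<open>k\<close> and \<open>l\<close>, the family \<open>v\<close> with
      \<open>x\<close> in row \<open>l\<close>; hence the sign.\<close>
    have swap: "face_det v x l = - s l * face_det v x k" if "l \<noteq> k" for l
    proof -
      let ?\<tau> = "Transposition.transpose k l"
      have "(\<chi> j. if j = l then v k else W j) = (\<chi> j. (\<chi> j. if j = l then x else v j) $ ?\<tau> j)"
        using that by (auto simp: vec_eq_iff W_def Transposition.transpose_def)
      then have "face_det W (v k) l = - face_det v x l"
        unfolding face_det_def using that
        by (simp only: det_permute_rows permutes_swap_id iso_tuple_UNIV_I sign_swap_id) simp
      with fd show ?thesis by simp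
    qed
    have "(\<Sum>l\<in>UNIV. face_det v x l *\<^sub>R v l) =
        face_det v x k *\<^sub>R v k + (\<Sum>l\<in>UNIV - {k}. face_det v x l *\<^sub>R v l)"
      by (simp add: sum.remove [of UNIV k])
    also have "(\<Sum>l\<in>UNIV - {k}. face_det v x l *\<^sub>R v l) = (\<Sum>l\<in>UNIV - {k}. - face_det v x k *\<^sub>R s l *\<^sub>R W l)"
      by (intro sum.cong) (auto simp: swap W_def)
    also have "\<dots> = - face_det v x k *\<^sub>R (\<Sum>l\<in>UNIV - {k}. s l *\<^sub>R W l)"
      by (simp only: scaleR_sum_right)
    also have "(\<Sum>l\<in>UNIV - {k}. s l *\<^sub>R W l) = v k"
      unfolding s by (simp add: sum.remove [of UNIV k] sk)
    finally show ?thesis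
      by (simp add: det0)
  qed (simp add: det0)
qed

section \<open>Solid angles of simplicial cones\<close>

definition row_cone :: "('n::finite \<Rightarrow> real^'n) \<Rightarrow> (real^'n) set" where
  "row_cone v = {\<Sum>k\<in>UNIV. s k *\<^sub>R v k | s. \<forall>k. 0 \<le> s k}"

definition solid_angle :: "('n::finite \<Rightarrow> real^'n) \<Rightarrow> real" where
  "solid_angle v = sgn (det (\<chi> k. v k)) * measure lebesgue (row_cone v \<inter> cball 0 1) /
    measure lebesgue (cball 0 1 :: (real^'n) set)"

lemma rows_unique:
  fixes v :: "'n::finite \<Rightarrow> real^'n"
  assumes "det (\<chi> k. v k) \<noteq> 0" "(\<Sum>k\<in>UNIV. a k *\<^sub>R v k) = (\<Sum>k\<in>UNIV. b k *\<^sub>R v k)"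
  shows "a k = b k"
  using face_det_combination [of v a k] face_det_combination [of v b k] assms by simp

lemma row_cone_lmeasurable:
  fixes v :: "'n::finite \<Rightarrow> real^'n"
  assumes "det (\<chi> k. v k) \<noteq> 0"
  shows "row_cone v \<inter> cball 0 1 \<in> lmeasurable"
proof -
  define f where "f = (*v) (transpose (\<chi> k. v k))"
  have f: "f t = (\<Sum>i\<in>UNIV. t $ i *\<^sub>R v i)" for t
    by (auto simp: f_def matrix_mult_sum scalar_mult_eq_scaleR column_def transpose_def)
  have "row_cone v = f ` {t. \<forall>k. 0 \<le> t $ k}"
  proof (intro equalityI subsetI)
    fix x assume "x \<in> row_cone v"
    then obtain s where "x = (\<Sum>k\<in>UNIV. s k *\<^sub>R v k)" "\<forall>k. 0 \<le> s k"
      by (auto simp: row_cone_def)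
    then show "x \<in> f ` {t. \<forall>k. 0 \<le> t $ k}"
      by (intro image_eqI [of _ _ "\<chi> k. s k"]) (auto simp: f)
  qed (auto simp: row_cone_def f)
  moreover have "closed {t::real^'n. \<forall>k. 0 \<le> t $ k}"
    by (intro closed_Collect_all closed_Collect_le continuous_intros)
  moreover have "linear f" "inj f"
    using assms by (simp_all add: f_def inj_matrix_vector_mult invertible_det_nz)
  ultimately have "closed (row_cone v)"
    by (simp add: closed_injective_linear_image)
  then show ?thesis
    by (intro lmeasurable_compact closed_Int_compact) auto
qed

text \<open>
  Fix \<open>x\<close> and write \<open>x = \<Sum>\<^sub>i t\<^sub>i V\<^sub>i\<close>, where the \<open>n + 1\<close> vectors \<open>V\<^sub>i\<close> satisfy the single relation
  \<open>\<Sum>\<^sub>i d\<^sub>i V\<^sub>i = 0\<close>. The nonnegative representations of \<open>x\<close> form an interval on the line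
  \<open>t + s d\<close>, and \<open>x\<close> lies in the cone omitting \<open>V\<^sub>i\<close> iff the point of the line with vanishing
  \<open>i\<close>-th coordinate belongs to this interval, i.e. is one of its endpoints.
\<close>

theorem solid_angle_cocycle:
  fixes v :: "'n::finite \<Rightarrow> real^'n" and x :: "real^'n"
  defines "d \<equiv> case_option (det (\<chi> k. v k)) (\<lambda>k. - face_det v x k)"
  assumes signs: "(\<forall>i. d i \<noteq> 0) \<or> ((\<exists>i. d i > 0) \<longleftrightarrow> (\<exists>i. d i < 0))"
  shows "solid_angle v - (\<Sum>k\<in>UNIV. solid_angle (v(k := x))) = constant_sign d"
proof -
  \<comment> \<open>The index \<open>None\<close> stands for the additional vector \<open>x\<close>.
    The map \<open>\<sigma> i\<close> fills the slots of a cone with all indices but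
    \<open>i\<close>; for \<open>Some k\<close> it puts \<open>None\<close> into slot
    \<open>k\<close>, which yields the cone spanned by \<open>v(k := x)\<close>.\<close>
  define V where "V = case_option x v"
  define \<sigma> where "\<sigma> = case_option Some (\<lambda>k j. if j = k then None else Some (j::'n))"
  let ?B = "cball 0 1 :: (real^'n) set"
  have dV: "(\<Sum>i\<in>UNIV. d i *\<^sub>R V i) = 0"
    using cramer_rows [of v x] by (simp add: UNIV_option_conv sum.reindex d_def V_def sum_negf)
  have \<sigma>: "bij_betw (\<sigma> i) UNIV (UNIV - {i})" for i
    by (cases i) (auto simp: bij_betw_def inj_on_def \<sigma>_def image_iff split: if_splits option.splits;
      metis not_None_eq)+
  have sum_\<sigma>: "(\<Sum>j\<in>UNIV. g (\<sigma> i j)) = (\<Sum>l\<in>UNIV - {i}. g l)" for g :: "'n option \<Rightarrow> 'z::comm_monoid_add" and i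
    by (rule sum.reindex_bij_betw [OF \<sigma>])
  have V\<sigma>: "V \<circ> \<sigma> None = v" "V \<circ> \<sigma> (Some k) = v(k := x)" for k
    by (auto simp: fun_eq_iff V_def \<sigma>_def)
  have det_Some: "det (\<chi> j. (v(k := x)) j) = - d (Some k)" for k
    by (simp add: d_def face_det_def fun_upd_def)
  have det\<sigma>: "det (\<chi> j. (V \<circ> \<sigma> i) j) = (if i = None then d i else - d i)" for i
    by (cases i) (simp_all only: V\<sigma> det_Some, simp_all add: d_def)
  \<comment> \<open>A degenerate cone counts with sign 0, so the empty set may replace it, which
    settles measurability.\<close>
  define S where "S i = (if d i = 0 then {} else row_cone (V \<circ> \<sigma> i) \<inter> ?B)" for i
  have S_meas: "S i \<in> lmeasurable" for i
    using row_cone_lmeasurable [of "V \<circ> \<sigma> i"] det\<sigma> [of i]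
    by (cases "d i = 0"; cases "i = None") (simp_all add: S_def)
  have lhs: "solid_angle v - (\<Sum>k\<in>UNIV. solid_angle (v(k := x))) =
      (\<Sum>i\<in>UNIV. sgn (d i) * measure lebesgue (S i)) / measure lebesgue ?B"
  proof -
    have 1: "solid_angle v = sgn (d None) * measure lebesgue (S None) / measure lebesgue ?B"
      by (simp only: solid_angle_def S_def V\<sigma>) (simp add: d_def)
    have 2: "solid_angle (v(k := x)) = - (sgn (d (Some k)) * measure lebesgue (S (Some k)) / measure lebesgue ?B)" for k
      by (simp only: solid_angle_def S_def V\<sigma> det_Some) (simp add: sgn_minus)
    show ?thesis
      unfolding 1 2 by (simp add: UNIV_option_conv sum.reindex add_divide_distrib sum_negf sum_divide_distrib)
  qed
  \<comment> \<open>A point with two vanishing coordinates in one representation lies in one of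
    these spans of n - 1 vectors. Off this null set the ratios compared in the endpoint count are
    distinct.\<close>
  define N where "N = (\<Union>(i, j)\<in>{(i, j). i \<noteq> j}. span (V ` (UNIV - {i, j})))"
  have "negligible N"
    unfolding N_def
  proof (rule negligible_Union)
    fix T assume "T \<in> (\<lambda>(i, j). span (V ` (UNIV - {i, j}))) ` {(i, j). i \<noteq> j}"
    then obtain i j where "i \<noteq> j" and T: "T = span (V ` (UNIV - {i, j}))"
      by auto
    have "dim (V ` (UNIV - {i, j})) \<le> card (V ` (UNIV - {i, j}))"
      by (rule dim_le_card') simp
    also have "\<dots> \<le> card (UNIV - {i, j})"
      by (rule card_image_le) simp
    also have "\<dots> = CARD('n) - 1"
      using \<open>i \<noteq> j\<close> by (simp add: card_Diff_subset)
    also have "\<dots> < CARD('n)"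
      by simp
    finally show "negligible T"
      unfolding T by (intro negligible_lowdim) simp
  qed simp
  have pointwise: "(\<Sum>i\<in>UNIV. sgn (d i) * indicat_real (S i) z) = constant_sign d * indicator ?B z"
    if "z \<notin> N" for z
  proof (cases "z \<in> ?B \<and> (\<exists>i. d i \<noteq> 0)")
    case True
    then obtain i0 where i0: "d i0 \<noteq> 0" by blast
    obtain s where s: "z = (\<Sum>k\<in>UNIV. s k *\<^sub>R (V \<circ> \<sigma> i0) k)"
      using in_span_rows [of "V \<circ> \<sigma> i0" z] i0 det\<sigma> [of i0] by (auto split: if_splits)
    \<comment> \<open>The representation of \<open>z\<close> without \<open>V i0\<close> is a first
      point of the line; \<open>shift\<close> moves along \<open>d\<close> to the one without
      \<open>V i\<close>.\<close>
    define t where "t l = (if l = i0 then 0 else s (inv_into UNIV (\<sigma> i0) l))" for l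
    have inj_\<sigma>: "inj (\<sigma> i)" for i
      using \<sigma> [of i] by (rule bij_betw_imp_inj_on)
    have ne_\<sigma>: "\<sigma> i k \<noteq> i" for i k
      using \<sigma> [of i] by (auto simp: bij_betw_def)
    have z: "z = (\<Sum>l\<in>UNIV. t l *\<^sub>R V l)"
    proof -
      have "z = (\<Sum>k\<in>UNIV. t (\<sigma> i0 k) *\<^sub>R V (\<sigma> i0 k))"
        unfolding s by (simp add: t_def ne_\<sigma> inv_f_f [OF inj_\<sigma>])
      also have "\<dots> = (\<Sum>l\<in>UNIV - {i0}. t l *\<^sub>R V l)"
        by (rule sum_\<sigma>)
      also have "\<dots> = (\<Sum>l\<in>UNIV. t l *\<^sub>R V l)"
        by (simp add: sum.remove [of UNIV i0] t_def)
      finally show ?thesis .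
    qed
    have shift: "z = (\<Sum>l\<in>UNIV - {i}. (t l - t i / d i * d l) *\<^sub>R V l)" if "d i \<noteq> 0" for i
    proof -
      have "z = (\<Sum>l\<in>UNIV. t l *\<^sub>R V l) - (t i / d i) *\<^sub>R (\<Sum>l\<in>UNIV. d l *\<^sub>R V l)"
        by (simp add: z dV)
      also have "\<dots> = (\<Sum>l\<in>UNIV. (t l - t i / d i * d l) *\<^sub>R V l)"
        by (simp add: scaleR_sum_right sum_subtractf scaleR_diff_left)
      also have "\<dots> = (\<Sum>l\<in>UNIV - {i}. (t l - t i / d i * d l) *\<^sub>R V l)"
        using that by (simp add: sum.remove [of UNIV i])
      finally show ?thesis .
    qed
    have mem: "z \<in> row_cone (V \<circ> \<sigma> i) \<longleftrightarrow> (\<forall>j. 0 \<le> t j - t i / d i * d j)" if i: "d i \<noteq> 0" for i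
    proof -
      have nz: "det (\<chi> j. (V \<circ> \<sigma> i) j) \<noteq> 0"
        using i det\<sigma> [of i] by (auto split: if_splits)
      have z\<sigma>: "z = (\<Sum>k\<in>UNIV. (t (\<sigma> i k) - t i / d i * d (\<sigma> i k)) *\<^sub>R (V \<circ> \<sigma> i) k)"
        unfolding shift [OF i] o_def by (rule sum_\<sigma> [symmetric])
      have "z \<in> row_cone (V \<circ> \<sigma> i) \<longleftrightarrow> (\<forall>k. 0 \<le> t (\<sigma> i k) - t i / d i * d (\<sigma> i k))"
      proof
        assume "z \<in> row_cone (V \<circ> \<sigma> i)"
        then obtain s where "z = (\<Sum>k\<in>UNIV. s k *\<^sub>R (V \<circ> \<sigma> i) k)" "\<forall>k. 0 \<le> s k"
          by (auto simp: row_cone_def)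
        with rows_unique [OF nz, of "\<lambda>k. t (\<sigma> i k) - t i / d i * d (\<sigma> i k)" s] z\<sigma>
        show "\<forall>k. 0 \<le> t (\<sigma> i k) - t i / d i * d (\<sigma> i k)"
          by metis
      qed (use z\<sigma> in \<open>auto simp: row_cone_def\<close>)
      also have "\<dots> \<longleftrightarrow> (\<forall>j\<in>range (\<sigma> i). 0 \<le> t j - t i / d i * d j)"
        by simp
      also have "range (\<sigma> i) = UNIV - {i}"
        using \<sigma> [of i] by (simp add: bij_betw_def)
      also have "(\<forall>j\<in>UNIV - {i}. 0 \<le> t j - t i / d i * d j) \<longleftrightarrow> (\<forall>j. 0 \<le> t j - t i / d i * d j)"
        using i by auto
      finally show ?thesis .
    qed
    have generic: "t i * d j \<noteq> t j * d i" if "i \<noteq> j" "d i \<noteq> 0" "d j \<noteq> 0" for i j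
    proof
      assume eq: "t i * d j = t j * d i"
      have "z = (\<Sum>l\<in>UNIV - {i, j}. (t l - t i / d i * d l) *\<^sub>R V l)"
      proof -
        have "UNIV - {i} - {j} = UNIV - {i, j}" by blast
        moreover have "t j - t i / d i * d j = 0"
          using eq that by (simp add: field_simps)
        ultimately show ?thesis
          using \<open>i \<noteq> j\<close> shift [OF \<open>d i \<noteq> 0\<close>] by (simp add: sum.remove [of "UNIV - {i}" j])
      qed
      then have "z \<in> span (V ` (UNIV - {i, j}))"
        by (metis (no_types, lifting) image_eqI span_base span_scale span_sum)
      with \<open>z \<notin> N\<close> \<open>i \<noteq> j\<close> show False
        unfolding N_def by blast
    qed
    have "(\<Sum>i\<in>UNIV. sgn (d i) * indicat_real (S i) z) =
        (\<Sum>i\<in>UNIV. sgn (d i) * (if \<forall>j. 0 \<le> t j - t i / d i * d j then 1 else 0))"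
    proof (intro sum.cong refl)
      fix i
      show "sgn (d i) * indicat_real (S i) z = sgn (d i) * (if \<forall>j. 0 \<le> t j - t i / d i * d j then 1 else 0)"
        using True mem [of i] by (cases "d i = 0") (simp_all add: S_def indicator_def)
    qed
    also have "\<dots> = constant_sign d"
      by (rule signed_endpoint_count [OF generic signs])
    finally show ?thesis
      using True by simp
  next
    case False
    then show ?thesis
      by (auto simp: S_def indicator_def constant_sign_def)
  qed
  have int: "integrable lebesgue (\<lambda>z. sgn (d i) * indicat_real (S i) z)" for i
    using S_meas [of i] by (intro integrable_mult_right integrable_real_indicator) (auto simp: fmeasurable_def)
  have "(\<Sum>i\<in>UNIV. sgn (d i) * measure lebesgue (S i)) =
      (LINT z|lebesgue. (\<Sum>i\<in>UNIV. sgn (d i) * indicat_real (S i) z))"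
    using S_meas int by (subst Bochner_Integration.integral_sum) simp_all
  also have "\<dots> = (LINT z|lebesgue. constant_sign d * indicat_real ?B z)"
  proof (rule integral_cong_AE)
    show "AE z in lebesgue. (\<Sum>i\<in>UNIV. sgn (d i) * indicat_real (S i) z) = constant_sign d * indicat_real ?B z"
      using \<open>negligible N\<close> pointwise
      by (intro AE_I' [of N]) (auto simp: negligible_iff_null_sets)
  next
    show "(\<lambda>z. \<Sum>i\<in>UNIV. sgn (d i) * indicat_real (S i) z) \<in> borel_measurable lebesgue"
      using int by (intro borel_measurable_integrable Bochner_Integration.integrable_sum) auto
    show "(\<lambda>z. constant_sign d * indicat_real ?B z) \<in> borel_measurable lebesgue"
      by (intro borel_measurable_times borel_measurable_const borel_measurable_indicator) simp
  qed
  also have "\<dots> = constant_sign d * measure lebesgue ?B"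
    by simp
  finally show ?thesis
    unfolding lhs using content_cball_pos [of 1 "0::real^'n"] by (simp add: measure_completion)
qed

text \<open>These are the n + 1 facet hyperplanes of the simplex on 0 and \<open>y\<close>. In
  coordinates with respect to \<open>y\<close> they are the coordinate hyperplanes and the plane of
  coordinate sum 1.\<close>

lemma negligible_face_planes:
  fixes y :: "'n::finite \<Rightarrow> real^'n"
  assumes "det (\<chi> k. y k) \<noteq> 0"
  shows "negligible {u. (\<exists>k. face_det y u k = 0) \<or> det (\<chi> j. y j - u) = 0}"
proof -
  define f where "f = (*v) (transpose (\<chi> k. y k))"
  have f: "f t = (\<Sum>i\<in>UNIV. t $ i *\<^sub>R y i)" for t
    by (auto simp: f_def matrix_mult_sum scalar_mult_eq_scaleR column_def transpose_def)
  let ?H = "(\<Union>k. {t::real^'n. axis k 1 \<bullet> t = 0}) \<union> {t. 1 \<bullet> t = 1}"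
  have "negligible ?H"
    by (intro negligible_Un negligible_Union) (auto intro!: negligible_hyperplane simp: axis_eq_0_iff)
  then have "negligible (f ` ?H)"
    using measure_linear_image_cart [of f ?H] by (simp add: f_def negligible_iff_measure)
  moreover have "{u. (\<exists>k. face_det y u k = 0) \<or> det (\<chi> j. y j - u) = 0} \<subseteq> f ` ?H"
  proof
    fix u assume u: "u \<in> {u. (\<exists>k. face_det y u k = 0) \<or> det (\<chi> j. y j - u) = 0}"
    obtain t where t: "u = (\<Sum>i\<in>UNIV. t i *\<^sub>R y i)"
      using in_span_rows assms by blast
    have fd: "face_det y u k = t k * det (\<chi> k. y k)" for k
      unfolding t by (rule face_det_combination)
    have "det (\<chi> j. y j - u) = (1 - (\<Sum>k\<in>UNIV. t k)) * det (\<chi> k. y k)"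
      unfolding det_diff_rows by (simp only: face_det_def [symmetric] fd left_diff_distrib sum_distrib_right mult_1_left)
    with u fd assms have "(\<exists>k. t k = 0) \<or> (\<Sum>k\<in>UNIV. t k) = 1"
      by auto
    moreover have "1 \<bullet> (\<chi> k. t k) = (\<Sum>k\<in>UNIV. t k)"
      by (simp add: inner_vec_def)
    ultimately have "(\<chi> k. t k) \<in> ?H"
      by (simp add: inner_axis')
    moreover have "u = f (\<chi> k. t k)"
      by (simp add: f t)
    ultimately show "u \<in> f ` ?H"
      by blast
  qed
  ultimately show ?thesis
    by (rule negligible_subset)
qed

text \<open>The cocycle identity for the simplex on 0 and \<open>y\<close> seen from
  \<open>u\<close>; the extra vector \<open>- u\<close> points from \<open>u\<close> to 0. The
  coefficients of the relation sum to the determinant of \<open>y\<close>. If this is 0, both signs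
  occur among them or none; otherwise they are all nonzero off the facet hyperplanes. A common
  strict sign means that \<open>u\<close> is inside the simplex.\<close>

corollary negligible_solid_angle_defect:
  fixes y :: "'n::finite \<Rightarrow> real^'n"
  shows "negligible {u. solid_angle (\<lambda>k. y k - u) -
    (\<Sum>k\<in>UNIV. solid_angle ((\<lambda>k. y k - u)(k := - u))) \<noteq> simplex_sign y u}"
proof -
  have eq: "solid_angle (\<lambda>k. y k - u) - (\<Sum>k\<in>UNIV. solid_angle ((\<lambda>k. y k - u)(k := - u))) = simplex_sign y u"
    if u: "det (\<chi> k. y k) = 0 \<or> \<not> ((\<exists>k. face_det y u k = 0) \<or> det (\<chi> j. y j - u) = 0)" for u
  proof -
    let ?d = "case_option (det (\<chi> k. y k - u)) (\<lambda>k. - face_det (\<lambda>k. y k - u) (- u) k)"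
    have face: "- face_det (\<lambda>k. y k - u) (- u) k = face_det y u k" for k
    proof -
      \<comment> \<open>Row \<open>k\<close> is \<open>- u\<close> and clears the summand
        \<open>- u\<close> from the other rows.\<close>
      have "face_det (\<lambda>k. y k - u) (- u) k = det (\<chi> j. if j = k then - u else y j + 1 *s (- u))"
        unfolding face_det_def by (intro arg_cong [of _ _ det]) (auto simp: vec_eq_iff)
      also have "\<dots> = det (\<chi> j. if j = k then (-1) *s u else y j)"
        unfolding det_add_row_multiples by (intro arg_cong [of _ _ det]) (auto simp: vec_eq_iff)
      also have "\<dots> = - face_det y u k"
        unfolding det_row_mul face_det_def by simp
      finally show ?thesis by simp
    qed
    have dets: "det (\<chi> k. y k - u) = det (\<chi> k. y k) - (\<Sum>k\<in>UNIV. face_det y u k)"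
      unfolding det_diff_rows face_det_def ..
    have sum_d: "(\<Sum>i\<in>UNIV. ?d i) = det (\<chi> k. y k)"
      by (simp add: UNIV_option_conv sum.reindex face dets)
    have "(\<forall>i. ?d i \<noteq> 0) \<or> ((\<exists>i. ?d i > 0) \<longleftrightarrow> (\<exists>i. ?d i < 0))"
    proof (cases "det (\<chi> k. y k) = 0")
      case True
      then have 0: "(\<Sum>i\<in>UNIV. ?d i) = 0"
        using sum_d by simp
      have "(\<forall>i. ?d i = 0)" if "(\<forall>i. 0 \<le> ?d i) \<or> (\<forall>i. 0 \<le> - ?d i)"
        using that
      proof
        assume "\<forall>i. 0 \<le> ?d i"
        with 0 show ?thesis
          using sum_nonneg_eq_0_iff [of UNIV ?d] by simp
      next
        assume "\<forall>i. 0 \<le> - ?d i"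
        with 0 show ?thesis
          using sum_nonneg_eq_0_iff [of UNIV "\<lambda>i. - ?d i"] by (simp add: sum_negf)
      qed
      then show ?thesis
        by (metis leI less_irrefl neg_0_le_iff_le)
    next
      case False
      with u show ?thesis
        by (auto simp: face split: option.splits)
    qed
    then have "solid_angle (\<lambda>k. y k - u) - (\<Sum>k\<in>UNIV. solid_angle ((\<lambda>k. y k - u)(k := - u))) = constant_sign ?d"
      by (rule solid_angle_cocycle)
    also have "\<dots> = simplex_sign y u"
    proof -
      have "(\<forall>i. ?d i > 0) \<longleftrightarrow> (\<forall>k. face_det y u k > 0) \<and> (\<Sum>k\<in>UNIV. face_det y u k) < det (\<chi> k. y k)"
        unfolding face dets split_option_all by auto
      moreover have "(\<forall>i. ?d i < 0) \<longleftrightarrow> (\<forall>k. face_det y u k < 0) \<and> (\<Sum>k\<in>UNIV. face_det y u k) > det (\<chi> k. y k)"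
        unfolding face dets split_option_all by auto
      ultimately show ?thesis
        by (simp only: constant_sign_def simplex_sign_def)
    qed
    finally show ?thesis .
  qed
  show ?thesis
  proof (cases "det (\<chi> k. y k) = 0")
    case True
    then show ?thesis
      using eq by simp
  next
    case False
    show ?thesis
      by (rule negligible_subset [OF negligible_face_planes [OF False]]) (use eq in blast)
  qed
qed

section \<open>Tuples and ordered rows\<close>

abbreviation idx :: "'n::finite \<Rightarrow> nat" where
  "idx \<equiv> to_nat_on (UNIV :: 'n set)"

lemma idx_less: "idx (k :: 'n::finite) < CARD('n)"
  using to_nat_on_finite [of "UNIV :: 'n set"] by (auto simp: bij_betw_def)

lemma idx_eq_iff: "idx (k :: 'n::finite) = idx l \<longleftrightarrow> k = l"
  using to_nat_on_finite [of "UNIV :: 'n set"] by (auto simp: bij_betw_def inj_on_def)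

lemma ex_idx: "j < CARD('n) \<Longrightarrow> \<exists>k :: 'n::finite. idx k = j"
  using bij_betw_imp_surj_on [OF to_nat_on_finite [of "UNIV :: 'n set"]]
  by (metis finite imageE lessThan_iff)

lemma sum_idx: "(\<Sum>k\<in>UNIV. g (idx (k :: 'n::finite))) = (\<Sum>j<CARD('n). g j)"
  by (rule sum.reindex_bij_betw) (simp add: to_nat_on_finite)

lemma prod_idx: "(\<Prod>k\<in>UNIV. g (idx (k :: 'n::finite))) = (\<Prod>j<CARD('n). g j)"
  by (rule prod.reindex_bij_betw) (simp add: to_nat_on_finite)

text \<open>Rows are numbered by naturals so that lists can fill them; \<open>idx\<close> is the
  enumeration that orients the space.\<close>

definition row_det :: "(nat \<Rightarrow> real^'n) \<Rightarrow> real" where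
  "row_det f = det (\<chi> k. f (idx (k :: 'n::finite)))"

lemma row_det_cong:
  fixes f g :: "nat \<Rightarrow> real^'n"
  shows "(\<And>j. j < CARD('n) \<Longrightarrow> f j = g j) \<Longrightarrow> row_det f = row_det g"
  by (simp add: row_det_def idx_less)

lemma row_det_update:
  fixes f :: "nat \<Rightarrow> real^'n"
  shows "row_det (f(idx k := v)) = det (\<chi> j. if j = k then v else f (idx j))"
  unfolding row_det_def by (intro arg_cong [of _ _ det]) (auto simp: vec_eq_iff idx_eq_iff)

lemma row_det_sum:
  fixes f :: "nat \<Rightarrow> real^'n"
  assumes "j < CARD('n)" "finite S"
  shows "row_det (f(j := \<Sum>i\<in>S. a i *\<^sub>R v i)) = (\<Sum>i\<in>S. a i * row_det (f(j := v i)))"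
proof -
  obtain k :: 'n where k: "j = idx k"
    using ex_idx assms by metis
  show ?thesis
    unfolding k row_det_update det_linear_row_sum [OF \<open>finite S\<close>]
    by (simp only: scalar_mult_eq_scaleR [symmetric] det_row_mul)
qed

lemma row_det_transpose:
  fixes f :: "nat \<Rightarrow> real^'n"
  assumes "a < CARD('n)" "b < CARD('n)" "a \<noteq> b"
  shows "row_det (f \<circ> Transposition.transpose a b) = - row_det f"
proof -
  obtain k l :: 'n where kl: "a = idx k" "b = idx l"
    using ex_idx assms by metis
  have "(f \<circ> Transposition.transpose a b) (idx j) = f (idx (Transposition.transpose k l j))" for j
    by (auto simp: kl Transposition.transpose_def idx_eq_iff)
  then have "row_det (f \<circ> Transposition.transpose a b) =
      det (\<chi> j. (\<chi> j. f (idx j)) $ Transposition.transpose k l j)"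
    unfolding row_det_def by simp
  then show ?thesis
    using assms kl by (simp only: det_permute_rows permutes_swap_id iso_tuple_UNIV_I sign_swap_id)
      (auto simp: row_det_def)
qed

lemma row_det_permute:
  fixes f :: "nat \<Rightarrow> real^'n"
  assumes "p permutes {..<CARD('n)}"
  shows "row_det (f \<circ> p) = of_int (sign p) * row_det f"
  using assms finite_lessThan
proof (induction arbitrary: f rule: permutes_induct)
  case (swap a b p)
  have "row_det (f \<circ> (Transposition.transpose a b \<circ> p)) =
      of_int (sign p) * row_det (f \<circ> Transposition.transpose a b)"
    using swap.IH [of "f \<circ> Transposition.transpose a b"] by (simp only: o_assoc)
  moreover have "permutation p"
    using \<open>p permutes {..<CARD('n)}\<close> by (rule permutes_imp_permutation [OF finite_lessThan])
  ultimately show ?case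
    using swap.hyps row_det_transpose [of a b f]
    by (simp only: sign_compose permutation_swap_id sign_swap_id lessThan_iff) simp
qed simp

lemma row_det_eq_0:
  fixes f :: "nat \<Rightarrow> real^'n"
  assumes "a < CARD('n)" "b < CARD('n)" "a \<noteq> b" "f a = f b"
  shows "row_det f = 0"
proof -
  have "f \<circ> Transposition.transpose a b = f"
    using assms by (auto simp: fun_eq_iff Transposition.transpose_def)
  with row_det_transpose [OF assms(1-3), of f] show ?thesis
    by simp
qed

section \<open>Tuples of vertices, flags and exponent vectors\<close>

definition tuples :: "nat \<Rightarrow> nat \<Rightarrow> nat list set" where
  "tuples m k = {xs. set xs \<subseteq> {..<m} \<and> length xs = k}"

lemma finite_tuples [simp]: "finite (tuples m k)"
  by (simp add: tuples_def finite_lists_length_eq)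

lemma tuples_0: "tuples m 0 = {[]}"
  by (auto simp: tuples_def)

lemma sum_tuples_snoc:
  "(\<Sum>xs\<in>tuples m (Suc k). h xs) = (\<Sum>xs\<in>tuples m k. \<Sum>i<m. h (xs @ [i]))"
  unfolding sum.cartesian_product
  by (rule sum.reindex_bij_witness [of _ "\<lambda>(xs, i). xs @ [i]" "\<lambda>xs. (butlast xs, last xs)"])
    (auto simp: tuples_def length_Suc_conv_rev)

text \<open>A full flag of faces of \<open>I\<close> is an ordering of \<open>I\<close>: each
  repetition-free tuple arises from exactly one set, that of its entries, and one permutation of the
  sorted list.\<close>

lemma sum_flags:
  "(\<Sum>I | I \<subseteq> {..<m} \<and> card I = n. \<Sum>p | p permutes {..<n}. h (permute_list p (sorted_list_of_set I))) =
    (\<Sum>xs | xs \<in> tuples m n \<and> distinct xs. h xs)"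
proof -
  let ?S = "SIGMA I : {I. I \<subseteq> {..<m} \<and> card I = n}. {p. p permutes {..<n}}"
  let ?f = "\<lambda>(I, p). permute_list p (sorted_list_of_set I)"
  have fin: "finite I" if "I \<subseteq> {..<m}" for I
    using that finite_subset by blast
  have "bij_betw ?f ?S {xs. xs \<in> tuples m n \<and> distinct xs}"
  proof (rule bij_betwI')
    fix x y assume x: "x \<in> ?S" and y: "y \<in> ?S"
    obtain I p where x': "x = (I, p)"
      by (cases x)
    obtain J q where y': "y = (J, q)"
      by (cases y)
    note xy = x' y'
    show "?f x = ?f y \<longleftrightarrow> x = y"
    proof
      assume eq: "?f x = ?f y"
      have I: "set (permute_list p (sorted_list_of_set I)) = I" "length (sorted_list_of_set I) = n"
        and J: "set (permute_list q (sorted_list_of_set J)) = J"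
        using x y fin by (auto simp: xy)
      then have "I = J"
        using eq by (simp add: xy)
      have pq: "p permutes {..<n}" "q permutes {..<n}"
        using x y by (auto simp: xy)
      have "p i = q i" for i
      proof (cases "i < n")
        case True
        have "permute_list p (sorted_list_of_set I) ! i = permute_list q (sorted_list_of_set I) ! i"
          using eq \<open>I = J\<close> by (simp add: xy)
        then have "sorted_list_of_set I ! p i = sorted_list_of_set I ! q i"
          using True pq I(2) by (simp add: permute_list_nth)
        moreover have "p i < n" "q i < n"
          using True permutes_in_image [OF pq(1), of i] permutes_in_image [OF pq(2), of i] by auto
        ultimately show ?thesis
          using I(2) by (simp add: nth_eq_iff_index_eq)
      next
        case False
        then show ?thesis
          using pq by (simp add: permutes_not_in)
      qed
      with \<open>I = J\<close> show "x = y"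
        by (auto simp: xy)
    qed simp
  next
    fix x assume "x \<in> ?S"
    then show "?f x \<in> {xs. xs \<in> tuples m n \<and> distinct xs}"
      using fin by (auto simp: tuples_def)
  next
    fix xs assume xs: "xs \<in> {xs. xs \<in> tuples m n \<and> distinct xs}"
    then have "mset xs = mset (sorted_list_of_set (set xs))"
      by (simp add: set_eq_iff_mset_eq_distinct [symmetric])
    then obtain p where "p permutes {..<length (sorted_list_of_set (set xs))}"
        "permute_list p (sorted_list_of_set (set xs)) = xs"
      by (rule mset_eq_permutation)
    then show "\<exists>x\<in>?S. xs = ?f x"
      using xs by (intro bexI [of _ "(set xs, p)"]) (auto simp: tuples_def distinct_card)
  qed
  then have "(\<Sum>x\<in>?S. h (?f x)) = (\<Sum>xs | xs \<in> tuples m n \<and> distinct xs. h xs)"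
    by (rule sum.reindex_bij_betw)
  then show ?thesis
    by (subst sum.Sigma) (auto simp: finite_permutations case_prod_unfold intro: finite_subset [of _ "Pow {..<m}"])
qed

definition exps :: "nat list \<Rightarrow> nat \<Rightarrow>\<^sub>0 nat" where
  "exps xs = (\<Sum>i\<leftarrow>xs. Poly_Mapping.single i 1)"

lemma exps_simps [simp]:
  "exps [] = 0" "exps (i # xs) = Poly_Mapping.single i 1 + exps xs" "exps (xs @ ys) = exps xs + exps ys"
  by (simp_all add: exps_def)

lemma exps_cong_mset: "mset xs = mset ys \<Longrightarrow> exps xs = exps ys"
  unfolding exps_def by (metis mset_map sum_mset_sum_list)

section \<open>Multi-fans from weighted vectors\<close>

lemma signed_solid_angle_eq:
  fixes y :: "nat \<Rightarrow> real^'n"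
  shows "signed_solid_angle y u = solid_angle (\<lambda>k. y (idx k) - u)"
proof -
  have "{\<Sum>k<CARD('n). t k *\<^sub>R (y k - u) | t. \<forall>k<CARD('n). 0 \<le> t k} = row_cone (\<lambda>k. y (idx k) - u)"
  proof (intro equalityI subsetI)
    fix x assume "x \<in> {\<Sum>k<CARD('n). t k *\<^sub>R (y k - u) | t. \<forall>k<CARD('n). 0 \<le> t k}"
    then obtain t where t: "x = (\<Sum>k<CARD('n). t k *\<^sub>R (y k - u))" "\<forall>k<CARD('n). 0 \<le> t k"
      by blast
    have "x = (\<Sum>k\<in>UNIV. t (idx k) *\<^sub>R (y (idx (k :: 'n)) - u))"
      unfolding t by (rule sum_idx [symmetric])
    with t(2) show "x \<in> row_cone (\<lambda>k. y (idx k) - u)"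
      unfolding row_cone_def by (intro CollectI exI [of _ "\<lambda>k. t (idx k)"]) (auto simp: idx_less)
  next
    fix x assume "x \<in> row_cone (\<lambda>k::'n. y (idx k) - u)"
    then obtain s where s: "x = (\<Sum>k\<in>UNIV. s k *\<^sub>R (y (idx (k :: 'n)) - u))" "\<forall>k. 0 \<le> s k"
      unfolding row_cone_def by blast
    define t where "t j = s (the_inv idx j)" for j
    have t_idx: "t (idx k) = s k" for k
      unfolding t_def by (subst the_inv_f_f) (auto simp: inj_def idx_eq_iff)
    have "x = (\<Sum>j<CARD('n). t j *\<^sub>R (y j - u))"
      unfolding s(1) t_idx [symmetric] by (rule sum_idx)
    moreover have "\<forall>j<CARD('n). 0 \<le> t j"
      using s(2) t_idx ex_idx by metis
    ultimately show "x \<in> {\<Sum>k<CARD('n). t k *\<^sub>R (y k - u) | t. \<forall>k<CARD('n). 0 \<le> t k}"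
      by blast
  qed
  then show ?thesis
    unfolding signed_solid_angle_def solid_angle_def by simp
qed

text \<open>\<open>g t\<close> plays the role of the integral of the monomial with exponents
  \<open>t\<close>, and \<open>relation\<close> is the vanishing of \<Sum> \<lambda>_i \<otimes> x_i
  tested against all monomials. \<open>generic\<close> is the independence of any n or fewer of the
  vectors, given by dual vectors, which also solve the hyperplane equations.\<close>

locale weighted_vectors =
  fixes m :: nat and lam :: "nat \<Rightarrow> real^'n" and g :: "(nat \<Rightarrow>\<^sub>0 nat) \<Rightarrow> real"
  assumes relation: "(\<Sum>i<m. g (t + Poly_Mapping.single i 1) *\<^sub>R lam i) = 0"
    and generic: "I \<subseteq> {..<m} \<Longrightarrow> card I \<le> CARD('n) \<Longrightarrow> i \<in> I \<Longrightarrow>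
      \<exists>D. D \<bullet> lam i = 1 \<and> (\<forall>j\<in>I - {i}. D \<bullet> lam j = 0)"
begin

text \<open>
  \<open>W (i\<^sub>0, \<dots>, i\<^sub>n\<^sub>-\<^sub>1)\<close> is the alternating extension of \<open>w\<close> to all tuples, so it absorbs the sign of
  the permutation in \<open>DH\<close>.
\<close>

definition W :: "nat list \<Rightarrow> real" where
  "W xs = g (exps xs) * row_det (\<lambda>j. lam (xs ! j))"

definition w :: "nat set \<Rightarrow> real" where
  "w I = (if I \<subseteq> {..<m} \<and> card I = CARD('n) then W (sorted_list_of_set I) else 0)"

text \<open>By linearity in one row the sum is a single determinant whose row at position
  \<open>length ys\<close> is the vanishing vector of \<open>relation\<close>.\<close>

lemma sum_W_middle:
  assumes "length ys + length zs + 1 = CARD('n)"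
  shows "(\<Sum>i<m. W (ys @ i # zs)) = 0"
proof -
  define f where "f j = lam ((ys @ 0 # zs) ! j)" for j
  have "W (ys @ i # zs) = g (exps (ys @ zs) + Poly_Mapping.single i 1) * row_det (f(length ys := lam i))" for i
  proof -
    have "row_det (\<lambda>j. lam ((ys @ i # zs) ! j)) = row_det (f(length ys := lam i))"
      by (rule row_det_cong) (auto simp: f_def nth_append nth_Cons')
    then show ?thesis
      by (simp add: W_def ac_simps)
  qed
  then have "(\<Sum>i<m. W (ys @ i # zs)) =
      row_det (f(length ys := \<Sum>i<m. g (exps (ys @ zs) + Poly_Mapping.single i 1) *\<^sub>R lam i))"
    using assms by (simp add: row_det_sum)
  also have "\<dots> = 0"
  proof -
    \<comment> \<open>A determinant with a zero row is treated as linearity for the empty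
      sum.\<close>
    have "row_det (f(length ys := \<Sum>i\<in>{}. g (exps zs) *\<^sub>R lam i)) = (\<Sum>i\<in>{}. g (exps zs) * row_det (f(length ys := lam i)))"
      using assms by (intro row_det_sum) auto
    then show ?thesis
      unfolding relation by simp
  qed
  finally show ?thesis .
qed

lemma W_not_distinct:
  assumes "length xs = CARD('n)" "\<not> distinct xs"
  shows "W xs = 0"
proof -
  obtain i j where "i < length xs" "j < length xs" "i \<noteq> j" "xs ! i = xs ! j"
    using assms(2) by (auto simp: distinct_conv_nth)
  then have "row_det (\<lambda>j. lam (xs ! j)) = 0"
    using assms(1) by (intro row_det_eq_0 [of i j]) auto
  then show ?thesis
    by (simp add: W_def)
qed

lemma W_permute:
  assumes "length xs = CARD('n)" "p permutes {..<CARD('n)}"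
  shows "W (permute_list p xs) = of_int (sign p) * W xs"
proof -
  have "row_det (\<lambda>j. lam (permute_list p xs ! j)) = row_det ((\<lambda>j. lam (xs ! j)) \<circ> p)"
    using assms by (intro row_det_cong) (simp add: permute_list_nth)
  moreover have "exps (permute_list p xs) = exps xs"
    using assms by (intro exps_cong_mset) simp
  ultimately show ?thesis
    using assms by (simp only: W_def row_det_permute) simp
qed

lemma W_swap:
  assumes "length (ys @ a # b # zs) = CARD('n)"
  shows "W (ys @ a # b # zs) = - W (ys @ b # a # zs)"
proof -
  let ?l = "length ys" and ?f = "\<lambda>j. lam ((ys @ b # a # zs) ! j)"
  have "row_det (\<lambda>j. lam ((ys @ a # b # zs) ! j)) = row_det (?f \<circ> Transposition.transpose ?l (Suc ?l))"
    by (intro row_det_cong) (auto simp: Transposition.transpose_def nth_append nth_Cons')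
  also have "\<dots> = - row_det ?f"
    using assms by (intro row_det_transpose) auto
  finally show ?thesis
    by (simp add: W_def ac_simps)
qed

lemma W_move_front:
  assumes "length (ys @ i # zs) = CARD('n)"
  shows "W (ys @ i # zs) = (- 1) ^ length ys * W (i # ys @ zs)"
  using assms
proof (induction ys arbitrary: zs rule: rev_induct)
  case (snoc a ys)
  have "W (ys @ a # i # zs) = - W (ys @ i # a # zs)"
    using snoc.prems by (intro W_swap) simp
  also have "W (ys @ i # a # zs) = (- 1) ^ length ys * W (i # ys @ a # zs)"
    using snoc.prems by (intro snoc.IH) simp
  finally show ?case
    by simp
qed simp

text \<open>Moving \<open>i\<close> from its sorted position to the front costs one sign per smaller
  element of \<open>J\<close>, which is the sign in the boundary. The boundary coefficient is thus
  the sum of \<open>W\<close> over the first entry, where an \<open>i\<close> already in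
  \<open>J\<close> contributes 0.\<close>

lemma simplicial_cycle_w: "simplicial_cycle m CARD('n) w"
  unfolding simplicial_cycle_def
proof (intro conjI allI impI)
  fix J assume J: "J \<subseteq> {..<m} \<and> card J + 1 = CARD('n)"
  then have "finite J"
    using finite_subset by blast
  have *: "(- 1) ^ card {j \<in> J. j < i} * w (insert i J) = W (i # sorted_list_of_set J)"
    if i: "i \<in> {..<m} - J" for i
  proof -
    define ys zs where "ys = sorted_list_of_set {j \<in> J. j < i}" and "zs = sorted_list_of_set {j \<in> J. i < j}"
    have neq: "j < i \<or> i < j" if "j \<in> J" for j
      using i that by (metis Diff_iff nat_neq_iff)
    have yz: "sorted_list_of_set J = ys @ zs"
      using \<open>finite J\<close> by (intro sorted_distinct_set_unique)
        (auto simp: ys_def zs_def sorted_append dest: neq)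
    have iyz: "sorted_list_of_set (insert i J) = ys @ i # zs"
      using \<open>finite J\<close> i by (intro sorted_distinct_set_unique)
        (auto simp: ys_def zs_def sorted_append set_insort_key
          sorted_insort distinct_insort dest: neq)
    have len: "length (ys @ i # zs) = CARD('n)"
      unfolding iyz [symmetric] using J \<open>finite J\<close> i by simp
    have "w (insert i J) = W (ys @ i # zs)"
      using J i \<open>finite J\<close> by (simp add: w_def iyz)
    also have "\<dots> = (- 1) ^ length ys * W (i # sorted_list_of_set J)"
      unfolding yz by (rule W_move_front [OF len])
    also have "length ys = card {j \<in> J. j < i}"
      by (simp add: ys_def)
    finally show ?thesis
      by (simp flip: mult.assoc power_add mult_2)
  qed
  have "(\<Sum>i\<in>{..<m} - J. (- 1) ^ card {j \<in> J. j < i} * w (insert i J)) =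
      (\<Sum>i\<in>{..<m} - J. W (i # sorted_list_of_set J))"
    by (intro sum.cong refl *)
  also have "\<dots> = (\<Sum>i<m. W ([] @ i # sorted_list_of_set J))"
    using J \<open>finite J\<close> by (intro sum.mono_neutral_cong_left) (auto intro!: W_not_distinct)
  also have "\<dots> = 0"
    using J \<open>finite J\<close> by (intro sum_W_middle) simp
  finally show "(\<Sum>i\<in>{..<m} - J. (- 1) ^ card {j \<in> J. j < i} * w (insert i J)) = 0" .
qed (auto simp: w_def split: if_splits)

lemma complete_multi_fan_w: "complete_multi_fan m w lam"
  unfolding complete_multi_fan_def
proof (intro conjI allI impI simplicial_cycle_w)
  fix I assume I: "I \<subseteq> {..<m} \<and> card I = CARD('n) \<and> w I \<noteq> 0"
  then have "finite I"
    using finite_subset by blast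
  have dual: "\<exists>D. D \<bullet> lam i = 1 \<and> (\<forall>j\<in>I - {i}. D \<bullet> lam j = 0)" if "i \<in> I" for i
    using that I by (intro generic) auto
  show inj: "inj_on lam I"
  proof (rule inj_onI, rule ccontr)
    fix i j assume "i \<in> I" "j \<in> I" "lam i = lam j" "i \<noteq> j"
    with dual [of i] show False
      by force
  qed
  show "independent (lam ` I)"
    unfolding dependent_finite [OF finite_imageI [OF \<open>finite I\<close>]]
  proof clarify
    fix u i assume 0: "(\<Sum>v\<in>lam ` I. u v *\<^sub>R v) = 0" and "i \<in> I" "u (lam i) \<noteq> 0"
    obtain D where D: "D \<bullet> lam i = 1" "\<forall>j\<in>I - {i}. D \<bullet> lam j = 0"
      using dual [OF \<open>i \<in> I\<close>] by blast
    have "0 = D \<bullet> (\<Sum>j\<in>I. u (lam j) *\<^sub>R lam j)"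
      using 0 by (simp add: sum.reindex [OF inj])
    also have "\<dots> = (\<Sum>j\<in>I. u (lam j) * (D \<bullet> lam j))"
      by (simp add: inner_sum_right)
    also have "\<dots> = u (lam i)"
      using \<open>i \<in> I\<close> \<open>finite I\<close> D by (simp add: sum.remove [of I i])
    finally show False
      using \<open>u (lam i) \<noteq> 0\<close> by simp
  qed
  moreover have "card (lam ` I) = CARD('n)"
    using I card_image [OF inj] by simp
  ultimately show "span (lam ` I) = UNIV"
    using card_eq_dim [of "lam ` I" "UNIV :: (real^'n) set"] \<open>finite I\<close>
    by (auto simp: dim_UNIV)
qed
end

section \<open>The Duistermaat--Heckman function and its integral as sums over tuples\<close>

context weighted_vectors
begin

text \<open>The closest point is known to lie in a set only if the set is closed and nonempty; the
  dual vectors, combined with coefficients \<open>c i\<close>, provide a common point of the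
  hyperplanes.\<close>

lemma barycenter_image_inner:
  assumes "J \<subseteq> {..<m}" "card J \<le> CARD('n)" "i \<in> J"
  shows "lam i \<bullet> barycenter_image lam c J = c i"
proof -
  have "finite J"
    using assms finite_subset by blast
  have "\<forall>i\<in>J. \<exists>D. D \<bullet> lam i = 1 \<and> (\<forall>j\<in>J - {i}. D \<bullet> lam j = 0)"
    using generic assms by blast
  then obtain D where D: "\<And>i. i \<in> J \<Longrightarrow> D i \<bullet> lam i = 1" "\<And>i j. i \<in> J \<Longrightarrow> j \<in> J - {i} \<Longrightarrow> D i \<bullet> lam j = 0"
    by metis
  have "(\<Sum>i\<in>J. c i *\<^sub>R D i) \<bullet> lam j = c j" if "j \<in> J" for j
  proof -
    have "(\<Sum>i\<in>J. c i *\<^sub>R D i) \<bullet> lam j = (\<Sum>i\<in>J. if i = j then c j else 0)"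
      unfolding inner_sum_left using D that by (intro sum.cong) auto
    then show ?thesis
      using that \<open>finite J\<close> by simp
  qed
  then have "(\<Inter>i\<in>J. support_hyperplane lam c i) \<noteq> {}"
    by (auto simp: support_hyperplane_def)
  moreover have "closed (\<Inter>i\<in>J. support_hyperplane lam c i)"
    unfolding support_hyperplane_def inner_commute [of _ "lam _"]
    by (intro closed_INT ballI closed_hyperplane)
  ultimately have "barycenter_image lam c J \<in> (\<Inter>i\<in>J. support_hyperplane lam c i)"
    unfolding barycenter_image_def by (rule closest_point_in_set [rotated])
  then show ?thesis
    using \<open>i \<in> J\<close> by (auto simp: support_hyperplane_def inner_commute)
qed

definition flag_vertex :: "(nat \<Rightarrow> real) \<Rightarrow> nat list \<Rightarrow> nat \<Rightarrow> real^'n" where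
  "flag_vertex c xs k = barycenter_image lam c (set (take (Suc k) xs))"

text \<open>Since \<open>W\<close> vanishes on tuples with a repetition, the sum over flags extends
  to all tuples and can then be carried out entry by entry.\<close>

lemma DH_eq_sum_tuples:
  "DH m w lam c u = (\<Sum>xs\<in>tuples m CARD('n). W xs * solid_angle (\<lambda>k. flag_vertex c xs (idx k) - u))"
proof -
  define h where "h xs = W xs * solid_angle (\<lambda>k. flag_vertex c xs (idx k) - u)" for xs
  have "DH m w lam c u =
    (\<Sum>I | I \<subseteq> {..<m} \<and> card I = CARD('n). \<Sum>p | p permutes {..<CARD('n)}. h (permute_list p (sorted_list_of_set I)))"
    unfolding DH_def
  proof (intro sum.cong refl)
    fix I p assume "I \<in> {I. I \<subseteq> {..<m} \<and> card I = CARD('n)}" "p \<in> {p. p permutes {..<CARD('n)}}"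
    then have I: "I \<subseteq> {..<m}" "card I = CARD('n)" and p: "p permutes {..<CARD('n)}"
      by auto
    have len: "length (sorted_list_of_set I) = CARD('n)"
      using I by simp
    have "flag_face I p k = set (take (Suc k) (permute_list p (sorted_list_of_set I)))" if "k < CARD('n)" for k
      using that unfolding permute_list_def len
      by (simp add: flag_face_def take_map take_upt atLeast0LessThan lessThan_Suc_atMost del: upt_Suc)
    then have "(\<lambda>k::'n. barycenter_image lam c (flag_face I p (idx k)) - u) =
        (\<lambda>k. flag_vertex c (permute_list p (sorted_list_of_set I)) (idx k) - u)"
      by (simp add: flag_vertex_def idx_less)
    moreover have "w I * of_int (sign p) = W (permute_list p (sorted_list_of_set I))"
      using I len by (simp add: w_def W_permute [OF len p])
    ultimately show "w I * of_int (sign p) *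
        signed_solid_angle (\<lambda>k. barycenter_image lam c (flag_face I p k)) u =
        h (permute_list p (sorted_list_of_set I))"
      by (simp add: h_def signed_solid_angle_eq)
  qed
  also have "\<dots> = (\<Sum>xs | xs \<in> tuples m CARD('n) \<and> distinct xs. h xs)"
    by (rule sum_flags)
  also have "\<dots> = (\<Sum>xs\<in>tuples m CARD('n). h xs)"
    by (intro sum.mono_neutral_left finite_tuples) (auto simp: h_def tuples_def W_not_distinct)
  finally show ?thesis
    by (simp add: h_def)
qed

text \<open>
  The cone over the cycle from the origin has boundary the cycle itself: inner facets cancel
  because exchanging two consecutive entries of a flag changes its orientation, the others
  because of the linear relation.
\<close>

lemma sum_apex_facets:
  fixes k :: 'n
  shows "(\<Sum>xs\<in>tuples m CARD('n). W xs * solid_angle ((\<lambda>j. flag_vertex c xs (idx j) - u)(k := - u))) = 0"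
proof (cases "Suc (idx k) < CARD('n)")
  case True
  let ?a = "idx k"
  define G where "G xs = solid_angle ((\<lambda>j. flag_vertex c xs (idx j) - u)(k := - u))" for xs
  \<comment> \<open>Exchanging the entries \<open>?a\<close> and \<open>Suc ?a\<close> changes only
    the face number \<open>?a\<close> of the flag, and its vertex is the one replaced by the
    apex.\<close>
  define \<tau> where "\<tau> = Transposition.transpose ?a (Suc ?a)"
  have perm: "\<tau> permutes {..<CARD('n)}"
    unfolding \<tau>_def using True by (intro permutes_swap_id) auto
  have "G (permute_list \<tau> xs) = G xs" if "xs \<in> tuples m CARD('n)" for xs
  proof -
    have len: "length xs = CARD('n)"
      using that by (simp add: tuples_def)
    have "set (take (Suc j) (permute_list \<tau> xs)) = set (take (Suc j) xs)" if "j < CARD('n)" "j \<noteq> ?a" for j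
    proof -
      have "set (take (Suc j) (permute_list \<tau> xs)) = (\<lambda>i. xs ! \<tau> i) ` {..j}"
        using that unfolding permute_list_def len
        by (simp add: take_map take_upt atLeast0LessThan lessThan_Suc_atMost del: upt_Suc)
      also have "\<dots> = (!) xs ` (\<tau> ` {..j})"
        by (simp add: image_image)
      \<comment> \<open>Below \<open>?a\<close> the initial segment is fixed pointwise; above
        \<open>?a\<close> it contains both exchanged positions.\<close>
      also have "\<tau> ` {..j} = {..j}"
      proof (cases "j < ?a")
        case True
        then show ?thesis
          by (auto simp: \<tau>_def Transposition.transpose_def)
      next
        case False
        with \<open>j \<noteq> ?a\<close> have "\<tau> permutes {..j}"
          unfolding \<tau>_def by (intro permutes_swap_id) auto
        then show ?thesis
          by (rule permutes_image)
      qed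
      also have "(!) xs ` {..j} = set (take (Suc j) xs)"
        using that len by (simp add: nth_image [symmetric] atLeast0LessThan lessThan_Suc_atMost del: upt_Suc)
      finally show ?thesis .
    qed
    then have "(\<lambda>j. flag_vertex c (permute_list \<tau> xs) (idx j) - u)(k := - u) =
        (\<lambda>j. flag_vertex c xs (idx j) - u)(k := - u)"
      by (auto simp: fun_eq_iff flag_vertex_def idx_less idx_eq_iff)
    then show ?thesis
      by (simp add: G_def)
  qed
  moreover have "W (permute_list \<tau> xs) = - W xs" if "xs \<in> tuples m CARD('n)" for xs
    using that perm by (simp add: W_permute tuples_def) (simp add: \<tau>_def sign_swap_id)
  moreover have "(\<Sum>xs\<in>tuples m CARD('n). W xs * G xs) =
      (\<Sum>xs\<in>tuples m CARD('n). W (permute_list \<tau> xs) * G (permute_list \<tau> xs))"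
  proof (rule sum.reindex_bij_witness [of _ "permute_list \<tau>" "permute_list \<tau>"])
    fix xs assume xs: "xs \<in> tuples m CARD('n)"
    have "permute_list \<tau> (permute_list \<tau> xs) = permute_list (\<tau> \<circ> \<tau>) xs"
      using xs perm by (intro permute_list_compose [symmetric]) (auto simp: tuples_def)
    then show inv: "permute_list \<tau> (permute_list \<tau> xs) = xs"
      by (simp add: \<tau>_def)
    then show "permute_list \<tau> (permute_list \<tau> xs) = xs" .
    show mem: "permute_list \<tau> xs \<in> tuples m CARD('n)"
      using xs perm by (auto simp: tuples_def)
    then show "permute_list \<tau> xs \<in> tuples m CARD('n)" .
    show "W (permute_list \<tau> (permute_list \<tau> xs)) * G (permute_list \<tau> (permute_list \<tau> xs)) = W xs * G xs"
      by (simp add: inv)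
  qed
  ultimately show ?thesis
    by (simp add: sum_negf G_def [symmetric])
next
  \<comment> \<open>Now \<open>k\<close> is the last position, and only the replaced vertex depends
    on the last entry of the tuple, so \<open>W\<close> can be summed over that entry.\<close>
  case False
  then have k: "Suc (idx k) = CARD('n)"
    using idx_less [of k] by simp
  have "(\<Sum>xs\<in>tuples m (Suc (idx k)). W xs * solid_angle ((\<lambda>j. flag_vertex c xs (idx j) - u)(k := - u))) =
    (\<Sum>ys\<in>tuples m (idx k). \<Sum>i<m. W (ys @ [i]) *
      solid_angle ((\<lambda>j. flag_vertex c (ys @ [i]) (idx j) - u)(k := - u)))"
    by (rule sum_tuples_snoc)
  also have "\<dots> = (\<Sum>ys\<in>tuples m (idx k). \<Sum>i<m. W (ys @ [i]) *
      solid_angle ((\<lambda>j. flag_vertex c ys (idx j) - u)(k := - u)))"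
  proof (intro sum.cong refl)
    fix ys i assume "ys \<in> tuples m (idx k)"
    then have "flag_vertex c (ys @ [i]) (idx j) = flag_vertex c ys (idx j)" if "j \<noteq> k" for j :: 'n
    proof -
      have "idx j \<noteq> idx k"
        using that by (simp add: idx_eq_iff)
      then have "idx j < idx k"
        using k idx_less [of j] by linarith
      then have "Suc (idx j) \<le> length ys"
        using \<open>ys \<in> tuples m (idx k)\<close> by (simp add: tuples_def)
      then show ?thesis
        by (simp add: flag_vertex_def)
    qed
    then have "(\<lambda>j. flag_vertex c (ys @ [i]) (idx j) - u)(k := - u) = (\<lambda>j. flag_vertex c ys (idx j) - u)(k := - u)"
      by (simp add: fun_eq_iff)
    then show "W (ys @ [i]) * solid_angle ((\<lambda>j. flag_vertex c (ys @ [i]) (idx j) - u)(k := - u)) =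
      W (ys @ [i]) * solid_angle ((\<lambda>j. flag_vertex c ys (idx j) - u)(k := - u))"
      by simp
  qed
  also have "\<dots> = 0"
    using k by (auto simp: sum_distrib_right [symmetric] tuples_def intro!: sum.neutral sum_W_middle)
  finally show ?thesis
    using k by simp
qed

text \<open>Subtracting the apex facets, which sum to 0, turns each solid angle into the defect in
  the cocycle identity, almost everywhere a signed indicator of a simplex; these are integrated one
  by one.\<close>

lemma multi_polytope_volume_eq:
  "multi_polytope_volume m w lam c =
    (\<Sum>xs\<in>tuples m CARD('n). W xs * row_det (flag_vertex c xs)) / fact CARD('n)"
proof -
  let ?T = "tuples m CARD('n)" and ?y = "\<lambda>xs (k::'n). flag_vertex c xs (idx k)"
  define f where "f u = (\<Sum>xs\<in>?T. W xs * simplex_sign (?y xs) u)" for u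
  define N where "N = (\<Union>xs\<in>?T. {u. solid_angle (\<lambda>k. ?y xs k - u) -
    (\<Sum>k\<in>UNIV. solid_angle ((\<lambda>k. ?y xs k - u)(k := - u))) \<noteq> simplex_sign (?y xs) u})"
  have "negligible N"
    unfolding N_def by (intro negligible_Union) (auto intro: negligible_solid_angle_defect)
  have eq: "DH m w lam c u = f u" if "u \<notin> N" for u
  proof -
    have "DH m w lam c u = (\<Sum>xs\<in>?T. W xs * solid_angle (\<lambda>k. ?y xs k - u)) -
        (\<Sum>k\<in>UNIV. \<Sum>xs\<in>?T. W xs * solid_angle ((\<lambda>k. ?y xs k - u)(k := - u)))"
      by (simp add: DH_eq_sum_tuples sum_apex_facets)
    also have "\<dots> = (\<Sum>xs\<in>?T. W xs * (solid_angle (\<lambda>k. ?y xs k - u) -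
        (\<Sum>k\<in>UNIV. solid_angle ((\<lambda>k. ?y xs k - u)(k := - u)))))"
      by (subst sum.swap) (simp add: right_diff_distrib sum_subtractf sum_distrib_left)
    also have "\<dots> = f u"
      using that by (simp add: f_def N_def)
    finally show ?thesis .
  qed
  have int: "integrable lebesgue (\<lambda>u. W xs * simplex_sign (?y xs) u)" for xs
    by (intro integrable_mult_right integral_simplex_sign)
  then have f_int: "integrable lebesgue f"
    unfolding f_def by (rule Bochner_Integration.integrable_sum)
  \<comment> \<open>\<open>DH\<close> inherits integrability, and with it the measurability required
    for comparing integrals, from the function \<open>f\<close> equal to it off a null set.\<close>
  then have "f absolutely_integrable_on UNIV"
    by (simp add: set_integrable_def)
  then have "DH m w lam c absolutely_integrable_on UNIV"
    using \<open>negligible N\<close> by (rule absolutely_integrable_spike) (use eq in auto)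
  then have "integrable lebesgue (DH m w lam c)"
    by (simp add: set_integrable_def)
  with f_int have "(LINT u|lebesgue. DH m w lam c u) = (LINT u|lebesgue. f u)"
    using \<open>negligible N\<close> eq
    by (intro integral_cong_AE AE_I' [of N]) (auto simp: negligible_iff_null_sets)
  also have "\<dots> = (\<Sum>xs\<in>?T. W xs * (row_det (flag_vertex c xs) / fact CARD('n)))"
    unfolding f_def by (subst Bochner_Integration.integral_sum [OF int])
      (simp add: integral_simplex_sign row_det_def)
  finally show ?thesis
    by (simp add: multi_polytope_volume_def sum_divide_distrib)
qed

end

section \<open>The volume as a polynomial\<close>

text \<open>Only the identity contributes to the determinant: a permutation that raises no index
  preserves the sum of indices, hence each index.\<close>

lemma det_lower_triangular_idx:
  fixes A :: "real^'n^'n"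
  assumes "\<And>i j. idx i < idx j \<Longrightarrow> A $ i $ j = 0"
  shows "det A = (\<Prod>i\<in>UNIV. A $ i $ i)"
proof -
  have "(\<Prod>i\<in>UNIV. A $ i $ p i) = 0" if p: "p permutes UNIV" "p \<noteq> id" for p
  proof -
    have "\<exists>i. idx i < idx (p i)"
    proof (rule ccontr)
      assume "\<not> (\<exists>i. idx i < idx (p i))"
      then have le: "idx (p i) \<le> idx i" for i
        by (meson not_le)
      have "(\<Sum>i\<in>UNIV. idx (p i)) = (\<Sum>i\<in>UNIV. idx (i::'n))"
        using sum.permute [OF p(1), of idx] unfolding o_def by (rule sym)
      then have "\<forall>i. idx (p i) = idx i"
        using sum_mono_inv [of "\<lambda>i. idx (p i)" UNIV idx] le by simp
      then have "p = id"
        by (auto simp: idx_eq_iff)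
      with p show False by blast
    qed
    then obtain i where "A $ i $ p i = 0"
      using assms by blast
    then show ?thesis
      by (intro prod_zero) auto
  qed
  then have "det A = (\<Sum>p\<in>{id}. of_int (sign p) * (\<Prod>i\<in>UNIV. A $ i $ p i))"
    unfolding det_def by (intro sum.mono_neutral_right) (auto simp: permutes_id finite_permutations)
  then show ?thesis
    by simp
qed

lemma row_det_add_row:
  fixes f :: "nat \<Rightarrow> real^'n"
  assumes "a < CARD('n)" "b < CARD('n)" "a \<noteq> b"
  shows "row_det (f(a := f a + f b)) = row_det f"
proof -
  obtain k l :: 'n where kl: "a = idx k" "b = idx l"
    using ex_idx assms by metis
  with assms have "k \<noteq> l"
    by blast
  let ?A = "(\<chi> j. f (idx j)) :: real^'n^'n"
  have "(\<chi> j. if j = k then f (idx k) + f (idx l) else f (idx j)) =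
      (\<chi> j. if j = k then row k ?A + 1 *s row l ?A else row j ?A)"
    by (auto simp: vec_eq_iff row_def)
  then show ?thesis
    unfolding kl row_det_update by (simp only: det_row_operation [OF \<open>k \<noteq> l\<close>] row_det_def)
qed

text \<open>Row operations from the top down: the restored row above equals \<open>b t\<close> and
  is added to the difference in row \<open>t\<close>. In row 0 the difference is already
  \<open>b 1\<close>, as \<open>b 0 = 0\<close>.\<close>

lemma row_det_telescope:
  fixes b :: "nat \<Rightarrow> real^'n"
  assumes "b 0 = 0"
  shows "row_det (\<lambda>j. b (Suc j)) = row_det (\<lambda>j. b (Suc j) - b j)"
proof -
  have "row_det (\<lambda>j. if j < t then b (Suc j) else b (Suc j) - b j) = row_det (\<lambda>j. b (Suc j) - b j)"
    if "t \<le> CARD('n)" for t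
    using that
  proof (induction t)
    case (Suc t)
    let ?f = "\<lambda>j. if j < t then b (Suc j) else b (Suc j) - b j"
    have "row_det (\<lambda>j. if j < Suc t then b (Suc j) else b (Suc j) - b j) = row_det ?f"
    proof (cases t)
      case 0
      have "(\<lambda>j. if j < Suc t then b (Suc j) else b (Suc j) - b j) = ?f"
        using assms by (simp add: 0 fun_eq_iff)
      then show ?thesis
        by simp
    next
      case t: (Suc t')
      have "(if j < Suc t then b (Suc j) else b (Suc j) - b j) = (?f(t := ?f t + ?f t')) j" for j
        by (cases "j = t") (simp_all add: t)
      then have "(\<lambda>j. if j < Suc t then b (Suc j) else b (Suc j) - b j) = ?f(t := ?f t + ?f t')"
        by (rule ext)
      moreover have "row_det (?f(t := ?f t + ?f t')) = row_det ?f"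
        using Suc.prems t by (intro row_det_add_row) auto
      ultimately show ?thesis
        by (simp only:)
    qed
    with Suc show ?case
      by simp
  qed simp
  moreover have "row_det (\<lambda>j. b (Suc j)) =
      row_det (\<lambda>j. if j < CARD('n) then b (Suc j) else b (Suc j) - b j)"
    by (intro row_det_cong) simp
  ultimately show ?thesis
    by simp
qed

lemma row_det_mult_inner:
  fixes f h :: "nat \<Rightarrow> real^'n"
  shows "row_det f * row_det h = det ((\<chi> i j. f (idx i) \<bullet> h (idx j)) :: real^'n^'n)"
proof -
  let ?F = "(\<chi> k. f (idx k)) :: real^'n^'n" and ?H = "(\<chi> k. h (idx k)) :: real^'n^'n"
  have "row_det f * row_det h = det (?F ** transpose ?H)"
    by (simp add: row_det_def det_mul)
  also have "?F ** transpose ?H = (\<chi> i j. f (idx i) \<bullet> h (idx j))"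
    by (simp add: matrix_matrix_mult_def transpose_def inner_vec_def vec_eq_iff)
  finally show ?thesis .
qed

text \<open>The product of determinants is the determinant of the pairings of \<lambda>(xs ! i) with
  \<open>b (Suc j) - b j\<close>. For i < j both \<open>b j\<close> and \<open>b (Suc j)\<close> lie
  on the hyperplane of \<open>xs ! i\<close>, so this matrix is triangular and its diagonal gives
  the factors.\<close>

lemma (in weighted_vectors) row_det_flag_vertex:
  assumes "xs \<in> tuples m CARD('n)"
  shows "row_det (\<lambda>j. lam (xs ! j)) * row_det (flag_vertex c xs) =
    (\<Prod>k<CARD('n). c (xs ! k) - lam (xs ! k) \<bullet> barycenter_image lam c (set (take k xs)))"
proof -
  define b where "b k = barycenter_image lam c (set (take k xs))" for k
  have len: "length xs = CARD('n)" and xs: "set xs \<subseteq> {..<m}"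
    using assms by (auto simp: tuples_def)
  have b: "lam (xs ! i) \<bullet> b k = c (xs ! i)" if "i < k" "k \<le> CARD('n)" for i k
    unfolding b_def
  proof (rule barycenter_image_inner)
    show "set (take k xs) \<subseteq> {..<m}"
      using xs set_take_subset by fast
    show "card (set (take k xs)) \<le> CARD('n)"
      using card_length [of "take k xs"] that len by simp
    show "xs ! i \<in> set (take k xs)"
      using that len by (auto simp: in_set_conv_nth intro!: exI [of _ i])
  qed
  \<comment> \<open>The empty intersection is the whole space, whose point closest to 0 is
    0.\<close>
  have "b 0 = 0"
    by (simp add: b_def barycenter_image_def closest_point_self)
  then have "row_det (flag_vertex c xs) = row_det (\<lambda>j. b (Suc j) - b j)"
    unfolding flag_vertex_def b_def [symmetric] by (rule row_det_telescope)
  then have "row_det (\<lambda>j. lam (xs ! j)) * row_det (flag_vertex c xs) =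
      det ((\<chi> i j. lam (xs ! idx i) \<bullet> (b (Suc (idx j)) - b (idx j))) :: real^'n^'n)"
    by (simp add: row_det_mult_inner)
  also have "\<dots> = (\<Prod>i\<in>UNIV. lam (xs ! idx (i::'n)) \<bullet> (b (Suc (idx i)) - b (idx i)))"
    by (subst det_lower_triangular_idx) (auto simp: inner_diff_right b idx_less less_SucI Suc_leI less_imp_le)
  also have "\<dots> = (\<Prod>k<CARD('n). lam (xs ! k) \<bullet> (b (Suc k) - b k))"
    by (rule prod_idx)
  also have "\<dots> = (\<Prod>k<CARD('n). c (xs ! k) - lam (xs ! k) \<bullet> b k)"
    by (intro prod.cong) (auto simp: inner_diff_right b)
  finally show ?thesis
    by (simp add: b_def)
qed

text \<open>Sum over the last entry first: \<open>B\<close> sees only the earlier entries, so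
  \<open>assms\<close> kills its pairing with the last vector. What remains is the same sum for
  \<open>g'\<close>, one entry shorter, and \<open>g'\<close> satisfies the relation again; this is
  why the induction varies \<open>g\<close>.\<close>

lemma sum_tuples_shifted:
  fixes lam :: "nat \<Rightarrow> real^'n" and B :: "nat set \<Rightarrow> real^'n"
  assumes "\<And>t. (\<Sum>i<m. g (t + Poly_Mapping.single i 1) *\<^sub>R lam i) = 0"
  shows "(\<Sum>xs\<in>tuples m k. g (exps xs) * (\<Prod>j<k. c (xs ! j) - lam (xs ! j) \<bullet> B (set (take j xs)))) =
    (\<Sum>xs\<in>tuples m k. g (exps xs) * (\<Prod>j<k. c (xs ! j)))"
  using assms
proof (induction k arbitrary: g)
  case (Suc k)
  let ?P = "\<lambda>xs. \<Prod>j<k. c (xs ! j) - lam (xs ! j) \<bullet> B (set (take j xs))"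
  define g' where "g' t = (\<Sum>i<m. c i * g (t + Poly_Mapping.single i 1))" for t
  have prod1: "(\<Prod>j<k. c ((xs @ [i]) ! j) - lam ((xs @ [i]) ! j) \<bullet> B (set (take j (xs @ [i])))) = ?P xs"
    and prod2: "(\<Prod>j<k. c ((xs @ [i]) ! j)) = (\<Prod>j<k. c (xs ! j))"
    and last: "(xs @ [i]) ! k = i" "take k (xs @ [i]) = xs" if "xs \<in> tuples m k" for xs i
    using that by (auto simp: tuples_def nth_append)
  have "(\<Sum>xs\<in>tuples m (Suc k). g (exps xs) * (\<Prod>j<Suc k. c (xs ! j) - lam (xs ! j) \<bullet> B (set (take j xs)))) =
      (\<Sum>xs\<in>tuples m k. \<Sum>i<m. g (exps xs + Poly_Mapping.single i 1) * (?P xs * (c i - lam i \<bullet> B (set xs))))"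
    unfolding sum_tuples_snoc prod.lessThan_Suc
    by (intro sum.cong refl) (simp only: prod1 last, simp)
  also have "\<dots> = (\<Sum>xs\<in>tuples m k. g' (exps xs) * ?P xs)"
  proof (intro sum.cong refl)
    fix xs
    have "(\<Sum>i<m. g (exps xs + Poly_Mapping.single i 1) * (lam i \<bullet> B (set xs))) =
        (\<Sum>i<m. g (exps xs + Poly_Mapping.single i 1) *\<^sub>R lam i) \<bullet> B (set xs)"
      by (simp add: inner_sum_left)
    also have "\<dots> = 0"
      unfolding Suc.prems by simp
    finally have 0: "(\<Sum>i<m. g (exps xs + Poly_Mapping.single i 1) * (lam i \<bullet> B (set xs))) = 0" .
    have "(\<Sum>i<m. g (exps xs + Poly_Mapping.single i 1) * (?P xs * (c i - lam i \<bullet> B (set xs)))) =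
        ?P xs * (g' (exps xs) - (\<Sum>i<m. g (exps xs + Poly_Mapping.single i 1) * (lam i \<bullet> B (set xs))))"
      unfolding g'_def sum_subtractf [symmetric] sum_distrib_left
      by (intro sum.cong refl) (simp add: algebra_simps)
    then show "(\<Sum>i<m. g (exps xs + Poly_Mapping.single i 1) * (?P xs * (c i - lam i \<bullet> B (set xs)))) =
        g' (exps xs) * ?P xs"
      unfolding 0 by simp
  qed
  also have "\<dots> = (\<Sum>xs\<in>tuples m k. g' (exps xs) * (\<Prod>j<k. c (xs ! j)))"
  proof (rule Suc.IH)
    fix t
    have "(\<Sum>i<m. g' (t + Poly_Mapping.single i 1) *\<^sub>R lam i) =
        (\<Sum>j<m. c j *\<^sub>R (\<Sum>i<m. g (t + Poly_Mapping.single j 1 + Poly_Mapping.single i 1) *\<^sub>R lam i))"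
      unfolding g'_def scaleR_sum_left scaleR_sum_right
      by (subst sum.swap) (simp add: ac_simps)
    then show "(\<Sum>i<m. g' (t + Poly_Mapping.single i 1) *\<^sub>R lam i) = 0"
      unfolding Suc.prems by simp
  qed
  also have "\<dots> = (\<Sum>xs\<in>tuples m (Suc k). g (exps xs) * (\<Prod>j<Suc k. c (xs ! j)))"
    unfolding sum_tuples_snoc prod.lessThan_Suc g'_def sum_distrib_right
    by (intro sum.cong refl) (simp only: prod2 last, simp add: ac_simps)
  finally show ?case .
qed (simp add: tuples_0)

theorem (in weighted_vectors) multi_polytope_volume_tuples:
  "multi_polytope_volume m w lam c =
    (\<Sum>xs\<in>tuples m CARD('n). g (exps xs) * (\<Prod>j<CARD('n). c (xs ! j))) / fact CARD('n)"
proof -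
  have "multi_polytope_volume m w lam c =
      (\<Sum>xs\<in>tuples m CARD('n). g (exps xs) *
        (\<Prod>j<CARD('n). c (xs ! j) - lam (xs ! j) \<bullet> barycenter_image lam c (set (take j xs)))) / fact CARD('n)"
    unfolding multi_polytope_volume_eq W_def mult.assoc
    by (simp add: row_det_flag_vertex cong: sum.cong)
  then show ?thesis
    unfolding sum_tuples_shifted [OF relation] .
qed

section \<open>Degrees, factorials and powers of exponent vectors\<close>

definition mdeg :: "(nat \<Rightarrow>\<^sub>0 nat) \<Rightarrow> nat" where
  "mdeg t = (\<Sum>i\<in>Poly_Mapping.keys t. Poly_Mapping.lookup t i)"

definition mfact :: "(nat \<Rightarrow>\<^sub>0 nat) \<Rightarrow> real" where
  "mfact t = (\<Prod>i\<in>Poly_Mapping.keys t. fact (Poly_Mapping.lookup t i))"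

definition mpower :: "(nat \<Rightarrow> real) \<Rightarrow> (nat \<Rightarrow>\<^sub>0 nat) \<Rightarrow> real" where
  "mpower c t = (\<Prod>i\<in>Poly_Mapping.keys t. c i ^ Poly_Mapping.lookup t i)"

definition exponents :: "nat \<Rightarrow> nat \<Rightarrow> (nat \<Rightarrow>\<^sub>0 nat) set" where
  "exponents m k = {t. Poly_Mapping.keys t \<subseteq> {..<m} \<and> mdeg t = k}"

lemma keys_add_nat: "Poly_Mapping.keys (s + t :: nat \<Rightarrow>\<^sub>0 nat) = Poly_Mapping.keys s \<union> Poly_Mapping.keys t"
  by (auto simp: in_keys_iff lookup_add)

lemma mdeg_superset:
  "finite S \<Longrightarrow> Poly_Mapping.keys t \<subseteq> S \<Longrightarrow> mdeg t = (\<Sum>i\<in>S. Poly_Mapping.lookup t i)"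
  unfolding mdeg_def by (intro sum.mono_neutral_left) (auto simp: in_keys_iff)

lemma mfact_superset:
  "finite S \<Longrightarrow> Poly_Mapping.keys t \<subseteq> S \<Longrightarrow> mfact t = (\<Prod>i\<in>S. fact (Poly_Mapping.lookup t i))"
  unfolding mfact_def by (intro prod.mono_neutral_left) (auto simp: in_keys_iff)

lemma mpower_superset:
  "finite S \<Longrightarrow> Poly_Mapping.keys t \<subseteq> S \<Longrightarrow> mpower c t = (\<Prod>i\<in>S. c i ^ Poly_Mapping.lookup t i)"
  unfolding mpower_def by (intro prod.mono_neutral_left) (auto simp: in_keys_iff)

lemma mdeg_0 [simp]: "mdeg 0 = 0"
  by (simp add: mdeg_def)

lemma mdeg_single [simp]: "mdeg (Poly_Mapping.single i k) = k"
  by (cases "k = 0") (simp_all add: mdeg_def)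

lemma mdeg_add: "mdeg (s + t) = mdeg s + mdeg t"
  by (simp add: mdeg_superset [of "Poly_Mapping.keys s \<union> Poly_Mapping.keys t"] keys_add_nat lookup_add sum.distrib)

lemma mfact_pos: "mfact t > 0"
  unfolding mfact_def by (intro prod_pos) simp

lemma mfact_add_single:
  "mfact (t + Poly_Mapping.single i 1) = real (Poly_Mapping.lookup t i + 1) * mfact t"
proof -
  let ?S = "insert i (Poly_Mapping.keys t)"
  have "mfact (t + Poly_Mapping.single i 1) =
      (\<Prod>j\<in>?S. fact (Poly_Mapping.lookup (t + Poly_Mapping.single i 1) j))"
    by (intro mfact_superset) (auto simp: keys_add_nat)
  also have "\<dots> = (\<Prod>j\<in>?S. (if j = i then real (Poly_Mapping.lookup t i + 1) else 1) * fact (Poly_Mapping.lookup t j))"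
    by (intro prod.cong) (auto simp: lookup_add lookup_single)
  also have "\<dots> = real (Poly_Mapping.lookup t i + 1) * (\<Prod>j\<in>?S. fact (Poly_Mapping.lookup t j))"
    by (subst prod.distrib) simp
  also have "(\<Prod>j\<in>?S. fact (Poly_Mapping.lookup t j)) = mfact t"
    by (rule mfact_superset [symmetric]) auto
  finally show ?thesis .
qed

lemma mpower_add_single: "mpower c (t + Poly_Mapping.single i 1) = c i * mpower c t"
proof -
  let ?S = "insert i (Poly_Mapping.keys t)"
  have "mpower c (t + Poly_Mapping.single i 1) =
      (\<Prod>j\<in>?S. c j ^ Poly_Mapping.lookup (t + Poly_Mapping.single i 1) j)"
    by (intro mpower_superset) (auto simp: keys_add_nat)
  also have "\<dots> = (\<Prod>j\<in>?S. (if j = i then c i else 1) * c j ^ Poly_Mapping.lookup t j)"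
    by (intro prod.cong) (auto simp: lookup_add lookup_single)
  also have "\<dots> = c i * (\<Prod>j\<in>?S. c j ^ Poly_Mapping.lookup t j)"
    by (subst prod.distrib) simp
  also have "(\<Prod>j\<in>?S. c j ^ Poly_Mapping.lookup t j) = mpower c t"
    by (rule mpower_superset [symmetric]) auto
  finally show ?thesis .
qed

lemma diff_single_add:
  "i \<in> Poly_Mapping.keys t \<Longrightarrow> t - Poly_Mapping.single i 1 + Poly_Mapping.single i (1::nat) = t"
  by (rule poly_mapping_eqI) (auto simp: lookup_add lookup_minus lookup_single in_keys_iff when_def)

lemma exponents_0: "exponents m 0 = {0}"
  by (auto simp: exponents_def mdeg_def in_keys_iff poly_mapping_eqI)

lemma exponents_add_single:
  "i < m \<Longrightarrow> t + Poly_Mapping.single i 1 \<in> exponents m (Suc k) \<longleftrightarrow> t \<in> exponents m k"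
  by (auto simp: exponents_def mdeg_add keys_add_nat)

lemma exponents_diff_single:
  "i \<in> Poly_Mapping.keys t \<Longrightarrow> t \<in> exponents m (Suc k) \<Longrightarrow>
    i < m \<and> t - Poly_Mapping.single i 1 \<in> exponents m k"
  using exponents_add_single [of i m "t - Poly_Mapping.single i 1" k] diff_single_add [of i t]
  by (auto simp: exponents_def)

lemma finite_exponents [simp]: "finite (exponents m k)"
proof (induction k)
  case (Suc k)
  have "exponents m (Suc k) \<subseteq> (\<Union>i<m. (\<lambda>t. t + Poly_Mapping.single i 1) ` exponents m k)"
  proof
    fix t assume t: "t \<in> exponents m (Suc k)"
    then have "Poly_Mapping.keys t \<noteq> {}"
      by (auto simp: exponents_def)
    then obtain i where i: "i \<in> Poly_Mapping.keys t"
      by blast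
    show "t \<in> (\<Union>i<m. (\<lambda>t. t + Poly_Mapping.single i 1) ` exponents m k)"
      using exponents_diff_single [OF i t] diff_single_add [OF i]
      by (intro UN_I [of i] image_eqI [of _ _ "t - Poly_Mapping.single i 1"]) auto
  qed
  then show ?case
    by (rule finite_subset) (simp add: Suc)
qed (simp add: exponents_0)

text \<open>The multinomial theorem: an exponent vector of degree \<open>k\<close> is spelled by
  \<open>fact k / mfact t\<close> tuples. Splitting off the last entry avoids counting them
  directly.\<close>

lemma sum_tuples_exponents:
  "(\<Sum>xs\<in>tuples m k. g (exps xs) * (\<Prod>j<k. c (xs ! j))) =
    fact k * (\<Sum>t\<in>exponents m k. g t / mfact t * mpower c t)"
proof (induction k arbitrary: g)
  case 0
  show ?case
    by (simp add: tuples_0 exponents_0 mfact_def mpower_def)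
next
  case (Suc k)
  let ?e = "\<lambda>i. Poly_Mapping.single i (1::nat)"
  \<comment> \<open>\<open>H i t\<close> is the term of \<open>t\<close> weighted by the exponent of
    \<open>i\<close>. After reindexing pairs by \<open>t + ?e i\<close>, these weights add up to the
    degree \<open>Suc k\<close>, as in Euler's identity.\<close>
  define H where "H i t = real (Poly_Mapping.lookup t i) * (g t / mfact t * mpower c t)" for i t
  have H: "c i * (g (t + ?e i) / mfact t * mpower c t) = H i (t + ?e i)" for i t
  proof -
    have lookup: "Poly_Mapping.lookup (t + ?e i) i = Poly_Mapping.lookup t i + 1"
      by (simp add: lookup_add)
    have "x * (a / (x * y) * (z * b)) = z * (a / y * b)" if "x \<noteq> 0" for x y z a b :: real
      using that by simp
    then show ?thesis
      unfolding H_def mfact_add_single mpower_add_single lookup by (simp del: of_nat_add)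
  qed
  have "(\<Sum>xs\<in>tuples m (Suc k). g (exps xs) * (\<Prod>j<Suc k. c (xs ! j))) =
      (\<Sum>xs\<in>tuples m k. \<Sum>i<m. c i * (g (exps xs + ?e i) * (\<Prod>j<k. c (xs ! j))))"
    unfolding sum_tuples_snoc prod.lessThan_Suc
    by (intro sum.cong refl) (auto simp: tuples_def nth_append intro!: prod.cong)
  also have "\<dots> = (\<Sum>i<m. c i * (\<Sum>xs\<in>tuples m k. g (exps xs + ?e i) * (\<Prod>j<k. c (xs ! j))))"
    by (subst sum.swap) (simp only: sum_distrib_left)
  also have "\<dots> = fact k * (\<Sum>i<m. \<Sum>t\<in>exponents m k. H i (t + ?e i))"
    unfolding Suc.IH [of "\<lambda>t. g (t + _)"] H [symmetric] sum_distrib_left by (simp only: ac_simps)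
  also have "(\<Sum>i<m. \<Sum>t\<in>exponents m k. H i (t + ?e i)) =
      (\<Sum>t\<in>exponents m (Suc k). \<Sum>i\<in>Poly_Mapping.keys t. H i t)"
  proof -
    have "(\<Sum>(i, t)\<in>{..<m} \<times> exponents m k. H i (t + ?e i)) =
        (\<Sum>(t, i)\<in>(SIGMA t : exponents m (Suc k). Poly_Mapping.keys t). H i t)"
      by (rule sum.reindex_bij_witness [of _ "\<lambda>(t, i). (i, t - ?e i)" "\<lambda>(i, t). (t + ?e i, i)"])
        (auto simp: exponents_add_single keys_add_nat diff_single_add
          dest: exponents_diff_single simp del: One_nat_def)
    then show ?thesis
      by (simp add: sum.cartesian_product sum.Sigma)
  qed
  also have "\<dots> = (\<Sum>t\<in>exponents m (Suc k). real (Suc k) * (g t / mfact t * mpower c t))"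
  proof (intro sum.cong refl)
    fix t assume "t \<in> exponents m (Suc k)"
    then have "(\<Sum>i\<in>Poly_Mapping.keys t. real (Poly_Mapping.lookup t i)) = real (Suc k)"
      by (auto simp: exponents_def mdeg_def simp flip: of_nat_sum)
    then show "(\<Sum>i\<in>Poly_Mapping.keys t. H i t) = real (Suc k) * (g t / mfact t * mpower c t)"
      unfolding H_def sum_distrib_right [symmetric] by simp
  qed
  finally show ?case
    by (simp add: sum_distrib_left mult.assoc mult.left_commute)
qed

text \<open>With \<open>g t\<close> the integral of the monomial with exponents \<open>t\<close>
  this is the integral of (\<Sum> c_i x_i)^n / n!. The divisors \<open>mfact t\<close> make
  differentiation a shift of the argument of \<open>g\<close>.\<close>

definition macaulay_dual :: "nat \<Rightarrow> nat \<Rightarrow> ((nat \<Rightarrow>\<^sub>0 nat) \<Rightarrow> real) \<Rightarrow> mpoly" where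
  "macaulay_dual m n g = (\<Sum>t\<in>exponents m n. Poly_Mapping.single t (g t / mfact t))"

lemma lookup_macaulay_dual:
  "Poly_Mapping.lookup (macaulay_dual m n g) t = (if t \<in> exponents m n then g t / mfact t else 0)"
  by (simp add: macaulay_dual_def lookup_sum lookup_single when_def)

lemma keys_macaulay_dual: "Poly_Mapping.keys (macaulay_dual m n g) \<subseteq> exponents m n"
  by (auto simp: in_keys_iff lookup_macaulay_dual split: if_splits)

lemma eval_macaulay_dual:
  "eval_mpoly (macaulay_dual m n g) c = (\<Sum>t\<in>exponents m n. g t / mfact t * mpower c t)"
proof -
  have "eval_mpoly (macaulay_dual m n g) c =
      (\<Sum>t\<in>exponents m n. Poly_Mapping.lookup (macaulay_dual m n g) t * mpower c t)"
    unfolding eval_mpoly_def mpower_def [symmetric]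
    by (intro sum.mono_neutral_left keys_macaulay_dual) (auto simp: in_keys_iff)
  then show ?thesis
    by (simp add: lookup_macaulay_dual)
qed

section \<open>Polynomials and differential operators\<close>

text \<open>The remainder modulo \<open>B\<close> recovers the lowest digit, and the quotient has
  the other digits.\<close>

lemma base_expansion_unique:
  fixes f f' :: "nat \<Rightarrow> nat"
  assumes "(\<Sum>i<m. f i * B ^ i) = (\<Sum>i<m. f' i * B ^ i)"
    and "\<And>i. i < m \<Longrightarrow> f i < B" "\<And>i. i < m \<Longrightarrow> f' i < B" "i < m"
  shows "f i = f' i"
  using assms
proof (induction m arbitrary: f f' i)
  case (Suc m)
  have split: "(\<Sum>i<Suc m. h i * B ^ i) = h 0 + B * (\<Sum>i<m. h (Suc i) * B ^ i)" for h :: "nat \<Rightarrow> nat"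
    unfolding sum.lessThan_Suc_shift by (simp add: sum_distrib_left mult.left_commute)
  have eq: "f 0 + B * (\<Sum>i<m. f (Suc i) * B ^ i) = f' 0 + B * (\<Sum>i<m. f' (Suc i) * B ^ i)"
    using Suc.prems(1) unfolding split .
  have less: "f 0 < B" "f' 0 < B"
    using Suc.prems by auto
  have 0: "f 0 = f' 0"
    using arg_cong [OF eq, of "\<lambda>x. x mod B"] less by simp
  have "(\<Sum>i<m. f (Suc i) * B ^ i) = (\<Sum>i<m. f' (Suc i) * B ^ i)"
    using arg_cong [OF eq, of "\<lambda>x. x div B"] less by simp
  then have *: "f (Suc j) = f' (Suc j)" if "j < m" for j
    by (rule Suc.IH [of "\<lambda>i. f (Suc i)" "\<lambda>i. f' (Suc i)"]) (simp_all add: that Suc.prems(2,3))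
  show ?case
    using 0 * Suc.prems(4) by (cases i) simp_all
qed simp

lemma eval_mpoly_superset:
  assumes "finite T" "Poly_Mapping.keys p \<subseteq> T"
  shows "eval_mpoly p c = (\<Sum>t\<in>T. Poly_Mapping.lookup p t * mpower c t)"
  unfolding eval_mpoly_def mpower_def [symmetric]
  using assms by (intro sum.mono_neutral_left) (auto simp: in_keys_iff)

text \<open>
  The Kronecker substitution \<open>c\<^sub>i = x ^ B ^ i\<close> with large \<open>B\<close> reduces to one variable.
\<close>

lemma eval_mpoly_inject:
  assumes "p \<in> mpolys m" "q \<in> mpolys m" "\<And>c. eval_mpoly p c = eval_mpoly q c"
  shows "p = q"
proof -
  let ?T = "Poly_Mapping.keys p \<union> Poly_Mapping.keys q"
  \<comment> \<open>\<open>B\<close> exceeds all exponents that occur, so they are base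
    \<open>B\<close> digits and \<open>K\<close> is injective on \<open>?T\<close>. The inserted 0
    keeps \<open>Max\<close> meaningful if there are no exponents.\<close>
  define B where "B = Suc (Max (insert 0 ((\<lambda>(t, i). Poly_Mapping.lookup t i) ` (?T \<times> {..<m}))))"
  define K where "K t = (\<Sum>i<m. Poly_Mapping.lookup t i * B ^ i)" for t :: "nat \<Rightarrow>\<^sub>0 nat"
  define a where "a t = Poly_Mapping.lookup p t - Poly_Mapping.lookup q t" for t
  have keys: "Poly_Mapping.keys t \<subseteq> {..<m}" if "t \<in> ?T" for t
    using assms(1,2) that by (auto simp: mpolys_def)
  have less: "Poly_Mapping.lookup t i < B" if "t \<in> ?T" "i < m" for t i
    unfolding B_def less_Suc_eq_le using that
    by (intro Max_ge insertI2 image_eqI [of _ _ "(t, i)"]) simp_all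
  have inj: "s = t" if "s \<in> ?T" "t \<in> ?T" "K s = K t" for s t
  proof (rule poly_mapping_eqI)
    fix i
    show "Poly_Mapping.lookup s i = Poly_Mapping.lookup t i"
    proof (cases "i < m")
      case True
      then show ?thesis
        using less [OF that(1)] less [OF that(2)] that(3) [unfolded K_def]
        by (intro base_expansion_unique [of "Poly_Mapping.lookup s" B m "Poly_Mapping.lookup t"])
    next
      case False
      then have "i \<notin> Poly_Mapping.keys s" "i \<notin> Poly_Mapping.keys t"
        using keys that by auto
      then show ?thesis
        by (simp add: in_keys_iff)
    qed
  qed
  define r where "r = (\<Sum>t\<in>?T. Polynomial.monom (a t) (K t))"
  have "poly r x = 0" for x
  proof -
    let ?c = "\<lambda>i. x ^ B ^ i"
    have "mpower ?c t = x ^ K t" if "t \<in> ?T" for t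
    proof -
      have "mpower ?c t = (\<Prod>i<m. ?c i ^ Poly_Mapping.lookup t i)"
        using keys [OF that] by (intro mpower_superset) auto
      then show ?thesis
        by (simp add: K_def power_sum mult.commute flip: power_mult)
    qed
    then have "poly r x = (\<Sum>t\<in>?T. a t * mpower ?c t)"
      unfolding r_def Polynomial.poly_sum Polynomial.poly_monom by (intro sum.cong) auto
    also have "\<dots> = eval_mpoly p ?c - eval_mpoly q ?c"
      by (simp add: eval_mpoly_superset [of ?T] a_def left_diff_distrib sum_subtractf)
    finally show ?thesis
      using assms(3) by simp
  qed
  then have "r = 0"
    using poly_all_0_iff_0 by blast
  have "a t = 0" if "t \<in> ?T" for t
  proof -
    have "Polynomial.coeff r (K t) = (\<Sum>s\<in>?T. if s = t then a t else 0)"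
      unfolding r_def Polynomial.coeff_sum Polynomial.coeff_monom using that inj by (intro sum.cong) auto
    then show ?thesis
      using that \<open>r = 0\<close> by simp
  qed
  moreover have "a t = 0" if "t \<notin> ?T" for t
    using that by (auto simp: a_def in_keys_iff)
  ultimately have "a t = 0" for t
    by blast
  then show ?thesis
    by (intro poly_mapping_eqI) (simp add: a_def)
qed

text \<open>The value at 0 of the partial derivative with multi-index \<open>t\<close>. In these
  coordinates a differential operator acts by shifting indices.\<close>

definition taylor_coeff :: "mpoly \<Rightarrow> (nat \<Rightarrow>\<^sub>0 nat) \<Rightarrow> real" where
  "taylor_coeff p t = mfact t * Poly_Mapping.lookup p t"

lemma taylor_coeff_eq_0_iff: "(\<forall>t. taylor_coeff p t = 0) \<longleftrightarrow> p = 0"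
  using mfact_pos by (auto simp: taylor_coeff_def poly_mapping_eq_iff fun_eq_iff less_le)

lemma lookup_partial_diff:
  "Poly_Mapping.lookup (partial_diff i p) s =
    real (Poly_Mapping.lookup s i + 1) * Poly_Mapping.lookup p (s + Poly_Mapping.single i 1)"
proof -
  let ?s = "s + Poly_Mapping.single i 1"
  have "Poly_Mapping.lookup (partial_diff i p) s =
      (\<Sum>t\<in>Poly_Mapping.keys p. if t - Poly_Mapping.single i 1 = s
        then real (Poly_Mapping.lookup t i) * Poly_Mapping.lookup p t else 0)"
    by (simp add: partial_diff_def lookup_sum lookup_single when_def)
  also have "\<dots> = (\<Sum>t\<in>Poly_Mapping.keys p. if t = ?s
        then real (Poly_Mapping.lookup s i + 1) * Poly_Mapping.lookup p ?s else 0)"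
  proof (intro sum.cong refl)
    fix t
    \<comment> \<open>Subtraction is truncated: if \<open>i\<close> has exponent 0 in
      \<open>t\<close>, the difference is \<open>t\<close> itself, but then the factor
      \<open>lookup t i\<close> is 0.\<close>
    have "t - Poly_Mapping.single i 1 = s \<longleftrightarrow> t = ?s" if "Poly_Mapping.lookup t i \<noteq> 0"
      using diff_single_add [of i t] that by (auto simp: in_keys_iff simp del: One_nat_def)
    moreover have "t \<noteq> ?s" if "Poly_Mapping.lookup t i = 0"
      using that by (auto simp: lookup_add)
    ultimately show "(if t - Poly_Mapping.single i 1 = s then real (Poly_Mapping.lookup t i) * Poly_Mapping.lookup p t else 0) =
        (if t = ?s then real (Poly_Mapping.lookup s i + 1) * Poly_Mapping.lookup p ?s else 0)"
      by (cases "Poly_Mapping.lookup t i = 0") (auto simp: lookup_add simp del: One_nat_def)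
  qed
  also have "\<dots> = real (Poly_Mapping.lookup s i + 1) * Poly_Mapping.lookup p ?s"
    by (simp add: in_keys_iff del: One_nat_def)
  finally show ?thesis .
qed

lemma taylor_coeff_partial_diff:
  "taylor_coeff (partial_diff i p) s = taylor_coeff p (s + Poly_Mapping.single i 1)"
  unfolding taylor_coeff_def lookup_partial_diff mfact_add_single by simp

lemma taylor_coeff_partial_diff_power:
  "taylor_coeff ((partial_diff i ^^ k) p) s = taylor_coeff p (s + Poly_Mapping.single i k)"
proof (induction k arbitrary: s)
  case (Suc k)
  have "s + Poly_Mapping.single i 1 + Poly_Mapping.single i k = s + Poly_Mapping.single i (Suc k)"
    by (simp add: add.assoc flip: single_add)
  with Suc show ?case
    by (simp only: funpow.simps o_apply taylor_coeff_partial_diff)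
qed simp

lemma taylor_coeff_monomial_diff: "taylor_coeff (monomial_diff t p) s = taylor_coeff p (s + t)"
proof -
  have "taylor_coeff (foldr (\<lambda>i. partial_diff i ^^ Poly_Mapping.lookup t i) xs p) s =
      taylor_coeff p (s + (\<Sum>i\<leftarrow>xs. Poly_Mapping.single i (Poly_Mapping.lookup t i)))" for xs
    by (induction xs arbitrary: s) (simp_all add: taylor_coeff_partial_diff_power add.assoc)
  moreover have "(\<Sum>i\<leftarrow>sorted_list_of_set (Poly_Mapping.keys t). Poly_Mapping.single i (Poly_Mapping.lookup t i)) = t"
  proof -
    have "(\<Sum>i\<leftarrow>sorted_list_of_set (Poly_Mapping.keys t). Poly_Mapping.single i (Poly_Mapping.lookup t i)) =
        (\<Sum>i\<in>Poly_Mapping.keys t. Poly_Mapping.single i (Poly_Mapping.lookup t i))"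
      by (simp add: sum_list_distinct_conv_sum_set)
    also have "\<dots> = t"
      by (rule poly_mapping_eqI) (simp add: lookup_sum lookup_single when_def in_keys_iff)
    finally show ?thesis .
  qed
  ultimately show ?thesis
    by (simp add: monomial_diff_def)
qed

lemma lookup_scale: "Poly_Mapping.lookup (Poly_Mapping.single 0 a * p) t = a * Poly_Mapping.lookup p t"
  for p :: mpoly
  unfolding mult_map_scale_conv_mult [symmetric] by (simp add: Poly_Mapping.map.rep_eq when_def)

lemma taylor_coeff_apply_diff:
  "taylor_coeff (apply_diff D p) s =
    (\<Sum>t\<in>Poly_Mapping.keys D. Poly_Mapping.lookup D t * taylor_coeff p (s + t))"
  unfolding taylor_coeff_monomial_diff [symmetric]
  by (simp add: taylor_coeff_def apply_diff_def lookup_sum lookup_scale sum_distrib_left mult.left_commute)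

text \<open>The Taylor coefficients of the dual polynomial are \<open>g\<close> itself, the
  assumption covering exponents of other degree or with foreign variables; an operator annihilates
  it iff all Taylor coefficients of the result vanish.\<close>

lemma Ann_macaulay_dual:
  assumes "\<And>t. t \<notin> exponents m n \<Longrightarrow> g t = 0"
  shows "Ann m (macaulay_dual m n g) =
    {D \<in> mpolys m. \<forall>s. (\<Sum>t\<in>Poly_Mapping.keys D. Poly_Mapping.lookup D t * g (s + t)) = 0}"
proof -
  have "taylor_coeff (macaulay_dual m n g) t = g t" for t
    using mfact_pos [of t] assms by (simp add: taylor_coeff_def lookup_macaulay_dual)
  then show ?thesis
    by (auto simp: Ann_def diff_ring_def taylor_coeff_apply_diff simp flip: taylor_coeff_eq_0_iff)
qed

section \<open>Poincare duality algebras\<close>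

lemma real_field_simps [simp]:
  "carrier real_field = UNIV" "a \<otimes>\<^bsub>real_field\<^esub> b = a * b" "a \<oplus>\<^bsub>real_field\<^esub> b = a + b"
  "\<one>\<^bsub>real_field\<^esub> = 1" "\<zero>\<^bsub>real_field\<^esub> = 0"
  by (simp_all add: ring_of_type_algebra_def)

context poincare_duality_algebra
begin

lemma real_smult:
  assumes "x \<in> carrier A"
  shows "r \<odot> x \<in> carrier A" "(r + s) \<odot> x = r \<odot> x \<oplus> s \<odot> x" "(r * s) \<odot> x = r \<odot> (s \<odot> x)"
    "1 \<odot> x = x" "0 \<odot> x = \<zero>"
  using assms smult_closed [of r x] smult_l_distr [of r s x] smult_assoc1 [of r s x] smult_one [of x]
    smult_l_null [of x] by simp_all

lemma real_smult_mult:
  assumes "x \<in> carrier A" "y \<in> carrier A"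
  shows "(r \<odot> x) \<otimes> y = r \<odot> (x \<otimes> y)" "x \<otimes> (r \<odot> y) = r \<odot> (x \<otimes> y)"
proof -
  have *: "(r \<odot> x) \<otimes> y = r \<odot> (x \<otimes> y)" if "x \<in> carrier A" "y \<in> carrier A" for x y
    using smult_assoc2 [of r x y] that by simp
  then show "(r \<odot> x) \<otimes> y = r \<odot> (x \<otimes> y)"
    using assms .
  show "x \<otimes> (r \<odot> y) = r \<odot> (x \<otimes> y)"
    using * [of y x] assms by (simp add: m_comm real_smult)
qed

lemma gr_closed:
  "x \<in> gr d \<Longrightarrow> x \<in> carrier A" "x \<in> gr d \<Longrightarrow> y \<in> gr d \<Longrightarrow> x \<oplus> y \<in> gr d"
  "x \<in> gr d \<Longrightarrow> r \<odot> x \<in> gr d" "\<zero> \<in> gr d"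
proof -
  note E = submoduleE [OF gr_submodule [of d]]
  show "x \<in> gr d \<Longrightarrow> x \<in> carrier A" "x \<in> gr d \<Longrightarrow> y \<in> gr d \<Longrightarrow> x \<oplus> y \<in> gr d"
    "x \<in> gr d \<Longrightarrow> r \<odot> x \<in> gr d"
    using E(1) E(4) [of r x] E(5) [of x y] by auto
  obtain z where "z \<in> gr d"
    using E(2) by blast
  then show "\<zero> \<in> gr d"
    using E(1) E(4) [of 0 z] real_smult(5) [of z] by auto
qed

section \<open>Homogeneous components and the extended integral\<close>

definition proj :: "nat \<Rightarrow> 'a \<Rightarrow> 'a" where
  "proj j x = (THE f. f \<in> (\<Pi>\<^sub>E j\<in>{..n}. gr (2 * j)) \<and> x = (\<Oplus>j\<in>{..n}. f j)) j"

lemma proj_props: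
  assumes "x \<in> carrier A"
  shows "j \<le> n \<Longrightarrow> proj j x \<in> gr (2 * j)" and "x = (\<Oplus>j\<in>{..n}. proj j x)"
proof -
  have "(THE f. f \<in> (\<Pi>\<^sub>E j\<in>{..n}. gr (2 * j)) \<and> x = (\<Oplus>j\<in>{..n}. f j)) \<in> (\<Pi>\<^sub>E j\<in>{..n}. gr (2 * j)) \<and>
      x = (\<Oplus>j\<in>{..n}. (THE f. f \<in> (\<Pi>\<^sub>E j\<in>{..n}. gr (2 * j)) \<and> x = (\<Oplus>j\<in>{..n}. f j)) j)"
    using gr_direct_sum [OF assms] by (rule theI')
  then show "j \<le> n \<Longrightarrow> proj j x \<in> gr (2 * j)" "x = (\<Oplus>j\<in>{..n}. proj j x)"
    by (auto simp: proj_def PiE_iff)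
qed

lemma proj_closed: "x \<in> carrier A \<Longrightarrow> j \<le> n \<Longrightarrow> proj j x \<in> carrier A"
  using proj_props(1) gr_closed(1) by blast

lemma proj_unique:
  assumes f: "\<And>j. j \<le> n \<Longrightarrow> f j \<in> gr (2 * j)" and x: "x = (\<Oplus>j\<in>{..n}. f j)" and "j \<le> n"
  shows "proj j x = f j"
proof -
  have f': "f j \<in> carrier A" if "j \<le> n" for j
    using f [OF that] by (rule gr_closed(1))
  then have "x \<in> carrier A"
    unfolding x by (intro finsum_closed) auto
  let ?P = "\<lambda>h. h \<in> (\<Pi>\<^sub>E j\<in>{..n}. gr (2 * j)) \<and> x = (\<Oplus>j\<in>{..n}. h j)"
  \<comment> \<open>The uniqueness in \<open>gr_direct_sum\<close> concerns extensional families,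
    hence the restrictions.\<close>
  have "?P (restrict f {..n})"
    using f f' unfolding x by (auto intro!: M.finsum_cong')
  moreover have "?P (restrict (\<lambda>j. proj j x) {..n})"
    using proj_props [OF \<open>x \<in> carrier A\<close>] proj_closed [OF \<open>x \<in> carrier A\<close>]
    by (auto intro!: trans [OF proj_props(2) [OF \<open>x \<in> carrier A\<close>]] M.finsum_cong')
  ultimately have "restrict (\<lambda>j. proj j x) {..n} = restrict f {..n}"
    using gr_direct_sum [OF \<open>x \<in> carrier A\<close>] by blast
  then show ?thesis
    using \<open>j \<le> n\<close> by (metis atMost_iff restrict_apply')
qed

lemma proj_add:
  assumes "x \<in> carrier A" "y \<in> carrier A" "j \<le> n"
  shows "proj j (x \<oplus> y) = proj j x \<oplus> proj j y"
proof (rule proj_unique [of "\<lambda>j. proj j x \<oplus> proj j y"])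
  show "x \<oplus> y = (\<Oplus>j\<in>{..n}. proj j x \<oplus> proj j y)"
    using assms proj_closed proj_props(2) by (subst M.finsum_addf) auto
qed (use assms proj_props(1) gr_closed(2) in auto)

lemma proj_smult:
  assumes "x \<in> carrier A" "j \<le> n"
  shows "proj j (r \<odot> x) = r \<odot> proj j x"
proof (rule proj_unique [of "\<lambda>j. r \<odot> proj j x"])
  have "r \<odot> (\<Oplus>j\<in>{..n}. proj j x) = (\<Oplus>j\<in>{..n}. r \<odot> proj j x)"
    using assms proj_closed by (intro finsum_smult_ldistr) auto
  then show "r \<odot> x = (\<Oplus>j\<in>{..n}. r \<odot> proj j x)"
    using proj_props(2) [OF assms(1)] by simp
qed (use assms proj_props(1) gr_closed(3) in auto)

lemma proj_homogeneous:
  assumes "x \<in> gr d" "j \<le> n"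
  shows "proj j x = (if d = 2 * j then x else \<zero>)"
proof (cases "x = \<zero>")
  case True
  have "proj j \<zero> = \<zero>"
    using assms gr_closed(4) by (intro proj_unique [of "\<lambda>_. \<zero>"]) auto
  with True show ?thesis by simp
next
  case False
  then have "even d" "d \<le> 2 * n"
    using gr_trivial [of d] assms by force+
  then obtain i where i: "d = 2 * i" "i \<le> n"
    by (auto elim!: evenE)
  have "x \<in> carrier A"
    using assms gr_closed(1) by blast
  then have "x = (\<Oplus>j\<in>{..n}. if i = j then x else \<zero>)"
    using i by (subst M.add.finprod_singleton) auto
  then have "proj j x = (if i = j then x else \<zero>)"
    using assms i gr_closed(4) by (intro proj_unique) auto
  then show ?thesis
    using i by simp
qed

text \<open>The integral extended by zero on the lower degrees, so that it applies to inhomogeneous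
  elements.\<close>

definition functional :: "'a \<Rightarrow> real" where
  "functional x = intg (proj n x)"

lemma functional_add:
  "x \<in> carrier A \<Longrightarrow> y \<in> carrier A \<Longrightarrow> functional (x \<oplus> y) = functional x + functional y"
  by (simp add: functional_def proj_add proj_props(1) intg_add)

lemma functional_smult: "x \<in> carrier A \<Longrightarrow> functional (r \<odot> x) = r * functional x"
  by (simp add: functional_def proj_smult proj_props(1) intg_smult)

lemma functional_zero: "functional \<zero> = 0"
  using functional_smult [of "\<zero>" 0] real_smult(5) [of \<zero>] by simp

lemma functional_homogeneous: "x \<in> gr d \<Longrightarrow> functional x = (if d = 2 * n then intg x else 0)"
  using proj_homogeneous [of x d n] functional_zero proj_homogeneous [of \<zero> 0 n] gr_closed(4) [of 0]
  by (auto simp: functional_def)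

lemma functional_finsum:
  assumes "finite S" "f \<in> S \<rightarrow> carrier A"
  shows "functional (\<Oplus>s\<in>S. f s) = (\<Sum>s\<in>S. functional (f s))"
  using assms by (induction S rule: finite_induct) (auto simp: functional_zero functional_add)

text \<open>Multiplying by an element of degree 2n - 2p brings exactly the component
  \<open>proj p x\<close> into the top degree, so each component is covered by
  \<open>nondegenerate\<close>.\<close>

lemma functional_nondegenerate:
  assumes "x \<in> carrier A" "\<And>y. y \<in> carrier A \<Longrightarrow> functional (x \<otimes> y) = 0"
  shows "x = \<zero>"
proof -
  have "proj p x = \<zero>" if "p \<le> n" for p
  proof (rule nondegenerate [OF \<open>p \<le> n\<close> proj_props(1)]; (intro ballI)?)
    fix b assume b: "b \<in> gr (2 * n - 2 * p)"
    then have "b \<in> carrier A"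
      by (rule gr_closed(1))
    have mult: "proj j x \<otimes> b \<in> gr (2 * j + (2 * n - 2 * p))" if "j \<le> n" for j
      using that assms(1) b by (intro gr_mult proj_props(1))
    have "0 = functional (x \<otimes> b)"
      using assms \<open>b \<in> carrier A\<close> by simp
    also have "x \<otimes> b = (\<Oplus>j\<in>{..n}. proj j x) \<otimes> b"
      using proj_props(2) [OF assms(1)] by simp
    also have "\<dots> = (\<Oplus>j\<in>{..n}. proj j x \<otimes> b)"
      using assms(1) \<open>b \<in> carrier A\<close> proj_closed by (intro finsum_ldistr) auto
    also have "functional \<dots> = (\<Sum>j\<in>{..n}. functional (proj j x \<otimes> b))"
      using assms(1) \<open>b \<in> carrier A\<close> proj_closed by (intro functional_finsum) auto
    also have "\<dots> = (\<Sum>j\<in>{..n}. if j = p then intg (proj p x \<otimes> b) else 0)"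
      using functional_homogeneous [OF mult] \<open>p \<le> n\<close> by (intro sum.cong) auto
    finally show "intg (proj p x \<otimes> b) = 0"
      using \<open>p \<le> n\<close> by simp
  qed (use assms that in auto)
  then have "(\<Oplus>j\<in>{..n}. proj j x) = \<zero>"
    by (intro M.add.finprod_one_eqI) auto
  then show ?thesis
    using proj_props(2) [OF assms(1)] by simp
qed

end

section \<open>The ring of differential operators and its evaluation in the algebra\<close>

lemma mpolys_induct [consumes 1, case_names zero add]:
  assumes "p \<in> mpolys m" "P 0"
    and "\<And>p t a. p \<in> mpolys m \<Longrightarrow> Poly_Mapping.keys t \<subseteq> {..<m} \<Longrightarrow> P p \<Longrightarrow> P (Poly_Mapping.single t a + p)"
  shows "P p"
proof -
  have "P (\<Sum>t\<in>S. Poly_Mapping.single t (Poly_Mapping.lookup p t)) \<and>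
      (\<Sum>t\<in>S. Poly_Mapping.single t (Poly_Mapping.lookup p t)) \<in> mpolys m"
    if "S \<subseteq> Poly_Mapping.keys p" for S
    using finite_subset [OF that finite_keys] that
  proof (induction S rule: finite_induct)
    case (insert t S)
    let ?q = "\<Sum>t\<in>S. Poly_Mapping.single t (Poly_Mapping.lookup p t)"
    have t: "Poly_Mapping.keys t \<subseteq> {..<m}"
      using insert assms(1) by (auto simp: mpolys_def)
    moreover have "Poly_Mapping.single t (Poly_Mapping.lookup p t) + ?q \<in> mpolys m"
      using insert t Poly_Mapping.keys_add [of "Poly_Mapping.single t (Poly_Mapping.lookup p t)" ?q]
      by (auto simp: mpolys_def split: if_splits)
    ultimately show ?case
      using insert by (simp add: assms(3))
  qed (simp add: assms mpolys_def)
  from this [of "Poly_Mapping.keys p"] have "P (\<Sum>t\<in>Poly_Mapping.keys p. Poly_Mapping.single t (Poly_Mapping.lookup p t))"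
    by simp
  also have "(\<Sum>t\<in>Poly_Mapping.keys p. Poly_Mapping.single t (Poly_Mapping.lookup p t)) = p"
    by (rule poly_mapping_eqI) (simp add: lookup_sum lookup_single when_def in_keys_iff)
  finally show ?thesis .
qed

lemma mpolys_closed:
  "0 \<in> mpolys m" "1 \<in> mpolys m" "p \<in> mpolys m \<Longrightarrow> q \<in> mpolys m \<Longrightarrow> p + q \<in> mpolys m"
  "p \<in> mpolys m \<Longrightarrow> - p \<in> mpolys m" "p \<in> mpolys m \<Longrightarrow> q \<in> mpolys m \<Longrightarrow> p * q \<in> mpolys m"
proof -
  show "p \<in> mpolys m \<Longrightarrow> q \<in> mpolys m \<Longrightarrow> p + q \<in> mpolys m"
    using Poly_Mapping.keys_add [of p q] by (auto simp: mpolys_def)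
  show "p * q \<in> mpolys m" if "p \<in> mpolys m" "q \<in> mpolys m"
  proof -
    have "Poly_Mapping.keys t \<subseteq> {..<m}" if t: "t \<in> Poly_Mapping.keys (p * q)" for t
    proof -
      obtain a b where "t = a + b" "a \<in> Poly_Mapping.keys p" "b \<in> Poly_Mapping.keys q"
        using keys_mult [of p q] t by blast
      with \<open>p \<in> mpolys m\<close> \<open>q \<in> mpolys m\<close> show ?thesis
        by (simp add: mpolys_def keys_add_nat)
    qed
    then show ?thesis
      by (simp add: mpolys_def)
  qed
qed (auto simp: mpolys_def simp flip: single_one)

lemma single_mpolys: "Poly_Mapping.keys t \<subseteq> {..<m} \<Longrightarrow> Poly_Mapping.single t a \<in> mpolys m"
  by (auto simp: mpolys_def)

lemma cring_diff_ring: "cring (diff_ring m)"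
proof (rule cringI)
  show "abelian_group (diff_ring m)"
    by (rule abelian_groupI)
      (auto simp: diff_ring_def mpolys_closed ac_simps intro!: bexI [of _ "- _"])
  show "comm_monoid (diff_ring m)"
    by (rule comm_monoidI) (auto simp: diff_ring_def mpolys_closed ac_simps)
qed (auto simp: diff_ring_def algebra_simps)

text \<open>Finitely many elements of degree 2, continued by zero so that power products with a
  foreign variable vanish.\<close>

locale marked_poincare_duality_algebra = poincare_duality_algebra +
  fixes gen :: "nat \<Rightarrow> 'a" and m :: nat
  assumes gen_gr: "gen i \<in> gr 2" and gen_zero: "m \<le> i \<Longrightarrow> gen i = \<zero>"
begin

lemma gen_closed [simp]: "gen i \<in> carrier A"
  using gen_gr by (rule gr_closed(1))

definition power_product :: "(nat \<Rightarrow>\<^sub>0 nat) \<Rightarrow> 'a" where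
  "power_product t = (\<Otimes>i\<in>Poly_Mapping.keys t. gen i [^] Poly_Mapping.lookup t i)"

lemma power_product_superset:
  "finite S \<Longrightarrow> Poly_Mapping.keys t \<subseteq> S \<Longrightarrow> power_product t = (\<Otimes>i\<in>S. gen i [^] Poly_Mapping.lookup t i)"
  unfolding power_product_def
  by (intro finprod_mono_neutral_cong_left) (auto simp: in_keys_iff)

lemma power_product_closed [simp]: "power_product t \<in> carrier A"
  unfolding power_product_def by (intro finprod_closed) auto

lemma power_product_0 [simp]: "power_product 0 = \<one>"
  by (simp add: power_product_def)

lemma power_product_add: "power_product (s + t) = power_product s \<otimes> power_product t"
proof -
  let ?S = "Poly_Mapping.keys s \<union> Poly_Mapping.keys t"
  have "power_product (s + t) = (\<Otimes>i\<in>?S. gen i [^] Poly_Mapping.lookup s i \<otimes> gen i [^] Poly_Mapping.lookup t i)"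
    by (subst power_product_superset [of ?S]) (auto simp: keys_add_nat lookup_add nat_pow_mult)
  also have "\<dots> = (\<Otimes>i\<in>?S. gen i [^] Poly_Mapping.lookup s i) \<otimes> (\<Otimes>i\<in>?S. gen i [^] Poly_Mapping.lookup t i)"
    by (intro finprod_multf) auto
  finally show ?thesis
    by (simp add: power_product_superset [of ?S])
qed

lemma power_product_single [simp]: "power_product (Poly_Mapping.single i 1) = gen i"
  by (simp add: power_product_def)

lemma power_product_gr: "power_product t \<in> gr (2 * mdeg t)"
proof -
  have pow: "gen i [^] (k::nat) \<in> gr (2 * k)" for i k
  proof (induction k)
    case (Suc k)
    then show ?case
      using gr_mult [OF Suc gen_gr [of i]] by (simp add: add.commute)
  qed (simp add: gr_one)
  have "(\<Otimes>i\<in>S. gen i [^] Poly_Mapping.lookup t i) \<in> gr (2 * (\<Sum>i\<in>S. Poly_Mapping.lookup t i))"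
    if "finite S" for S
    using that
  proof (induction S rule: finite_induct)
    case (insert i S)
    then show ?case
      using gr_mult [OF pow insert.IH] by (simp add: distrib_left)
  qed (simp add: gr_one)
  then show ?thesis
    by (simp add: power_product_def mdeg_def)
qed

lemma power_product_zero:
  assumes "\<not> Poly_Mapping.keys t \<subseteq> {..<m}"
  shows "power_product t = \<zero>"
proof -
  obtain i where i: "i \<in> Poly_Mapping.keys t" "m \<le> i"
    using assms by force
  have "t = (t - Poly_Mapping.single i 1) + Poly_Mapping.single i 1"
    using diff_single_add [OF i(1)] by simp
  then show ?thesis
    using gen_zero [OF i(2)] power_product_add power_product_single power_product_closed r_null by metis
qed

definition eval_at :: "mpoly \<Rightarrow> 'a" where
  "eval_at p = (\<Oplus>t\<in>Poly_Mapping.keys p. Poly_Mapping.lookup p t \<odot> power_product t)"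

lemma eval_at_superset:
  "finite T \<Longrightarrow> Poly_Mapping.keys p \<subseteq> T \<Longrightarrow> eval_at p = (\<Oplus>t\<in>T. Poly_Mapping.lookup p t \<odot> power_product t)"
  unfolding eval_at_def
  by (intro M.add.finprod_mono_neutral_cong_left) (auto simp: in_keys_iff real_smult)

lemma eval_at_closed [simp]: "eval_at p \<in> carrier A"
  unfolding eval_at_def by (intro M.finsum_closed) (auto simp: real_smult)

lemma eval_at_0 [simp]: "eval_at 0 = \<zero>"
  by (simp add: eval_at_def)

lemma eval_at_single: "eval_at (Poly_Mapping.single t a) = a \<odot> power_product t"
  by (cases "a = 0") (simp_all add: eval_at_def real_smult)

lemma eval_at_add: "eval_at (p + q) = eval_at p \<oplus> eval_at q"
proof -
  let ?T = "Poly_Mapping.keys p \<union> Poly_Mapping.keys q"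
  have "eval_at (p + q) = (\<Oplus>t\<in>?T. Poly_Mapping.lookup p t \<odot> power_product t \<oplus> Poly_Mapping.lookup q t \<odot> power_product t)"
    using Poly_Mapping.keys_add [of p q]
    by (subst eval_at_superset [of ?T]) (auto simp: lookup_add real_smult)
  also have "\<dots> = (\<Oplus>t\<in>?T. Poly_Mapping.lookup p t \<odot> power_product t) \<oplus> (\<Oplus>t\<in>?T. Poly_Mapping.lookup q t \<odot> power_product t)"
    by (intro M.finsum_addf) (auto simp: real_smult)
  finally show ?thesis
    by (simp add: eval_at_superset [of ?T])
qed

lemma eval_at_mult:
  assumes "p \<in> mpolys k" "q \<in> mpolys k"
  shows "eval_at (p * q) = eval_at p \<otimes> eval_at q"
proof -
  have single: "eval_at (Poly_Mapping.single t a * q) = (a \<odot> power_product t) \<otimes> eval_at q" for t a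
    using assms(2)
  proof (induction q rule: mpolys_induct)
    case (add q s b)
    have "eval_at (Poly_Mapping.single t a * Poly_Mapping.single s b) =
        (a \<odot> power_product t) \<otimes> (b \<odot> power_product s)"
      by (simp add: mult_single eval_at_single power_product_add real_smult real_smult_mult)
        (metis mult.commute real_smult(3) m_closed power_product_closed)
    then show ?case
      using add by (simp add: distrib_left eval_at_add eval_at_single r_distr real_smult)
  qed (simp add: real_smult)
  show ?thesis
    using assms(1)
  proof (induction p rule: mpolys_induct)
    case (add p t a)
    then show ?case
      by (simp add: distrib_right eval_at_add eval_at_single l_distr real_smult single)
  qed simp
qed

lemma eval_at_1: "eval_at 1 = \<one>"
  using eval_at_single [of 0 1] by (simp add: real_smult)

lemma ring_hom_eval_at: "ring_hom_ring (diff_ring m) A eval_at"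
  by (rule ring_hom_ringI)
    (use cring_diff_ring in \<open>auto simp: diff_ring_def eval_at_mult eval_at_add eval_at_1 cring_def M_cring
      cring.axioms(1) [OF M_cring]\<close>)

lemma functional_power_product:
  "functional (power_product t) = (if mdeg t = n then intg (power_product t) else 0)"
  using functional_homogeneous [OF power_product_gr [of t]] by simp

lemma functional_power_product_outside:
  "t \<notin> exponents m n \<Longrightarrow> functional (power_product t) = 0"
  using power_product_zero [of t] functional_zero functional_power_product [of t]
  by (cases "Poly_Mapping.keys t \<subseteq> {..<m}") (simp_all add: exponents_def)

lemma functional_eval_at_mult:
  assumes "y \<in> carrier A"
  shows "functional (eval_at D \<otimes> y) =
    (\<Sum>t\<in>Poly_Mapping.keys D. Poly_Mapping.lookup D t * functional (power_product t \<otimes> y))"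
proof -
  have "eval_at D \<otimes> y = (\<Oplus>t\<in>Poly_Mapping.keys D. (Poly_Mapping.lookup D t \<odot> power_product t) \<otimes> y)"
    unfolding eval_at_def using assms by (intro finsum_ldistr) (auto simp: real_smult)
  then have "functional (eval_at D \<otimes> y) =
      (\<Sum>t\<in>Poly_Mapping.keys D. functional ((Poly_Mapping.lookup D t \<odot> power_product t) \<otimes> y))"
    using assms by (simp only:) (intro functional_finsum, auto simp: real_smult)
  then show ?thesis
    using assms by (simp add: real_smult_mult functional_smult)
qed

text \<open>Macaulay duality. By nondegeneracy \<open>eval_at D\<close> is zero iff the functional
  vanishes on its products with all power products, as these span by \<open>surj\<close>; written
  out, those are the equations that describe the annihilator.\<close>

lemma kernel_eval_at:
  assumes surj: "eval_at ` mpolys m = carrier A"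
  shows "a_kernel (diff_ring m) A eval_at =
    Ann m (macaulay_dual m n (\<lambda>t. functional (power_product t)))"
proof -
  have "eval_at D = \<zero> \<longleftrightarrow>
    (\<forall>s. (\<Sum>t\<in>Poly_Mapping.keys D. Poly_Mapping.lookup D t * functional (power_product (s + t))) = 0)" for D
  proof -
    have eq: "(\<Sum>t\<in>Poly_Mapping.keys D. Poly_Mapping.lookup D t * functional (power_product (s + t))) =
        functional (eval_at D \<otimes> power_product s)" for s
      by (simp add: functional_eval_at_mult power_product_add m_comm)
    show ?thesis
      unfolding eq
    proof
      assume *: "\<forall>s. functional (eval_at D \<otimes> power_product s) = 0"
      show "eval_at D = \<zero>"
      proof (rule functional_nondegenerate)
        fix y assume "y \<in> carrier A"
        then obtain q where y: "y = eval_at q"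
          using surj by blast
        have "functional (eval_at D \<otimes> y) = functional (eval_at q \<otimes> eval_at D)"
          unfolding y by (simp add: m_comm)
        also have "\<dots> = 0"
          unfolding functional_eval_at_mult [OF eval_at_closed] using * by (simp add: m_comm)
        finally show "functional (eval_at D \<otimes> y) = 0" .
      qed simp
    qed (simp add: functional_zero)
  qed
  then show ?thesis
    by (auto simp: Ann_macaulay_dual functional_power_product_outside a_kernel_def' diff_ring_def)
qed

text \<open>Power products are homogeneous, so projecting the value amounts to keeping the monomials
  of degree \<open>j\<close>.\<close>

lemma eval_at_homogeneous_part:
  assumes "p \<in> mpolys m" "j \<le> n"
  shows "\<exists>q\<in>mpolys m. (\<forall>t\<in>Poly_Mapping.keys q. mdeg t = j) \<and> eval_at q = proj j (eval_at p)"
  using assms(1)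
proof (induction p rule: mpolys_induct)
  case zero
  then show ?case
    using proj_homogeneous [of \<zero> "2 * j" j] gr_closed(4) \<open>j \<le> n\<close> by (intro bexI [of _ 0]) (auto simp: mpolys_closed)
next
  case (add p t a)
  then obtain q where q: "q \<in> mpolys m" "\<forall>t\<in>Poly_Mapping.keys q. mdeg t = j" "eval_at q = proj j (eval_at p)"
    by blast
  let ?r = "Poly_Mapping.single t (if mdeg t = j then a else 0)"
  have "proj j (eval_at (Poly_Mapping.single t a)) = eval_at ?r"
    using proj_homogeneous [OF gr_closed(3) [OF power_product_gr [of t]] \<open>j \<le> n\<close>]
    by (simp add: eval_at_single real_smult)
  then have "eval_at (?r + q) = proj j (eval_at (Poly_Mapping.single t a + p))"
    using q \<open>j \<le> n\<close> by (simp add: eval_at_add proj_add)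
  moreover have "?r + q \<in> mpolys m"
    using q add by (intro mpolys_closed single_mpolys)
  moreover have "\<forall>s\<in>Poly_Mapping.keys (?r + q). mdeg s = j"
    using Poly_Mapping.keys_add [of ?r q] q by (auto split: if_splits)
  ultimately show ?case
    by blast
qed

lemma eval_at_homogeneous:
  assumes surj: "eval_at ` mpolys m = carrier A"
  shows "eval_at ` {p \<in> mpolys m. \<forall>t\<in>Poly_Mapping.keys p. 2 * mdeg t = d} = gr d"
proof (intro equalityI subsetI)
  fix x assume "x \<in> eval_at ` {p \<in> mpolys m. \<forall>t\<in>Poly_Mapping.keys p. 2 * mdeg t = d}"
  then obtain p where x: "x = eval_at p" and p: "\<forall>t\<in>Poly_Mapping.keys p. 2 * mdeg t = d"
    by auto
  have "(\<Oplus>t\<in>S. Poly_Mapping.lookup p t \<odot> power_product t) \<in> gr d" if "finite S" "S \<subseteq> Poly_Mapping.keys p" for S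
    using that
  proof (induction S rule: finite_induct)
    case (insert t S)
    moreover have "power_product t \<in> gr d"
      using insert p power_product_gr [of t] by auto
    ultimately show ?case
      by (subst M.finsum_insert) (auto simp: real_smult gr_closed(2,3))
  qed (simp add: gr_closed)
  then show "x \<in> gr d"
    by (simp add: x eval_at_def)
next
  fix x assume x: "x \<in> gr d"
  show "x \<in> eval_at ` {p \<in> mpolys m. \<forall>t\<in>Poly_Mapping.keys p. 2 * mdeg t = d}"
  proof (cases "odd d \<or> d > 2 * n")
    case True
    \<comment> \<open>The zero polynomial has no monomials and so counts as homogeneous of every
      degree.\<close>
    then have "x = eval_at 0"
      using x gr_trivial by auto
    then show ?thesis
      by (intro image_eqI [of _ _ 0]) (auto simp: mpolys_closed)
  next
    case False
    then obtain j where j: "d = 2 * j" "j \<le> n"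
      by (auto elim!: evenE)
    have "x \<in> eval_at ` mpolys m"
      unfolding surj using x by (rule gr_closed(1))
    then obtain p where "p \<in> mpolys m" "x = eval_at p"
      by blast
    then obtain q where "q \<in> mpolys m" "\<forall>t\<in>Poly_Mapping.keys q. mdeg t = j" "eval_at q = proj j x"
      using eval_at_homogeneous_part [OF _ j(2)] by blast
    then show ?thesis
      using proj_homogeneous [OF x j(2)] j by (intro image_eqI [of _ _ q]) auto
  qed
qed

end

section \<open>Realization by a multi-fan\<close>

definition moment_curve :: "nat \<Rightarrow> real^'n" where
  "moment_curve i = (\<chi> k. real i ^ idx k)"

text \<open>Pairing with a point of the moment curve evaluates the polynomial whose coefficients are
  the coordinates of the other vector. \<open>D\<close> comes from the Lagrange polynomial that is 1
  at \<open>i\<close> and 0 at the rest of \<open>I\<close>; its degree \<open>card I - 1\<close> is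
  below n.\<close>

lemma moment_curve_dual:
  assumes "finite I" "card I \<le> CARD('n)" "i \<in> I"
  shows "\<exists>D :: real^'n. D \<bullet> moment_curve i = 1 \<and> (\<forall>j\<in>I - {i}. D \<bullet> moment_curve j = 0)"
proof -
  define q where "q = (\<Prod>j\<in>I - {i}. [:- real j, 1:])"
  define D :: "real^'n" where "D = (\<chi> k. Polynomial.coeff q (idx k) / poly q (real i))"
  have "Polynomial.degree q = (\<Sum>j\<in>I - {i}. Polynomial.degree [:- real j, 1:])"
    unfolding q_def by (rule Polynomial.degree_prod_eq_sum_degree) simp
  then have "Polynomial.degree q = card I - 1"
    using assms by simp
  moreover have "card I > 0"
    using assms card_gt_0_iff by blast
  ultimately have deg: "Polynomial.degree q < CARD('n)"
    using assms by linarith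
  have D: "D \<bullet> moment_curve x = poly q (real x) / poly q (real i)" for x
  proof -
    have "D \<bullet> moment_curve x = (\<Sum>k\<in>UNIV. Polynomial.coeff q (idx (k::'n)) * real x ^ idx k) / poly q (real i)"
      by (simp add: D_def moment_curve_def inner_vec_def sum_divide_distrib)
    also have "(\<Sum>k\<in>UNIV. Polynomial.coeff q (idx (k::'n)) * real x ^ idx k) =
        (\<Sum>k<CARD('n). Polynomial.coeff q k * real x ^ k)"
      by (rule sum_idx)
    also have "\<dots> = (\<Sum>k\<le>Polynomial.degree q. Polynomial.coeff q k * real x ^ k)"
      using deg by (intro sum.mono_neutral_right) (auto simp: Polynomial.coeff_eq_0)
    also have "\<dots> = poly q (real x)"
      by (simp add: poly_altdef)
    finally show ?thesis .
  qed
  have "poly q (real i) \<noteq> 0"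
    using assms by (auto simp: q_def Polynomial.poly_prod)
  moreover have "poly q (real j) = 0" if "j \<in> I - {i}" for j
    using assms that by (auto simp: q_def Polynomial.poly_prod intro!: prod_zero)
  ultimately show ?thesis
    using D by (intro exI [of _ D]) simp
qed

text \<open>Biorthogonality makes one matrix a one-sided inverse of the other; for square matrices
  it is two-sided, and the other product gives the expansion.\<close>

lemma dual_basis_expansion:
  fixes D lam :: "nat \<Rightarrow> real^'n"
  assumes "\<And>j k. j < CARD('n) \<Longrightarrow> k < CARD('n) \<Longrightarrow> D k \<bullet> lam j = (if j = k then 1 else 0)"
  shows "(\<Sum>k<CARD('n). (D k \<bullet> v) *\<^sub>R lam k) = v"
proof -
  let ?D = "(\<chi> k. D (idx k)) :: real^'n^'n" and ?L = "(\<chi> k. lam (idx k)) :: real^'n^'n"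
  have "(?D ** transpose ?L) $ i $ j = D (idx i) \<bullet> lam (idx j)" for i j
    by (simp add: matrix_matrix_mult_def transpose_def inner_vec_def)
  also have "D (idx i) \<bullet> lam (idx j) = (mat 1 :: real^'n^'n) $ i $ j" for i j
    using assms [of "idx j" "idx i"] idx_less [of i] idx_less [of j] idx_eq_iff [of j i]
    by (auto simp: mat_def)
  finally have "?D ** transpose ?L = mat 1"
    by (simp add: vec_eq_iff)
  then have "transpose ?L ** ?D = mat 1"
    by (simp add: matrix_left_right_inverse)
  then have "v = transpose ?L *v (?D *v v)"
    by (simp add: matrix_vector_mul_assoc)
  also have "\<dots> = (\<Sum>k\<in>UNIV. (D (idx (k::'n)) \<bullet> v) *\<^sub>R lam (idx k))"
    by (simp add: matrix_mult_sum scalar_mult_eq_scaleR column_def transpose_def)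
      (simp add: matrix_vector_mult_def inner_vec_def mult.commute)
  also have "\<dots> = (\<Sum>k<CARD('n). (D k \<bullet> v) *\<^sub>R lam k)"
    by (rule sum_idx)
  finally show ?thesis ..
qed

section \<open>Finitely many generators in degree 2\<close>

context poincare_duality_algebra
begin

lemma proj_finsum:
  assumes "finite S" "f \<in> S \<rightarrow> carrier A" "j \<le> n"
  shows "proj j (\<Oplus>s\<in>S. f s) = (\<Oplus>s\<in>S. proj j (f s))"
  using assms(1,2)
proof (induction S rule: finite_induct)
  case empty
  then show ?case
    using proj_homogeneous [OF gr_closed(4) \<open>j \<le> n\<close>] by auto
next
  case (insert s S)
  then have "f s \<in> carrier A" "f \<in> S \<rightarrow> carrier A" "proj j (f s) \<in> carrier A" "(\<lambda>s. proj j (f s)) \<in> S \<rightarrow> carrier A"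
    using proj_closed \<open>j \<le> n\<close> by auto
  with insert \<open>j \<le> n\<close> show ?case
    by (simp add: proj_add)
qed

text \<open>The degree 2 components of a finite spanning set of the whole algebra serve as
  generators; \<open>n \<ge> 1\<close> makes degree 2 one of the graded pieces.\<close>

lemma gr_2_finite_dim:
  assumes "n \<ge> 1"
  obtains S h where "finite S" "\<And>s. s \<in> S \<Longrightarrow> h s \<in> gr 2"
    "\<And>x. x \<in> gr 2 \<Longrightarrow> \<exists>r :: 'a \<Rightarrow> real. x = (\<Oplus>s\<in>S. r s \<odot> h s)"
proof -
  obtain S where S: "finite S" "S \<subseteq> carrier A"
    and span: "\<And>x. x \<in> carrier A \<Longrightarrow> \<exists>r :: 'a \<Rightarrow> real. x = (\<Oplus>s\<in>S. r s \<odot> s)"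
    using finite_dim by blast
  show ?thesis
  proof (rule that [of S "proj 1"])
    show "proj 1 s \<in> gr 2" if "s \<in> S" for s
      using proj_props(1) [of s 1] that S \<open>n \<ge> 1\<close> by auto
    fix x assume x: "x \<in> gr 2"
    then obtain r where r: "x = (\<Oplus>s\<in>S. r s \<odot> s)"
      using span gr_closed(1) by blast
    have "x = proj 1 x"
      using proj_homogeneous [OF x \<open>n \<ge> 1\<close>] by simp
    also have "\<dots> = (\<Oplus>s\<in>S. proj 1 (r s \<odot> s))"
      unfolding r using S \<open>n \<ge> 1\<close> by (intro proj_finsum) (auto simp: real_smult)
    also have "\<dots> = (\<Oplus>s\<in>S. r s \<odot> proj 1 s)"
      using S \<open>n \<ge> 1\<close> proj_closed
      by (intro M.finsum_cong') (auto simp: proj_smult subset_eq intro!: real_smult(1))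
    finally show "\<exists>r. x = (\<Oplus>s\<in>S. r s \<odot> proj 1 s)"
      by blast
  qed (rule S)
qed

end

text \<open>The image of evaluation is a subring and a subspace, and it contains \<open>gr 2\<close>
  because it contains a spanning family of it.\<close>

lemma (in marked_poincare_duality_algebra) eval_at_surj:
  assumes "generated_in_degree_2 A gr" "finite S" "h ` S \<subseteq> gen ` {..<m}"
    and "\<And>x. x \<in> gr 2 \<Longrightarrow> \<exists>r :: 'b \<Rightarrow> real. x = (\<Oplus>s\<in>S. r s \<odot> h s)"
  shows "eval_at ` mpolys m = carrier A"
proof -
  let ?E = "eval_at ` mpolys m"
  have minus: "\<ominus> x = (- 1) \<odot> x" if "x \<in> carrier A" for x
  proof (rule M.minus_equality)
    show "(- 1) \<odot> x \<oplus> x = \<zero>"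
      using real_smult(2) [OF that, of "- 1" 1] that by (simp add: real_smult)
  qed (use that real_smult(1) in auto)
  have add: "x \<oplus> y \<in> ?E" if "x \<in> ?E" "y \<in> ?E" for x y
    using that by (auto simp: image_iff simp flip: eval_at_add intro!: bexI [of _ "_ + _"] mpolys_closed)
  have mult: "x \<otimes> y \<in> ?E" if "x \<in> ?E" "y \<in> ?E" for x y
    using that by (auto simp: image_iff simp flip: eval_at_mult intro!: bexI [of _ "_ * _"] mpolys_closed)
  have smult: "r \<odot> x \<in> ?E" if x: "x \<in> ?E" for r x
  proof -
    have "r \<odot> x = eval_at (Poly_Mapping.single 0 r) \<otimes> x"
      using x by (auto simp: eval_at_single real_smult real_smult_mult)
    also have "\<dots> \<in> ?E"
      using x by (intro mult imageI single_mpolys) auto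
    finally show ?thesis .
  qed
  have zero: "\<zero> \<in> ?E"
    by (intro image_eqI [of _ _ 0]) (auto simp: mpolys_closed)
  have one: "\<one> \<in> ?E"
    by (intro image_eqI [of _ _ 1]) (auto simp: mpolys_closed eval_at_1)
  have carrier: "?E \<subseteq> carrier A"
    by auto
  have neg: "\<ominus> x \<in> ?E" if "x \<in> ?E" for x
    using smult [OF that] minus that carrier by auto
  have "subring ?E A"
    by (rule ring.subringI [OF cring.axioms(1) [OF M_cring] carrier one neg mult add])
  moreover have "submodule ?E real_field A"
    by (rule submoduleI [OF carrier zero neg add smult])
  moreover have "gr 2 \<subseteq> ?E"
  proof
    fix x assume "x \<in> gr 2"
    then obtain r where r: "x = (\<Oplus>s\<in>S. r s \<odot> h s)"
      using assms(4) by blast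
    have h: "h s \<in> ?E" if "s \<in> S" for s
    proof -
      obtain i where "i < m" "h s = gen i"
        using assms(3) \<open>s \<in> S\<close> by auto
      then show ?thesis
        using eval_at_single [of "Poly_Mapping.single i 1" 1]
        by (intro image_eqI [of _ _ "Poly_Mapping.single (Poly_Mapping.single i 1) 1"] single_mpolys)
          (auto simp: real_smult simp del: One_nat_def)
    qed
    have "(\<Oplus>s\<in>T. r s \<odot> h s) \<in> ?E" if "T \<subseteq> S" for T
      using finite_subset [OF that \<open>finite S\<close>] that
    proof (induction T rule: finite_induct)
      case (insert s T)
      then have "h s \<in> carrier A" "h \<in> T \<rightarrow> carrier A"
        using h carrier by blast+
      with insert h show ?case
        by (subst M.finsum_insert) (auto simp: real_smult intro!: add smult)
    qed (simp add: zero)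
    then show "x \<in> ?E"
      by (simp add: r)
  qed
  ultimately show ?thesis
    using assms(1) unfolding generated_in_degree_2_def by blast
qed

text \<open>Existence comes from the tuple formula for the volume and the multinomial theorem;
  uniqueness, which \<open>THE\<close> requires, from the fact that a polynomial is determined by
  its values.\<close>

lemma (in weighted_vectors) volume_polynomial_w:
  assumes "\<And>t. t \<notin> exponents m CARD('n) \<Longrightarrow> g t = 0"
  shows "volume_polynomial m w lam = macaulay_dual m CARD('n) g"
proof -
  let ?V = "macaulay_dual m CARD('n) g"
  have "is_volume_polynomial m w lam ?V"
    unfolding is_volume_polynomial_def
  proof (intro conjI allI)
    show "?V \<in> mpolys m" "homogeneous CARD('n) ?V"
      using keys_macaulay_dual [of m "CARD('n)" g]
      by (auto simp: mpolys_def homogeneous_def exponents_def mdeg_def)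
    show "eval_mpoly ?V c = multi_polytope_volume m w lam c" for c
      unfolding multi_polytope_volume_tuples sum_tuples_exponents eval_macaulay_dual by simp
  qed
  then show ?thesis
    unfolding volume_polynomial_def
    by (intro the_equality) (auto simp: is_volume_polynomial_def intro: eval_mpoly_inject)
qed

text \<open>By \<open>V\<close> the annihilator is the kernel of evaluation, so the first
  isomorphism theorem applies. The map \<open>\<phi>\<close> is the inverse of the induced
  isomorphism and sends \<open>eval_at p\<close> to the coset of \<open>p\<close>, from which
  scalars and degrees are read off.\<close>

lemma (in marked_poincare_duality_algebra) isomorphic_multi_fan_algebra:
  assumes surj: "eval_at ` mpolys m = carrier A"
    and V: "volume_polynomial m w lam = macaulay_dual m n (\<lambda>t. functional (power_product t))"
  shows "graded_algebra_isomorphic A gr (multi_fan_algebra m w lam) (multi_fan_grading m w lam)"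
proof -
  let ?D = "diff_ring m" and ?M = "multi_fan_algebra m w lam"
  define I where "I = Ann m (volume_polynomial m w lam)"
  define \<Phi> where "\<Phi> C = the_elem (eval_at ` C)" for C
  interpret h: ring_hom_ring ?D A eval_at
    by (rule ring_hom_eval_at)
  have I: "I = a_kernel ?D A eval_at"
    unfolding I_def V using kernel_eval_at [OF surj] by simp
  have carrier_D: "carrier ?D = mpolys m"
    by (simp add: diff_ring_def)
  have ideal: "ideal I ?D"
    unfolding I by (rule h.kernel_is_ideal)
  let ?Q = "?D Quot I"
  have ring_Q: "ring ?Q"
    by (rule ideal.quotient_is_ring [OF ideal])
  have M: "?M = \<lparr>carrier = carrier ?Q, mult = mult ?Q, one = one ?Q, zero = zero ?Q, add = add ?Q,
       smult = (\<lambda>r C. (I +>\<^bsub>?D\<^esub> Poly_Mapping.single 0 r) \<otimes>\<^bsub>?Q\<^esub> C)\<rparr>"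
    by (simp add: multi_fan_algebra_def I_def Let_def)
  have iso: "\<Phi> \<in> ring_iso ?Q A"
    unfolding \<Phi>_def I by (rule h.FactRing_iso_set) (simp add: carrier_D surj)
  have coset: "I +>\<^bsub>?D\<^esub> p \<in> carrier ?Q" "\<Phi> (I +>\<^bsub>?D\<^esub> p) = eval_at p" if "p \<in> mpolys m" for p
    using that unfolding \<Phi>_def I
    by (auto simp: FactRing_def A_RCOSETS_def' carrier_D intro!: h.the_elem_simp)
  define \<phi> where "\<phi> = inv_into (carrier ?Q) \<Phi>"
  have "\<phi> \<in> ring_iso A ?Q"
    unfolding \<phi>_def by (rule ring_iso_set_sym [OF ring_Q iso])
  then have "\<phi> \<in> ring_iso A ?M"
    by (simp add: M ring_iso_def ring_hom_def)
  have \<phi>: "\<phi> (eval_at p) = I +>\<^bsub>?D\<^esub> p" if "p \<in> mpolys m" for p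
  proof -
    have "inj_on \<Phi> (carrier ?Q)"
      using iso by (auto simp: ring_iso_def bij_betw_def)
    then have "inv_into (carrier ?Q) \<Phi> (\<Phi> (I +>\<^bsub>?D\<^esub> p)) = I +>\<^bsub>?D\<^esub> p"
      using coset(1) [OF that] by (rule inv_into_f_f)
    then show ?thesis
      unfolding coset(2) [OF that] \<phi>_def .
  qed
  have "\<phi> (r \<odot> x) = r \<odot>\<^bsub>?M\<^esub> \<phi> x" if "x \<in> carrier A" for r x
  proof -
    have "x \<in> eval_at ` mpolys m"
      unfolding surj by (rule that)
    then obtain p where p: "p \<in> mpolys m" "x = eval_at p"
      by blast
    have s: "Poly_Mapping.single 0 r \<in> mpolys m"
      by (intro single_mpolys) simp
    have "r \<odot> x = eval_at (Poly_Mapping.single 0 r * p)"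
      using p by (simp add: eval_at_mult [OF s p(1)] eval_at_single real_smult real_smult_mult)
    then have "\<phi> (r \<odot> x) = I +>\<^bsub>?D\<^esub> (Poly_Mapping.single 0 r * p)"
      using \<phi> [OF mpolys_closed(5) [OF s p(1)]] by simp
    also have "\<dots> = (I +>\<^bsub>?D\<^esub> Poly_Mapping.single 0 r) \<otimes>\<^bsub>?Q\<^esub> (I +>\<^bsub>?D\<^esub> p)"
      using ideal.rcoset_mult_add [OF ideal, of "Poly_Mapping.single 0 r" p] s p
      by (simp add: FactRing_def diff_ring_def)
    finally show ?thesis
      using \<phi> p by (simp add: M)
  qed
  moreover have "\<phi> ` gr d = multi_fan_grading m w lam d" for d
    unfolding eval_at_homogeneous [OF surj, symmetric] multi_fan_grading_def I_def [symmetric] image_image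
      carrier_D mdeg_def [symmetric]
    using \<phi> by (auto simp: image_iff)
  ultimately show ?thesis
    unfolding graded_algebra_isomorphic_def using \<open>\<phi> \<in> ring_iso A ?M\<close> by blast
qed

theorem theorem9p1:
  fixes A :: "(real, 'a) module" and gr :: "nat \<Rightarrow> 'a set" and intg :: "'a \<Rightarrow> real"
  assumes "poincare_duality_algebra A CARD('n::finite) gr intg"
    and "generated_in_degree_2 A gr"
  shows "\<exists>m w (lam :: nat \<Rightarrow> real ^ 'n).
    complete_multi_fan m w lam \<and>
    graded_algebra_isomorphic A gr (multi_fan_algebra m w lam) (multi_fan_grading m w lam)"
proof -
  let ?n = "CARD('n)" and ?lam = "moment_curve :: nat \<Rightarrow> real^'n"
  interpret A: poincare_duality_algebra A ?n gr intg
    by (rule assms(1))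
  have "?n \<ge> 1"
    by (simp add: Suc_leI)
  then obtain S h where S: "finite S" "\<And>s. s \<in> S \<Longrightarrow> h s \<in> gr 2"
    and span: "\<And>x. x \<in> gr 2 \<Longrightarrow> \<exists>r :: 'a \<Rightarrow> real. x = (\<Oplus>\<^bsub>A\<^esub>s\<in>S. r s \<odot>\<^bsub>A\<^esub> h s)"
    using A.gr_2_finite_dim by metis
  define q where "q = card S"
  obtain v where v: "bij_betw v {0..<q} S"
    unfolding q_def using ex_bij_betw_nat_finite [OF \<open>finite S\<close>] by blast
  define b where "b s = h (v s)" for s
  have b: "b s \<in> gr 2" if "s < q" for s
    using that v S(2) by (auto simp: b_def bij_betw_def)
  \<comment> \<open>The first n moment vectors form a basis, and \<open>D\<close> is the dual
    basis.\<close>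
  obtain D :: "nat \<Rightarrow> real^'n" where D: "\<And>k. k < ?n \<Longrightarrow> D k \<bullet> ?lam k = 1"
    "\<And>j k. j < ?n \<Longrightarrow> k < ?n \<Longrightarrow> j \<noteq> k \<Longrightarrow> D k \<bullet> ?lam j = 0"
  proof -
    have "\<forall>k\<in>{..<?n}. \<exists>D. D \<bullet> ?lam k = 1 \<and> (\<forall>j\<in>{..<?n} - {k}. D \<bullet> ?lam j = 0)"
      by (intro ballI moment_curve_dual) auto
    then show ?thesis
      using that by (metis Diff_iff lessThan_iff singletonD)
  qed
  \<comment> \<open>Pairing the desired relation \<Sum> \<lambda>_i \<otimes> x_i = 0 with
    \<open>D k\<close> expresses the \<open>k\<close>-th element by the ones from index n on. So the
    generators \<open>b\<close> are placed at the indices from n on, and the first n elements are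
    defined by these equations.\<close>
  define x where "x i = (if i < ?n then \<Oplus>\<^bsub>A\<^esub>s\<in>{..<q}. (- (D i \<bullet> ?lam (?n + s))) \<odot>\<^bsub>A\<^esub> b s
    else if i < ?n + q then b (i - ?n) else \<zero>\<^bsub>A\<^esub>)" for i
  have sum_gr: "(\<Oplus>\<^bsub>A\<^esub>s\<in>T. r s \<odot>\<^bsub>A\<^esub> b s) \<in> gr 2" if "finite T" "T \<subseteq> {..<q}" for T and r :: "nat \<Rightarrow> real"
    using that
  proof (induction T rule: finite_induct)
    case (insert s T)
    then have "b s \<in> carrier A" "b \<in> T \<rightarrow> carrier A"
      using b A.gr_closed(1) by blast+
    with insert b show ?case
      by (subst A.M.finsum_insert) (auto simp: A.real_smult A.gr_closed(2,3))
  qed (simp add: A.gr_closed)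
  interpret marked_poincare_duality_algebra A ?n gr intg x "?n + q"
    by unfold_locales (auto simp: x_def b A.gr_closed(4) intro!: sum_gr)
  define g where "g t = A.functional (power_product t)" for t
  have relation: "(\<Sum>i<?n + q. g (t + Poly_Mapping.single i 1) *\<^sub>R ?lam i) = 0" for t
  proof -
    define f where "f z = A.functional (power_product t \<otimes>\<^bsub>A\<^esub> z)" for z
    have b_closed: "b s \<in> carrier A" if "s < q" for s
      using b [OF that] by (rule A.gr_closed(1))
    have "f (x k) = - (\<Sum>s<q. (D k \<bullet> ?lam (?n + s)) * f (b s))" if "k < ?n" for k
    proof -
      have "power_product t \<otimes>\<^bsub>A\<^esub> x k =
          (\<Oplus>\<^bsub>A\<^esub>s\<in>{..<q}. power_product t \<otimes>\<^bsub>A\<^esub> ((- (D k \<bullet> ?lam (?n + s))) \<odot>\<^bsub>A\<^esub> b s))"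
        using that b_closed by (simp add: x_def) (intro A.finsum_rdistr, auto simp: A.real_smult)
      then have "f (x k) = (\<Sum>s<q. A.functional (power_product t \<otimes>\<^bsub>A\<^esub> ((- (D k \<bullet> ?lam (?n + s))) \<odot>\<^bsub>A\<^esub> b s)))"
        using b_closed unfolding f_def
        by (simp only:) (intro A.functional_finsum, auto simp: A.real_smult)
      also have "\<dots> = (\<Sum>s<q. - ((D k \<bullet> ?lam (?n + s)) * f (b s)))"
        using b_closed by (intro sum.cong) (auto simp: f_def A.real_smult_mult A.functional_smult)
      finally show ?thesis
        by (simp add: sum_negf)
    qed
    then have "(\<Sum>k<?n. f (x k) *\<^sub>R ?lam k) =
        - (\<Sum>s<q. f (b s) *\<^sub>R (\<Sum>k<?n. (D k \<bullet> ?lam (?n + s)) *\<^sub>R ?lam k))"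
      unfolding scaleR_sum_right
      by (subst sum.swap) (simp add: scaleR_sum_left sum_negf mult.commute)
    \<comment> \<open>The inner sums are the expansions of the later moment vectors in the basis of
      the first n.\<close>
    also have "\<dots> = - (\<Sum>s<q. f (b s) *\<^sub>R ?lam (?n + s))"
      using D by (subst dual_basis_expansion) auto
    finally have first: "(\<Sum>k<?n. f (x k) *\<^sub>R ?lam k) = - (\<Sum>s<q. f (b s) *\<^sub>R ?lam (?n + s))" .
    have "g (t + Poly_Mapping.single i 1) = f (x i)" for i
      unfolding g_def f_def power_product_add power_product_single ..
    then have "(\<Sum>i<?n + q. g (t + Poly_Mapping.single i 1) *\<^sub>R ?lam i) = (\<Sum>i<?n + q. f (x i) *\<^sub>R ?lam i)"
      by simp
    also have "\<dots> = (\<Sum>k<?n. f (x k) *\<^sub>R ?lam k) + (\<Sum>s<q. f (x (?n + s)) *\<^sub>R ?lam (?n + s))"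
      by (induction q) (simp_all add: add.assoc)
    also have "(\<Sum>s<q. f (x (?n + s)) *\<^sub>R ?lam (?n + s)) = (\<Sum>s<q. f (b s) *\<^sub>R ?lam (?n + s))"
      by (intro sum.cong) (auto simp: x_def)
    finally show ?thesis
      unfolding first by simp
  qed
  interpret F: weighted_vectors "?n + q" ?lam g
  proof
    show "\<exists>D. D \<bullet> ?lam i = 1 \<and> (\<forall>j\<in>I - {i}. D \<bullet> ?lam j = 0)"
      if "I \<subseteq> {..<?n + q}" "card I \<le> ?n" "i \<in> I" for I i
      using that finite_subset [OF that(1)] by (intro moment_curve_dual) auto
  qed (rule relation)
  have "h ` S \<subseteq> x ` {..<?n + q}"
  proof
    fix y assume "y \<in> h ` S"
    then obtain s where "s < q" "y = h (v s)"
      using v by (auto simp: bij_betw_def)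
    then have "y = x (?n + s)"
      by (simp add: x_def b_def)
    then show "y \<in> x ` {..<?n + q}"
      using \<open>s < q\<close> by auto
  qed
  then have surj: "eval_at ` mpolys (?n + q) = carrier A"
    by (rule eval_at_surj [OF assms(2) \<open>finite S\<close> _ span])
  have "volume_polynomial (?n + q) F.w ?lam = macaulay_dual (?n + q) ?n g"
    by (rule F.volume_polynomial_w) (simp add: g_def functional_power_product_outside)
  then have "graded_algebra_isomorphic A gr (multi_fan_algebra (?n + q) F.w ?lam) (multi_fan_grading (?n + q) F.w ?lam)"
    unfolding g_def by (rule isomorphic_multi_fan_algebra [OF surj])
  then show ?thesis
    using F.complete_multi_fan_w by blast
qed

end
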